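(* Let $m,n\ge2$, $m\ne n$, $l\ge1$, $\lambda\in\mathbb{C}$, and let $M$ be a right $H^{\deg}_\lambda(S_l)$-module. Then an action of $Y_\lambda(\mathfrak{sl}(m|n))$ on $M\otimes_{\mathbb{C}[S_l]}\mathbb{C}(m|n)^{\otimes l}$ is defined by the following formulas, for $1\le i\le m+n-1$, $\mathbf{m}\in M$, $\mathbf{v}\in\mathbb{C}(m|n)^{\otimes l}$: $$H_{i,0}(\mathbf{m}\otimes\mathbf{v})=\mathbf{m}\otimes((-1)^{|i|}E_{i,i}-(-1)^{|i+1|}E_{i+1,i+1})\mathbf{v},$$ $$X^+_{i,0}(\mathbf{m}\otimes\mathbf{v})=\mathbf{m}\otimes E_{i,i+1}\mathbf{v},\qquad X^-_{i,0}(\mathbf{m}\otimes\mathbf{v})=(-1)^{|i|}\mathbf{m}\otimes E_{i+1,i}\mathbf{v},$$ $$J(h_i)(\mathbf{m}\otimes\mathbf{v})=\sum_{k=1}^l\mathbf{m}\,\mathfrak{z}_k\otimes((-1)^{|i|}E^{(k)}_{i,i}-(-1)^{|i+1|}E^{(k)}_{i+1,i+1})\mathbf{v},$$ $$J(x_i^+)(\mathbf{m}\otimes\mathbf{v})=\sum_{k=1}^l\mathbf{m}\,\mathfrak{z}_k\otimes E^{(k)}_{i,i+1}\mathbf{v},\qquad J(x_i^-)(\mathbf{m}\otimes\mathbf{v})=(-1)^{|i|}\sum_{k=1}^l\mathbf{m}\,\mathfrak{z}_k\otimes E^{(k)}_{i+1,i}\mathbf{v}.$$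
   Context: Parity: $|i|=0$ for $1\le i\le m$, $|i|=1$ for $m+1\le i\le m+n$. $\mathbb{C}(m|n)=\bigoplus_{i=1}^{m+n}\mathbb{C}e_i$, $e_i$ of parity $|i|$; $E_{i,j}$ matrix units of parity $|i|+|j|$. $[\cdot,\cdot]$ is the supercommutator, $\{x,y\}=xy+yx$. On $\mathbb{C}(m|n)^{\otimes l}$: $E_{a,b}^{(k)}(v_1\otimes\cdots\otimes v_l)=(-1)^{(|a|+|b|)\sum_{j<k}|v_j|}v_1\otimes\cdots\otimes E_{a,b}v_k\otimes\cdots\otimes v_l$ and $E_{a,b}$ acts by $\sum_kE_{a,b}^{(k)}$; $S_l$ acts on the left by $\sigma_{i,i+1}(v_1\otimes\cdots\otimes v_l)=(-1)^{|v_i||v_{i+1}|}v_1\otimes\cdots\otimes v_{i+1}\otimes v_i\otimes\cdots\otimes v_l$; $\sigma_{i,j}$ is the transposition of $i,j$. $M$ is regarded as purely even. Cartan matrix ($1\le i,j\le m+n-1$): $a_{i,i}=(-1)^{|i|}+(-1)^{|i+1|}$, $a_{i,i+1}=-(-1)^{|i+1|}$, $a_{i,i-1}=-(-1)^{|i|}$, and $a_{i,j}=0$ otherwise. $Y_\lambda(\mathfrak{sl}(m|n))$ is the associative superalgebra generated by $X^\pm_{i,r},H_{i,r}$ ($1\le i\le m+n-1$, $r=0,1$), where $X^\pm_{m,r}$ are odd and all other generators are even, with relations (where $\widetilde H_{i,1}=H_{i,1}-\frac{\lambda}{2}H_{i,0}^2$): $[H_{i,r},H_{j,s}]=0$; $[X^+_{i,0},X^-_{j,0}]=\delta_{i,j}H_{i,0}$;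 $[X^+_{i,1},X^-_{j,0}]=\delta_{i,j}H_{i,1}=[X^+_{i,0},X^-_{j,1}]$; $[H_{i,0},X^\pm_{j,r}]=\pm a_{i,j}X^\pm_{j,r}$; $[\widetilde H_{i,1},X^\pm_{j,0}]=\pm a_{i,j}X^\pm_{j,1}$; $[X^\pm_{i,1},X^\pm_{j,0}]-[X^\pm_{i,0},X^\pm_{j,1}]=\pm\frac{\lambda a_{i,j}}{2}\{X^\pm_{i,0},X^\pm_{j,0}\}$; $(\mathrm{ad}\,X^\pm_{i,0})^{1+|a_{i,j}|}(X^\pm_{j,0})=0$ for $i\ne j$ (here $|a_{i,j}|$ is the absolute value); $[X^\pm_{m,0},X^\pm_{m,0}]=0$; $[[X^\pm_{m-1,0},X^\pm_{m,0}],[X^\pm_{m,0},X^\pm_{m+1,0}]]=0$. There is a homomorphism $U(\mathfrak{sl}_{m|n})\to Y_\lambda(\mathfrak{sl}(m|n))$ with $E_{i,i+1}\mapsto X^+_{i,0}$, $(-1)^{|i|}E_{i+1,i}\mapsto X^-_{i,0}$, $(-1)^{|i|}E_{i,i}-(-1)^{|i+1|}E_{i+1,i+1}\mapsto H_{i,0}$; images of elements are denoted by the same symbols. Put $i^{(0)}=\sum_{j=i+2}^{m+n}(-1)^{|j|}$ and $$\vartheta_i=-\tfrac{(i-1)^{(0)}}{2}H_{i,0}+\tfrac{(-1)^{|i|}}{2}\sum_{k\ne i}(-1)^{|k|}\mathrm{sign}(k-i)E_{i,k}E_{k,i}-\tfrac{(-1)^{|i+1|}}{2}\sum_{k\ne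 i+1}(-1)^{|k|}\mathrm{sign}(k-i-1)E_{i+1,k}E_{k,i+1},$$ $$\varpi_i^+=-\tfrac{i^{(0)}}{2}X^+_{i,0}+\tfrac12\sum_{k\ne i,i+1}(-1)^{|k|}\mathrm{sign}(k-i)E_{i,k}E_{k,i+1}-\tfrac12H_{i,0}X^+_{i,0},$$ $$\varpi_i^-=-\tfrac{i^{(0)}}{2}X^-_{i,0}+\tfrac{(-1)^{|i|}}{2}\sum_{k\ne i,i+1}(-1)^{|k|}\mathrm{sign}(k-i)E_{i+1,k}E_{k,i}-\tfrac12X^-_{i,0}H_{i,0},$$ and $J(h_i)=\widetilde H_{i,1}+\lambda\vartheta_i$, $J(x_i^\pm)=X^\pm_{i,1}+\lambda\varpi_i^\pm$. Thus $H_{i,0},X_{i,0}^\pm,J(h_i),J(x_i^\pm)$ generate $Y_\lambda(\mathfrak{sl}(m|n))$, and prescribing their action prescribes that of all generators. $H^{\deg}_\lambda(S_l)$ is generated by $\mathbb{C}[S_l]$ (with $\sigma_i=\sigma_{i,i+1}$) and pairwise commuting $\mathsf{u}_1,\dots,\mathsf{u}_l$ with $\mathsf{u}_i\sigma_i=\sigma_i\mathsf{u}_{i+1}-\lambda$, $\mathsf{u}_{i+1}\sigma_i=\sigma_i\mathsf{u}_i+\lambda$, $\mathsf{u}_i\sigma_j=\sigma_j\mathsf{u}_i$ for $i\ne j,j+1$. Put $\mathfrak{z}_i=\mathsf{u}_i+\frac{\lambda}{2}\sum_{j\ne i}\mathrm{sign}(j-i)\sigma_{i,j}$. *)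

theory Defs
  imports
    Complex_Main
    "HOL-Library.Poly_Mapping"
    "HOL-Combinatorics.Permutations"
    "HOL-Algebra.QuotRing"
    "HOL-Algebra.Module"
begin

section \<open>Complex vector spaces, algebras and their quotients\<close>

text \<open>
  Complex vector spaces and associative algebras are records of type
  \<^typ>\<open>(complex, 'a) module\<close>.  As usual in HOL-Algebra, the multiplicative fields carry no
  meaning when such a record is only used as a vector space.
\<close>

definition complex_ring :: "complex ring" where
  "complex_ring = \<lparr>carrier = UNIV, monoid.mult = (*), one = 1, zero = 0, add = (+)\<rparr>"

definition scale :: "complex \<Rightarrow> ('a \<Rightarrow>\<^sub>0 complex) \<Rightarrow> ('a \<Rightarrow>\<^sub>0 complex)" (infixr \<open>*\<^sub>C\<close> 75) where
  "c *\<^sub>C f = Poly_Mapping.map ((*) c) f"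

definition lin_ext :: "('a \<Rightarrow> 'b \<Rightarrow>\<^sub>0 complex) \<Rightarrow> ('a \<Rightarrow>\<^sub>0 complex) \<Rightarrow> ('b \<Rightarrow>\<^sub>0 complex)" where
  "lin_ext g f = (\<Sum>a\<in>Poly_Mapping.keys f. Poly_Mapping.lookup f a *\<^sub>C g a)"

text \<open>The complex vector space with basis \<open>B\<close>.\<close>

definition free_space :: "'a set \<Rightarrow> (complex, 'a \<Rightarrow>\<^sub>0 complex) module" where
  "free_space B =
     \<lparr>carrier = {f. Poly_Mapping.keys f \<subseteq> B}, monoid.mult = (\<lambda>_ _. 0), one = 0,
      zero = 0, add = (+), module.smult = (*\<^sub>C)\<rparr>"

text \<open>
  The quotient of an algebra by a two-sided ideal, or of a vector space by a subspace: the
  library's quotient ring together with the induced scalar multiplication.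
\<close>

definition quot :: "(complex, 'a) module \<Rightarrow> 'a set \<Rightarrow> (complex, 'a set) module" where
  "quot A I = ring.extend (A Quot I) (module.fields (\<lambda>c K. \<Union>x\<in>K. I +>\<^bsub>A\<^esub> (c \<odot>\<^bsub>A\<^esub> x)))"

definition gen_subspace :: "(complex, 'a) module \<Rightarrow> 'a set \<Rightarrow> 'a set" where
  "gen_subspace A S = \<Inter>{N. submodule N complex_ring A \<and> S \<subseteq> N}"

section \<open>Free algebras and presentations\<close>

datatype 'g word = Word (letters: "'g list")

instantiation word :: (type) monoid_add
begin

definition zero_word :: "'a word" where "0 = Word []"

definition plus_word :: "'a word \<Rightarrow> 'a word \<Rightarrow> 'a word" where
  "u + v = Word (letters u @ letters v)"

instance
  by standard (simp_all add: zero_word_def plus_word_def)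

end

text \<open>
  Since addition of words is concatenation, the (convolution) product of
  \<^typ>\<open>'g word \<Rightarrow>\<^sub>0 complex\<close> is that of the monoid algebra of the free monoid, i.e. of the free
  unital associative algebra.
\<close>

type_synonym 'g free = "'g word \<Rightarrow>\<^sub>0 complex"

definition gen :: "'g \<Rightarrow> 'g free" where
  "gen g = Poly_Mapping.single (Word [g]) 1"

definition free_algebra :: "'g set \<Rightarrow> (complex, 'g free) module" where
  "free_algebra G =
     \<lparr>carrier = {f. \<forall>w\<in>Poly_Mapping.keys f. set (letters w) \<subseteq> G}, monoid.mult = (*), one = 1,
      zero = 0, add = (+), module.smult = (*\<^sub>C)\<rparr>"

text \<open>The algebra with generators \<open>G\<close> and relations \<open>r = 0\<close> for \<open>r \<in> R\<close>.\<close>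

definition presented_algebra :: "'g set \<Rightarrow> 'g free set \<Rightarrow> (complex, 'g free set) module" where
  "presented_algebra G R = quot (free_algebra G) (Idl\<^bsub>free_algebra G\<^esub> R)"

text \<open>The class of an element of the free algebra in the presented algebra.\<close>

definition presented_class :: "'g set \<Rightarrow> 'g free set \<Rightarrow> 'g free \<Rightarrow> 'g free set" where
  "presented_class G R f = (Idl\<^bsub>free_algebra G\<^esub> R) +>\<^bsub>free_algebra G\<^esub> f"

section \<open>Modules over algebras, tensor products\<close>

definition right_module ::
  "(complex, 'a) module \<Rightarrow> (complex, 'm) module \<Rightarrow> ('m \<Rightarrow> 'a \<Rightarrow> 'm) \<Rightarrow> bool" where
  "right_module A M ract \<longleftrightarrow>
     module complex_ring M \<and>
     (\<forall>x\<in>carrier M. \<forall>a\<in>carrier A. ract x a \<in> carrier M) \<and>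
     (\<forall>x\<in>carrier M. \<forall>y\<in>carrier M. \<forall>a\<in>carrier A.
        ract (x \<oplus>\<^bsub>M\<^esub> y) a = ract x a \<oplus>\<^bsub>M\<^esub> ract y a) \<and>
     (\<forall>x\<in>carrier M. \<forall>a\<in>carrier A. \<forall>b\<in>carrier A.
        ract x (a \<oplus>\<^bsub>A\<^esub> b) = ract x a \<oplus>\<^bsub>M\<^esub> ract x b) \<and>
     (\<forall>c. \<forall>x\<in>carrier M. \<forall>a\<in>carrier A.
        ract (c \<odot>\<^bsub>M\<^esub> x) a = c \<odot>\<^bsub>M\<^esub> ract x a \<and> ract x (c \<odot>\<^bsub>A\<^esub> a) = c \<odot>\<^bsub>M\<^esub> ract x a) \<and>
     (\<forall>x\<in>carrier M. \<forall>a\<in>carrier A. \<forall>b\<in>carrier A. ract x (a \<otimes>\<^bsub>A\<^esub> b) = ract (ract x a) b) \<and>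
     (\<forall>x\<in>carrier M. ract x \<one>\<^bsub>A\<^esub> = x)"

definition left_module ::
  "(complex, 'a) module \<Rightarrow> (complex, 'w) module \<Rightarrow> ('a \<Rightarrow> 'w \<Rightarrow> 'w) \<Rightarrow> bool" where
  "left_module A W act \<longleftrightarrow>
     module complex_ring W \<and>
     (\<forall>a\<in>carrier A. \<forall>x\<in>carrier W. act a x \<in> carrier W) \<and>
     (\<forall>a\<in>carrier A. \<forall>x\<in>carrier W. \<forall>y\<in>carrier W.
        act a (x \<oplus>\<^bsub>W\<^esub> y) = act a x \<oplus>\<^bsub>W\<^esub> act a y) \<and>
     (\<forall>a\<in>carrier A. \<forall>b\<in>carrier A. \<forall>x\<in>carrier W.
        act (a \<oplus>\<^bsub>A\<^esub> b) x = act a x \<oplus>\<^bsub>W\<^esub> act b x) \<and>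
     (\<forall>c. \<forall>a\<in>carrier A. \<forall>x\<in>carrier W.
        act a (c \<odot>\<^bsub>W\<^esub> x) = c \<odot>\<^bsub>W\<^esub> act a x \<and> act (c \<odot>\<^bsub>A\<^esub> a) x = c \<odot>\<^bsub>W\<^esub> act a x) \<and>
     (\<forall>a\<in>carrier A. \<forall>b\<in>carrier A. \<forall>x\<in>carrier W. act (a \<otimes>\<^bsub>A\<^esub> b) x = act a (act b x)) \<and>
     (\<forall>x\<in>carrier W. act \<one>\<^bsub>A\<^esub> x = x)"

text \<open>
  A module over a superalgebra on a superspace.  \<open>Apart p\<close> and \<open>Wpart q\<close> are the homogeneous
  components, indexed by natural numbers read modulo 2.
\<close>

definition left_supermodule ::
  "(complex, 'a) module \<Rightarrow> (nat \<Rightarrow> 'a set) \<Rightarrow> (complex, 'w) module \<Rightarrow> (nat \<Rightarrow> 'w set) \<Rightarrow>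
   ('a \<Rightarrow> 'w \<Rightarrow> 'w) \<Rightarrow> bool" where
  "left_supermodule A Apart W Wpart act \<longleftrightarrow>
     left_module A W act \<and>
     (\<forall>p q. \<forall>a\<in>Apart p. \<forall>x\<in>Wpart q. act a x \<in> Wpart (p + q))"

text \<open>
  Tensor product of a right module \<open>M\<close> and a left module \<open>V\<close>: the free vector space on pairs
  modulo bilinearity and balancing.  \<open>B\<close> consists of the pairs (operator on \<open>M\<close>, operator on
  \<open>V\<close>) by which the elements of a spanning set of the algebra act; balancing over the whole
  algebra then follows from bilinearity.
\<close>

definition tensor_rels ::
  "(complex, 'm) module \<Rightarrow> (complex, 'v) module \<Rightarrow> (('m \<Rightarrow> 'm) \<times> ('v \<Rightarrow> 'v)) set \<Rightarrow>
   ('m \<times> 'v \<Rightarrow>\<^sub>0 complex) set" where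
  "tensor_rels M V B =
     (let \<delta> = (\<lambda>x v. Poly_Mapping.single (x, v) 1) in
       {\<delta> (x \<oplus>\<^bsub>M\<^esub> y) v - \<delta> x v - \<delta> y v | x y v. x \<in> carrier M \<and> y \<in> carrier M \<and> v \<in> carrier V}
     \<union> {\<delta> x (u \<oplus>\<^bsub>V\<^esub> v) - \<delta> x u - \<delta> x v | x u v. x \<in> carrier M \<and> u \<in> carrier V \<and> v \<in> carrier V}
     \<union> {\<delta> (c \<odot>\<^bsub>M\<^esub> x) v - c *\<^sub>C \<delta> x v | c x v. x \<in> carrier M \<and> v \<in> carrier V}
     \<union> {\<delta> x (c \<odot>\<^bsub>V\<^esub> v) - c *\<^sub>C \<delta> x v | c x v. x \<in> carrier M \<and> v \<in> carrier V}
     \<union> {\<delta> (\<rho> x) v - \<delta> x (\<tau> v) | \<rho> \<tau> x v. (\<rho>, \<tau>) \<in> B \<and> x \<in> carrier M \<and> v \<in> carrier V})"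

definition tensor_kernel ::
  "(complex, 'm) module \<Rightarrow> (complex, 'v) module \<Rightarrow> (('m \<Rightarrow> 'm) \<times> ('v \<Rightarrow> 'v)) set \<Rightarrow>
   ('m \<times> 'v \<Rightarrow>\<^sub>0 complex) set" where
  "tensor_kernel M V B =
     gen_subspace (free_space (carrier M \<times> carrier V)) (tensor_rels M V B)"

definition tensor_product ::
  "(complex, 'm) module \<Rightarrow> (complex, 'v) module \<Rightarrow> (('m \<Rightarrow> 'm) \<times> ('v \<Rightarrow> 'v)) set \<Rightarrow>
   (complex, ('m \<times> 'v \<Rightarrow>\<^sub>0 complex) set) module" where
  "tensor_product M V B = quot (free_space (carrier M \<times> carrier V)) (tensor_kernel M V B)"

definition tensor_class ::
  "(complex, 'm) module \<Rightarrow> (complex, 'v) module \<Rightarrow> (('m \<Rightarrow> 'm) \<times> ('v \<Rightarrow> 'v)) set \<Rightarrow>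
   ('m \<times> 'v \<Rightarrow>\<^sub>0 complex) \<Rightarrow> ('m \<times> 'v \<Rightarrow>\<^sub>0 complex) set" where
  "tensor_class M V B f = tensor_kernel M V B +>\<^bsub>free_space (carrier M \<times> carrier V)\<^esub> f"

definition pure_tensor ::
  "(complex, 'm) module \<Rightarrow> (complex, 'v) module \<Rightarrow> (('m \<Rightarrow> 'm) \<times> ('v \<Rightarrow> 'v)) set \<Rightarrow>
   'm \<Rightarrow> 'v \<Rightarrow> ('m \<times> 'v \<Rightarrow>\<^sub>0 complex) set" where
  "pure_tensor M V B x v = tensor_class M V B (Poly_Mapping.single (x, v) 1)"

section \<open>The superspace \<open>\<complex>(m|n)\<^sup>\<otimes>\<^sup>l\<close>\<close>

definition par :: "nat \<Rightarrow> nat \<Rightarrow> nat" where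
  "par m i = (if i \<le> m then 0 else 1)"

definition sg :: "nat \<Rightarrow> nat \<Rightarrow> complex" where
  "sg m i = (-1) ^ par m i"

text \<open>
  The word \<open>[a\<^sub>1, \<dots>, a\<^sub>l]\<close> stands for the basis tensor \<open>e\<^bsub>a\<^sub>1\<^esub> \<otimes> \<dots> \<otimes> e\<^bsub>a\<^sub>l\<^esub>\<close>.  Tensor positions are
  counted from 1, list positions from 0.
\<close>

definition tensor_words :: "nat \<Rightarrow> nat \<Rightarrow> nat \<Rightarrow> nat list set" where
  "tensor_words m n l = {w. length w = l \<and> set w \<subseteq> {1..m + n}}"

definition tensor_power :: "nat \<Rightarrow> nat \<Rightarrow> nat \<Rightarrow> (complex, nat list \<Rightarrow>\<^sub>0 complex) module" where
  "tensor_power m n l = free_space (tensor_words m n l)"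

definition tensor_power_part :: "nat \<Rightarrow> nat \<Rightarrow> nat \<Rightarrow> nat \<Rightarrow> (nat list \<Rightarrow>\<^sub>0 complex) set" where
  "tensor_power_part m n l p =
     {v \<in> carrier (tensor_power m n l).
        \<forall>w\<in>Poly_Mapping.keys v. sum_list (map (par m) w) mod 2 = p mod 2}"

definition unit_at ::
  "nat \<Rightarrow> nat \<Rightarrow> nat \<Rightarrow> nat \<Rightarrow> (nat list \<Rightarrow>\<^sub>0 complex) \<Rightarrow> (nat list \<Rightarrow>\<^sub>0 complex)" where
  "unit_at m a b k = lin_ext (\<lambda>w.
     if w ! (k - 1) = b
     then (-1) ^ ((par m a + par m b) * (\<Sum>j\<in>{1..<k}. par m (w ! (j - 1)))) *\<^sub>C
            Poly_Mapping.single (w[k - 1 := a]) 1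
     else 0)"

definition unit_op ::
  "nat \<Rightarrow> nat \<Rightarrow> nat \<Rightarrow> nat \<Rightarrow> (nat list \<Rightarrow>\<^sub>0 complex) \<Rightarrow> (nat list \<Rightarrow>\<^sub>0 complex)" where
  "unit_op m l a b v = (\<Sum>k\<in>{1..l}. unit_at m a b k v)"

definition super_swap :: "nat \<Rightarrow> nat \<Rightarrow> (nat list \<Rightarrow>\<^sub>0 complex) \<Rightarrow> (nat list \<Rightarrow>\<^sub>0 complex)" where
  "super_swap m i = lin_ext (\<lambda>w.
     (-1) ^ (par m (w ! (i - 1)) * par m (w ! i)) *\<^sub>C
       Poly_Mapping.single (w[i - 1 := w ! i, i := w ! (i - 1)]) 1)"

text \<open>
  The graph of the left action of \<open>S\<^sub>l\<close> on the tensor power, i.e. of the homomorphism sending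
  each adjacent transposition to the corresponding signed flip.
\<close>

inductive_set super_perm ::
  "nat \<Rightarrow> nat \<Rightarrow> ((nat \<Rightarrow> nat) \<times> ((nat list \<Rightarrow>\<^sub>0 complex) \<Rightarrow> (nat list \<Rightarrow>\<^sub>0 complex))) set"
  for m l :: nat where
  super_perm_id: "(id, id) \<in> super_perm m l"
| super_perm_step: "(\<sigma>, T) \<in> super_perm m l \<Longrightarrow> 1 \<le> i \<Longrightarrow> i < l \<Longrightarrow>
    (Transposition.transpose i (i + 1) \<circ> \<sigma>, super_swap m i \<circ> T) \<in> super_perm m l"

section \<open>The degenerate affine Hecke algebra\<close>

datatype hecke_gen = Perm "nat \<Rightarrow> nat" | U nat

definition hecke_gens :: "nat \<Rightarrow> hecke_gen set" where
  "hecke_gens l = Perm ` {\<sigma>. \<sigma> permutes {1..l}} \<union> U ` {1..l}"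

definition swap_gen :: "nat \<Rightarrow> nat \<Rightarrow> hecke_gen free" where
  "swap_gen i j = gen (Perm (Transposition.transpose i j))"

definition hecke_rels :: "nat \<Rightarrow> complex \<Rightarrow> hecke_gen free set" where
  "hecke_rels l lam =
     (let u = (\<lambda>i. gen (U i)); s = (\<lambda>i. swap_gen i (i + 1)) in
       {gen (Perm id) - 1}
     \<union> {gen (Perm \<sigma>) * gen (Perm \<tau>) - gen (Perm (\<sigma> \<circ> \<tau>)) | \<sigma> \<tau>.
          \<sigma> permutes {1..l} \<and> \<tau> permutes {1..l}}
     \<union> {u i * u j - u j * u i | i j. i \<in> {1..l} \<and> j \<in> {1..l}}
     \<union> {u i * s i - (s i * u (i + 1) - lam *\<^sub>C 1) | i. i \<in> {1..<l}}
     \<union> {u (i + 1) * s i - (s i * u i + lam *\<^sub>C 1) | i. i \<in> {1..<l}}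
     \<union> {u i * s j - s j * u i | i j. i \<in> {1..l} \<and> j \<in> {1..<l} \<and> i \<noteq> j \<and> i \<noteq> j + 1})"

definition hecke :: "nat \<Rightarrow> complex \<Rightarrow> (complex, hecke_gen free set) module" where
  "hecke l lam = presented_algebra (hecke_gens l) (hecke_rels l lam)"

definition hecke_class :: "nat \<Rightarrow> complex \<Rightarrow> hecke_gen free \<Rightarrow> hecke_gen free set" where
  "hecke_class l lam = presented_class (hecke_gens l) (hecke_rels l lam)"

definition hecke_z :: "nat \<Rightarrow> complex \<Rightarrow> nat \<Rightarrow> hecke_gen free set" where
  "hecke_z l lam k = hecke_class l lam
     (gen (U k) +
      (lam / 2) *\<^sub>C (\<Sum>j\<in>{1..l} - {k}. of_int (sgn (int j - int k)) *\<^sub>C swap_gen k j))"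

section \<open>The Yangian of \<open>sl(m|n)\<close>\<close>

datatype pm = Plus | Minus

fun pm_sign :: "pm \<Rightarrow> complex" where
  "pm_sign Plus = 1"
| "pm_sign Minus = -1"

datatype yangian_gen = Xgen pm nat nat | Hgen nat nat

definition yangian_gens :: "nat \<Rightarrow> nat \<Rightarrow> yangian_gen set" where
  "yangian_gens m n =
     {Xgen e i r | e i r. i \<in> {1..m + n - 1} \<and> r \<in> {0, 1}} \<union>
     {Hgen i r | i r. i \<in> {1..m + n - 1} \<and> r \<in> {0, 1}}"

fun gen_par :: "nat \<Rightarrow> yangian_gen \<Rightarrow> nat" where
  "gen_par m (Xgen e i r) = (if i = m then 1 else 0)"
| "gen_par m (Hgen i r) = 0"

definition word_par :: "nat \<Rightarrow> yangian_gen word \<Rightarrow> nat" where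
  "word_par m w = sum_list (map (gen_par m) (letters w))"

definition X_elt :: "pm \<Rightarrow> nat \<Rightarrow> nat \<Rightarrow> yangian_gen free" where
  "X_elt e i r = gen (Xgen e i r)"

definition H_elt :: "nat \<Rightarrow> nat \<Rightarrow> yangian_gen free" where
  "H_elt i r = gen (Hgen i r)"

text \<open>
  The supercommutator: the bilinear extension of \<open>[x, y] = x y - (-1)\<^bsup>|x||y|\<^esup> y x\<close> for words
  \<open>x\<close>, \<open>y\<close>.
\<close>

definition super_comm ::
  "nat \<Rightarrow> yangian_gen free \<Rightarrow> yangian_gen free \<Rightarrow> yangian_gen free" where
  "super_comm m f g =
     (\<Sum>x\<in>Poly_Mapping.keys f. \<Sum>y\<in>Poly_Mapping.keys g.
        (Poly_Mapping.lookup f x * Poly_Mapping.lookup g y) *\<^sub>C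
          (Poly_Mapping.single (x + y) 1
           - (-1) ^ (word_par m x * word_par m y) *\<^sub>C Poly_Mapping.single (y + x) 1))"

definition cartan :: "nat \<Rightarrow> nat \<Rightarrow> nat \<Rightarrow> int" where
  "cartan m i j =
     (if j = i then (-1) ^ par m i + (-1) ^ par m (i + 1)
      else if j = i + 1 then - ((-1) ^ par m (i + 1))
      else if i = j + 1 then - ((-1) ^ par m i)
      else 0)"

definition H_tilde :: "complex \<Rightarrow> nat \<Rightarrow> yangian_gen free" where
  "H_tilde lam i = H_elt i 1 - (lam / 2) *\<^sub>C (H_elt i 0 * H_elt i 0)"

definition yangian_rels :: "nat \<Rightarrow> nat \<Rightarrow> complex \<Rightarrow> yangian_gen free set" where
  "yangian_rels m n lam =
     (let I = {1..m + n - 1};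
          br = super_comm m;
          a = (\<lambda>i j. of_int (cartan m i j) :: complex);
          \<delta> = (\<lambda>i j. if i = j then 1 else 0 :: complex)
      in
       {br (H_elt i r) (H_elt j s) | i j r s. i \<in> I \<and> j \<in> I \<and> r \<in> {0, 1} \<and> s \<in> {0, 1}}
     \<union> {br (X_elt Plus i 0) (X_elt Minus j 0) - \<delta> i j *\<^sub>C H_elt i 0 | i j. i \<in> I \<and> j \<in> I}
     \<union> {br (X_elt Plus i 1) (X_elt Minus j 0) - \<delta> i j *\<^sub>C H_elt i 1 | i j. i \<in> I \<and> j \<in> I}
     \<union> {br (X_elt Plus i 0) (X_elt Minus j 1) - \<delta> i j *\<^sub>C H_elt i 1 | i j. i \<in> I \<and> j \<in> I}
     \<union> {br (H_elt i 0) (X_elt e j r) - (pm_sign e * a i j) *\<^sub>C X_elt e j r | e i j r.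
          i \<in> I \<and> j \<in> I \<and> r \<in> {0, 1}}
     \<union> {br (H_tilde lam i) (X_elt e j 0) - (pm_sign e * a i j) *\<^sub>C X_elt e j 1 | e i j.
          i \<in> I \<and> j \<in> I}
     \<union> {br (X_elt e i 1) (X_elt e j 0) - br (X_elt e i 0) (X_elt e j 1)
          - (pm_sign e * lam * a i j / 2) *\<^sub>C
              (X_elt e i 0 * X_elt e j 0 + X_elt e j 0 * X_elt e i 0) | e i j.
          i \<in> I \<and> j \<in> I}
     \<union> {(br (X_elt e i 0) ^^ (1 + nat \<bar>cartan m i j\<bar>)) (X_elt e j 0) | e i j.
          i \<in> I \<and> j \<in> I \<and> i \<noteq> j}
     \<union> {br (X_elt e m 0) (X_elt e m 0) | e. True}
     \<union> {br (br (X_elt e (m - 1) 0) (X_elt e m 0)) (br (X_elt e m 0) (X_elt e (m + 1) 0)) | e. True})"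

definition yangian :: "nat \<Rightarrow> nat \<Rightarrow> complex \<Rightarrow> (complex, yangian_gen free set) module" where
  "yangian m n lam = presented_algebra (yangian_gens m n) (yangian_rels m n lam)"

definition yangian_class ::
  "nat \<Rightarrow> nat \<Rightarrow> complex \<Rightarrow> yangian_gen free \<Rightarrow> yangian_gen free set" where
  "yangian_class m n lam = presented_class (yangian_gens m n) (yangian_rels m n lam)"

definition yangian_part :: "nat \<Rightarrow> nat \<Rightarrow> complex \<Rightarrow> nat \<Rightarrow> yangian_gen free set set" where
  "yangian_part m n lam p = yangian_class m n lam `
     {f \<in> carrier (free_algebra (yangian_gens m n)).
        \<forall>w\<in>Poly_Mapping.keys f. word_par m w mod 2 = p mod 2}"

text \<open>
  Lifts to the free algebra of the images of the matrix units \<open>E\<^bsub>i,k\<^esub>\<close>, \<open>i \<noteq> k\<close>, under the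
  homomorphism from \<open>U(sl(m|n))\<close>.  The images of \<open>E\<^bsub>i,i+1\<^esub>\<close> and \<open>E\<^bsub>i+1,i\<^esub>\<close> are prescribed, and the
  others are forced by \<open>E\<^bsub>i,k+1\<^esub> = [E\<^bsub>i,k\<^esub>, E\<^bsub>k,k+1\<^esub>]\<close> and \<open>E\<^bsub>k+1,i\<^esub> = [E\<^bsub>k+1,k\<^esub>, E\<^bsub>k,i\<^esub>]\<close>, valid in
  \<open>sl(m|n)\<close> for \<open>i < k\<close>.  With \<open>d = k - i - 1\<close>, \<open>root_up m i d\<close> is \<open>E\<^bsub>i,k\<^esub>\<close> and
  \<open>root_down m i d\<close> is \<open>E\<^bsub>k,i\<^esub>\<close>.  The diagonal values \<open>E_img m i i\<close> are never used.
\<close>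

primrec root_up :: "nat \<Rightarrow> nat \<Rightarrow> nat \<Rightarrow> yangian_gen free" where
  "root_up m i 0 = X_elt Plus i 0"
| "root_up m i (Suc d) = super_comm m (root_up m i d) (X_elt Plus (i + d + 1) 0)"

primrec root_down :: "nat \<Rightarrow> nat \<Rightarrow> nat \<Rightarrow> yangian_gen free" where
  "root_down m i 0 = sg m i *\<^sub>C X_elt Minus i 0"
| "root_down m i (Suc d) =
     super_comm m (sg m (i + d + 1) *\<^sub>C X_elt Minus (i + d + 1) 0) (root_down m i d)"

definition E_img :: "nat \<Rightarrow> nat \<Rightarrow> nat \<Rightarrow> yangian_gen free" where
  "E_img m i k = (if i < k then root_up m i (k - i - 1) else root_down m k (i - k - 1))"

text \<open>\<open>upper_sum m n i\<close> is \<open>i\<^bsup>(0)\<^esup>\<close>.\<close>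

definition upper_sum :: "nat \<Rightarrow> nat \<Rightarrow> nat \<Rightarrow> complex" where
  "upper_sum m n i = (\<Sum>j\<in>{i + 2..m + n}. sg m j)"

definition isgn :: "nat \<Rightarrow> nat \<Rightarrow> complex" where
  "isgn k i = of_int (sgn (int k - int i))"

definition theta :: "nat \<Rightarrow> nat \<Rightarrow> nat \<Rightarrow> yangian_gen free" where
  "theta m n i =
     - (upper_sum m n (i - 1) / 2) *\<^sub>C H_elt i 0
     + (sg m i / 2) *\<^sub>C
         (\<Sum>k\<in>{1..m + n} - {i}. (sg m k * isgn k i) *\<^sub>C (E_img m i k * E_img m k i))
     - (sg m (i + 1) / 2) *\<^sub>C
         (\<Sum>k\<in>{1..m + n} - {i + 1}.
            (sg m k * isgn k (i + 1)) *\<^sub>C (E_img m (i + 1) k * E_img m k (i + 1)))"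

definition varpi_plus :: "nat \<Rightarrow> nat \<Rightarrow> nat \<Rightarrow> yangian_gen free" where
  "varpi_plus m n i =
     - (upper_sum m n i / 2) *\<^sub>C X_elt Plus i 0
     + (1 / 2) *\<^sub>C
         (\<Sum>k\<in>{1..m + n} - {i, i + 1}. (sg m k * isgn k i) *\<^sub>C (E_img m i k * E_img m k (i + 1)))
     - (1 / 2) *\<^sub>C (H_elt i 0 * X_elt Plus i 0)"

definition varpi_minus :: "nat \<Rightarrow> nat \<Rightarrow> nat \<Rightarrow> yangian_gen free" where
  "varpi_minus m n i =
     - (upper_sum m n i / 2) *\<^sub>C X_elt Minus i 0
     + (sg m i / 2) *\<^sub>C
         (\<Sum>k\<in>{1..m + n} - {i, i + 1}. (sg m k * isgn k i) *\<^sub>C (E_img m (i + 1) k * E_img m k i))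
     - (1 / 2) *\<^sub>C (X_elt Minus i 0 * H_elt i 0)"

definition J_h :: "nat \<Rightarrow> nat \<Rightarrow> complex \<Rightarrow> nat \<Rightarrow> yangian_gen free" where
  "J_h m n lam i = H_tilde lam i + lam *\<^sub>C theta m n i"

definition J_x :: "nat \<Rightarrow> nat \<Rightarrow> complex \<Rightarrow> pm \<Rightarrow> nat \<Rightarrow> yangian_gen free" where
  "J_x m n lam e i =
     X_elt e i 1 + lam *\<^sub>C (case e of Plus \<Rightarrow> varpi_plus m n i | Minus \<Rightarrow> varpi_minus m n i)"

section \<open>The space \<open>M \<otimes>\<^bsub>\<complex>[S\<^sub>l]\<^esub> \<complex>(m|n)\<^sup>\<otimes>\<^sup>l\<close>\<close>

definition sym_balance ::
  "nat \<Rightarrow> nat \<Rightarrow> complex \<Rightarrow> ('m \<Rightarrow> hecke_gen free set \<Rightarrow> 'm) \<Rightarrow>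
   (('m \<Rightarrow> 'm) \<times> ((nat list \<Rightarrow>\<^sub>0 complex) \<Rightarrow> (nat list \<Rightarrow>\<^sub>0 complex))) set" where
  "sym_balance m l lam ract =
     {(\<lambda>x. ract x (hecke_class l lam (gen (Perm \<sigma>))), T) | \<sigma> T. (\<sigma>, T) \<in> super_perm m l}"

definition sw_space ::
  "nat \<Rightarrow> nat \<Rightarrow> nat \<Rightarrow> complex \<Rightarrow> (complex, 'm) module \<Rightarrow> ('m \<Rightarrow> hecke_gen free set \<Rightarrow> 'm) \<Rightarrow>
   (complex, ('m \<times> (nat list \<Rightarrow>\<^sub>0 complex) \<Rightarrow>\<^sub>0 complex) set) module" where
  "sw_space m n l lam M ract = tensor_product M (tensor_power m n l) (sym_balance m l lam ract)"

definition sw_tensor ::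
  "nat \<Rightarrow> nat \<Rightarrow> nat \<Rightarrow> complex \<Rightarrow> (complex, 'm) module \<Rightarrow> ('m \<Rightarrow> hecke_gen free set \<Rightarrow> 'm) \<Rightarrow>
   'm \<Rightarrow> (nat list \<Rightarrow>\<^sub>0 complex) \<Rightarrow> ('m \<times> (nat list \<Rightarrow>\<^sub>0 complex) \<Rightarrow>\<^sub>0 complex) set" where
  "sw_tensor m n l lam M ract = pure_tensor M (tensor_power m n l) (sym_balance m l lam ract)"

text \<open>The grading: \<open>M\<close> is purely even, so only the parity of the second factor counts.\<close>

definition sw_part ::
  "nat \<Rightarrow> nat \<Rightarrow> nat \<Rightarrow> complex \<Rightarrow> (complex, 'm) module \<Rightarrow> ('m \<Rightarrow> hecke_gen free set \<Rightarrow> 'm) \<Rightarrow>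
   nat \<Rightarrow> ('m \<times> (nat list \<Rightarrow>\<^sub>0 complex) \<Rightarrow>\<^sub>0 complex) set set" where
  "sw_part m n l lam M ract p =
     tensor_class M (tensor_power m n l) (sym_balance m l lam ract) `
       {f. Poly_Mapping.keys f \<subseteq> carrier M \<times> tensor_power_part m n l p}"

end

theory Submission
  imports Defs
begin

text \<open>
  Let \<open>E\<^bsub>a,b\<^esub>\<^sup>(\<^sup>k\<^sup>)\<close> be the matrix units on the tensor sites and \<open>e\<^bsub>a,b\<^esub>\<close> their sum over \<open>k\<close>.  The
  proof works on the unbalanced product \<open>M \<otimes> \<complex>(m|n)\<^sup>\<otimes>\<^sup>l\<close>, where only the commutativity of the
  \<open>u\<^sub>k\<close> matters, with the second coefficients of the monodromy matrix
  \<open>T\<^bsub>a,b\<^esub> = \<Sum>\<^sub>k u\<^sub>k E\<^bsub>a,b\<^esub>\<^sup>(\<^sup>k\<^sup>) - \<lambda> \<Sum>\<^bsub>j<k\<^esub> \<Sum>\<^sub>c (-1)\<^bsup>|c|\<^esup> E\<^bsub>a,c\<^esub>\<^sup>(\<^sup>j\<^sup>) E\<^bsub>c,b\<^esub>\<^sup>(\<^sup>k\<^sup>)\<close>.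
  They transform under \<open>gl(m|n)\<close> like matrix units, and so does \<open>T\<close> up to explicit quadratic terms
  after adding \<open>\<lambda> \<Sum>\<^bsub>c\<le>i\<^esub> (-1)\<^bsup>|c|\<^esup> e\<^bsub>a,c\<^esub> e\<^bsub>c,b\<^esub>\<close>; the matrix entries of the resulting \<open>G\<^sub>i\<close> are the
  generators of level 1.  All relations but \<open>[H\<^bsub>i,1\<^esub>, H\<^bsub>j,1\<^esub>] = 0\<close> follow from this equivariance.
  The remaining one holds because \<open>T\<^bsub>a,a\<^esub> + \<lambda> \<Sum>\<^bsub>c<a\<^esub> (-1)\<^bsup>|c|\<^esup> e\<^bsub>a,c\<^esub> e\<^bsub>c,a\<^esub>\<close> commute for
  different \<open>a\<close>, by the formula for \<open>[T\<^bsub>a,a\<^esub>, T\<^bsub>b,b\<^esub>]\<close>, proved by induction on the number of sites.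
  Balancing turns \<open>\<sigma>\<^bsub>j,k\<^esub> E\<^bsub>a,b\<^esub>\<^sup>(\<^sup>k\<^sup>)\<close> into \<open>\<Sum>\<^sub>c (-1)\<^bsup>|c|\<^esup> E\<^bsub>a,c\<^esub>\<^sup>(\<^sup>j\<^sup>) E\<^bsub>c,b\<^esub>\<^sup>(\<^sup>k\<^sup>)\<close>, so the action
  of \<open>J\<close> is \<open>\<Sum>\<^sub>k z\<^sub>k \<otimes> E\<^bsub>a,b\<^esub>\<^sup>(\<^sup>k\<^sup>)\<close>, and it descends to the balanced product since
  \<open>\<sigma> z\<^sub>k = z\<^bsub>\<sigma>(k)\<^esub> \<sigma>\<close>.
\<close>

section \<open>Equivariant families over \<open>gl(m|n)\<close>\<close>

text \<open>In general neither u_k nor a single E_ab^(k) respects balancing, so the relations cannot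
  be checked site by site on the balanced product. They are checked in a genuine ring: linear
  operators on the free space over formal pairs (x, w), with x in M and w a basis word, where not
  even linearity in x is imposed. Only the images of the generators then have to be shown to
  descend. The cut at c \<le> i in G_i carries the quadratic part of the relations. A sum over all c
  is again equivariant and would yield no quadratic terms. A cut sum fails to be equivariant by a
  single product of two units, and only for index pairs that the cut separates. These defects,
  together with the change of the cut between neighbouring nodes, produce the anticommutators and
  squares that the relations demand. The corrections theta and varpi in J replace the cut by half
  the sum over all c, and this symmetric form is what becomes the antisymmetric sum of
  transpositions in z_k. The parameter \<lambda> appears as h + h with h central, because the
  relations involve \<lambda>/2 and a general ring has no division.\<close>

definition sgn1 :: "(nat \<Rightarrow> bool) \<Rightarrow> nat \<Rightarrow> 'a::ring_1" where
  "sgn1 od a = (if od a then -1 else 1)"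

text \<open>The Koszul sign for exchanging E_ab and E_cd. Parity is a predicate and the sign is an
  element of the ring, so sign identities reduce to finitely many Boolean cases.\<close>

definition sgn2 :: "(nat \<Rightarrow> bool) \<Rightarrow> nat \<Rightarrow> nat \<Rightarrow> nat \<Rightarrow> nat \<Rightarrow> 'a::ring_1" where
  "sgn2 od a b c d = (if od a \<noteq> od b \<and> od c \<noteq> od d then -1 else 1)"

text \<open>The supercommutator rule of E_ij with E_cd, solved for the product with \<open>e\<close>
  on the left so that it can be used for reordering. Only the indices of the acting family are
  confined to \<open>I\<close>.\<close>

definition gl_equivariant ::
  "(nat \<Rightarrow> bool) \<Rightarrow> nat set \<Rightarrow> (nat \<Rightarrow> nat \<Rightarrow> 'a::ring_1) \<Rightarrow> (nat \<Rightarrow> nat \<Rightarrow> 'a) \<Rightarrow> bool" where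
  "gl_equivariant od I e X \<longleftrightarrow> (\<forall>i\<in>I. \<forall>j\<in>I. \<forall>c d.
     e i j * X c d = sgn2 od i j c d * (X c d * e i j) + (if j = c then X i d else 0)
       - sgn2 od i j c d * (if i = d then X c j else 0))"

text \<open>For \<open>C = I\<close> this is the product of supermatrices; smaller sets
  \<open>C\<close> give the cut sums.\<close>

definition super_prod ::
  "(nat \<Rightarrow> bool) \<Rightarrow> nat set \<Rightarrow> (nat \<Rightarrow> nat \<Rightarrow> 'a::ring_1) \<Rightarrow> (nat \<Rightarrow> nat \<Rightarrow> 'a) \<Rightarrow> nat \<Rightarrow> nat \<Rightarrow> 'a" where
  "super_prod od C A B a b = (\<Sum>c\<in>C. sgn1 od c * (A a c * B c b))"

lemma gl_equivariantD:
  assumes "gl_equivariant od I e X" "i \<in> I" "j \<in> I"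
  shows "e i j * X c d = sgn2 od i j c d * (X c d * e i j) + (if j = c then X i d else 0)
       - sgn2 od i j c d * (if i = d then X c j else 0)"
  using assms unfolding gl_equivariant_def by blast

text \<open>The parity of the inner index c enters the signs of both factors and cancels. The
  leftover terms at c = j and c = i carry a common sign. Everything depends on five parities and two
  equalities.\<close>

lemma sgn_collect:
  fixes Z P V Y :: "'a::ring_1"
  shows "sgn1 od c * (sgn2 od i j a c * (sgn2 od i j c b * Z + (if j = c then Y else 0)
        - sgn2 od i j c b * V) + P - sgn2 od i j a c * (if i = c then Y else 0)) =
      sgn2 od i j a b * (sgn1 od c * Z) + sgn1 od c * P - sgn2 od i j a b * (sgn1 od c * V)
      + sgn2 od i j a j * sgn1 od j * ((if c = j then Y else 0) - (if c = i then Y else 0))"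
  by (cases "c = j"; cases "c = i"; cases "od i"; cases "od j"; cases "od a"; cases "od b"; cases "od c")
     (simp_all add: sgn1_def sgn2_def)

text \<open>Equivariance is applied once to each factor. The corrections at the inner index, c = i
  from the first factor and c = j from the second, lead to the same product A_aj B_ib with opposite
  signs.\<close>

lemma gl_equivariant_mult3:
  fixes e :: "nat \<Rightarrow> nat \<Rightarrow> 'a::ring_1"
  assumes A: "gl_equivariant od I e A" and B: "gl_equivariant od I e B" and "i \<in> I" "j \<in> I"
  shows "e i j * (sgn1 od c * (A a c * B c b)) =
      sgn2 od i j a b * (sgn1 od c * (A a c * B c b * e i j))
      + sgn1 od c * (if j = a then A i c * B c b else 0)
      - sgn2 od i j a b * (sgn1 od c * (if i = b then A a c * B c j else 0))
      + sgn2 od i j a j * sgn1 od j *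
          ((if c = j then A a j * B i b else 0) - (if c = i then A a j * B i b else 0))"
proof -
  note 1 = gl_equivariantD[OF assms(1,3,4), of a c]
  note 2 = gl_equivariantD[OF assms(2,3,4), of c b]
  have "e i j * (sgn1 od c * (A a c * B c b)) = sgn1 od c * ((e i j * A a c) * B c b)"
    by (simp add: sgn1_def mult.assoc)
  also have "(e i j * A a c) * B c b = sgn2 od i j a c * (A a c * (e i j * B c b))
       + (if j = a then A i c * B c b else 0)
       - sgn2 od i j a c * (if i = c then A a j * B c b else 0)"
    unfolding 1 by (simp add: distrib_right left_diff_distrib mult.assoc if_distrib[of "\<lambda>x. x * _"])
  also have "A a c * (e i j * B c b) = sgn2 od i j c b * (A a c * B c b * e i j)
       + (if j = c then A a c * B i b else 0) - sgn2 od i j c b * (if i = b then A a c * B c j else 0)"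
    unfolding 2 by (simp add: distrib_left right_diff_distrib mult.assoc sgn2_def)
  finally have 3: "e i j * (sgn1 od c * (A a c * B c b)) = sgn1 od c *
      (sgn2 od i j a c * (sgn2 od i j c b * (A a c * B c b * e i j)
         + (if j = c then A a c * B i b else 0) - sgn2 od i j c b * (if i = b then A a c * B c j else 0))
       + (if j = a then A i c * B c b else 0) - sgn2 od i j a c * (if i = c then A a j * B c b else 0))" .
  have 4: "(if j = c then A a c * B i b else 0) = (if j = c then A a j * B i b else 0)"
    "(if i = c then A a j * B c b else 0) = (if i = c then A a j * B i b else 0)" by auto
  show ?thesis unfolding 3 4 by (rule sgn_collect)
qed

text \<open>The inner corrections survive only at c = j and c = i, and they cancel when
  \<open>C\<close> contains both or neither. The last term is thus the defect of a cut that
  separates i from j.\<close>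

lemma gl_equivariant_prod:
  fixes e :: "nat \<Rightarrow> nat \<Rightarrow> 'a::ring_1"
  assumes A: "gl_equivariant od I e A" and B: "gl_equivariant od I e B" and "i \<in> I" "j \<in> I" "finite C"
  shows "e i j * super_prod od C A B a b =
      sgn2 od i j a b * (super_prod od C A B a b * e i j)
      + (if j = a then super_prod od C A B i b else 0)
      - sgn2 od i j a b * (if i = b then super_prod od C A B a j else 0)
      + sgn2 od i j a j * sgn1 od j *
          ((if j \<in> C then A a j * B i b else 0) - (if i \<in> C then A a j * B i b else 0))"
proof -
  have 1: "(\<Sum>c\<in>C. if P then f c else 0) = (if P then (\<Sum>c\<in>C. f c) else 0)" for P and f :: "nat \<Rightarrow> 'a"
    by simp
  have 2: "(\<Sum>c\<in>C. sgn1 od c * (A a c * B c b * e i j)) = (\<Sum>c\<in>C. sgn1 od c * (A a c * B c b)) * e i j"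
    by (simp add: sum_distrib_right mult.assoc)
  show ?thesis
    unfolding super_prod_def sum_distrib_left
    unfolding gl_equivariant_mult3[OF A B assms(3,4)]
    using assms(5)
    by (simp add: sum.distrib sum_subtractf sum_distrib_left[symmetric] 1 2
       if_distrib[of "\<lambda>x. _ * x"] cong: if_cong del: mult_minus_left)
qed

lemma gl_equivariant_super_prod:
  fixes e :: "nat \<Rightarrow> nat \<Rightarrow> 'a::ring_1"
  assumes A: "gl_equivariant od I e A" and B: "gl_equivariant od I e B" and "finite I"
  shows "gl_equivariant od I e (super_prod od I A B)"
  unfolding gl_equivariant_def
  using gl_equivariant_prod[OF A B _ _ assms(3)] by auto

lemma gl_equivariant_add:
  assumes "gl_equivariant od I e A" "gl_equivariant od I e B"
  shows "gl_equivariant od I e (\<lambda>a b. A a b + B a b)"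
  unfolding gl_equivariant_def distrib_left
  by (intro ballI allI, unfold gl_equivariantD[OF assms(1)] gl_equivariantD[OF assms(2)])
     (simp add: algebra_simps)

lemma gl_equivariant_scale:
  fixes x :: "'a::ring_1"
  assumes "gl_equivariant od I e A" and x: "\<And>a b. x * e a b = e a b * x"
  shows "gl_equivariant od I e (\<lambda>a b. x * A a b)"
  unfolding gl_equivariant_def
proof (intro ballI allI)
  fix i j c d assume "i \<in> I" "j \<in> I"
  have "e i j * (x * A c d) = x * (e i j * A c d)" using x[of i j] by (metis mult.assoc)
  also have "\<dots> = sgn2 od i j c d * (x * A c d * e i j) + (if j = c then x * A i d else 0)
       - sgn2 od i j c d * (if i = d then x * A c j else 0)"
    unfolding gl_equivariantD[OF assms(1) \<open>i \<in> I\<close> \<open>j \<in> I\<close>]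
    by (simp add: algebra_simps sgn2_def)
  finally show "e i j * (x * A c d) = sgn2 od i j c d * (x * A c d * e i j)
      + (if j = c then x * A i d else 0) - sgn2 od i j c d * (if i = d then x * A c j else 0)" .
qed

section \<open>Commuting sites and the second monodromy coefficients\<close>

locale super_sites =
  fixes od :: "nat \<Rightarrow> bool" and I :: "nat set"
    and E :: "nat \<Rightarrow> nat \<Rightarrow> nat \<Rightarrow> 'a::ring_1" and u :: "nat \<Rightarrow> 'a" and h :: 'a
  assumes finite_I: "finite I"
    and E_same: "E k a b * E k c d = (if b = c then E k a d else 0)"
    and E_comm: "j \<noteq> k \<Longrightarrow> E j a b * E k c d = sgn2 od a b c d * (E k c d * E j a b)"
    and u_comm: "u j * u k = u k * u j"
    and u_E: "u j * E k a b = E k a b * u j"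
    and h_central: "h * x = x * h"
begin

abbreviation "s \<equiv> sgn1 od :: nat \<Rightarrow> 'a"
abbreviation "\<epsilon> \<equiv> sgn2 od :: nat \<Rightarrow> nat \<Rightarrow> nat \<Rightarrow> nat \<Rightarrow> 'a"

definition e :: "nat \<Rightarrow> nat \<Rightarrow> nat \<Rightarrow> 'a" where
  "e r a b = (\<Sum>k\<in>{1..r}. E k a b)"

text \<open>The coproduct of the second coefficient: one more site contributes its own term,
  \<open>u\<close> times a matrix unit, and the product of the first coefficients of the old sites
  and the new one. This form is made for induction on the number of sites.\<close>

primrec T :: "nat \<Rightarrow> nat \<Rightarrow> nat \<Rightarrow> 'a" where
  "T 0 a b = 0"
| "T (Suc r) a b = T r a b + u (Suc r) * E (Suc r) a b
     - (h + h) * super_prod od I (e r) (E (Suc r)) a b"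

lemma e_0: "e 0 a b = 0" and e_Suc: "e (Suc r) a b = e r a b + E (Suc r) a b"
  by (simp_all add: e_def)

lemma u_e: "u j * e r a b = e r a b * u j"
  by (simp add: e_def sum_distrib_left sum_distrib_right u_E)

lemma E_e_comm: "r < k \<Longrightarrow> E k a b * e r c d = \<epsilon> a b c d * (e r c d * E k a b)"
  unfolding e_def sum_distrib_left sum_distrib_right
  by (intro sum.cong refl E_comm) simp

lemma E_e_left: "r < k \<Longrightarrow> E k a b * (e r c d * x) = \<epsilon> a b c d * (e r c d * (E k a b * x))"
  by (simp add: mult.assoc[symmetric] E_e_comm)

lemma sgn2_sgn2: "\<epsilon> a b c d * (\<epsilon> c d a b * x) = x" by (auto simp: sgn2_def)

lemma e_E_comm: "r < k \<Longrightarrow> e r a b * E k c d = \<epsilon> a b c d * (E k c d * e r a b)"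
  by (simp add: E_e_comm sgn2_sgn2)

lemma E_E_equivariant: "gl_equivariant od I (E k) (E k)"
  by (auto simp: gl_equivariant_def E_same)

text \<open>A summand of the acting family that supercommutes with \<open>X\<close> leaves the
  transformation rule unchanged. It lets sites on which \<open>X\<close> does not live join the
  action.\<close>

lemma gl_equivariant_extend:
  assumes "gl_equivariant od I f X" and "\<And>a b c d. g a b * X c d = \<epsilon> a b c d * (X c d * g a b)"
  shows "gl_equivariant od I (\<lambda>a b. f a b + g a b) X"
  unfolding gl_equivariant_def distrib_right assms(2)
  by (intro ballI allI, unfold gl_equivariantD[OF assms(1)]) (simp add: algebra_simps)

text \<open>Units on different sites supercommute, so of the sum over r + 1 sites only the part on
  the same sites acts nontrivially on \<open>e r\<close> and on \<open>E (Suc r)\<close>.\<close>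

lemma e_eqv: "gl_equivariant od I (e r) (e r)"
proof (induction r)
  case 0 then show ?case by (simp add: gl_equivariant_def e_0)
next
  case (Suc r)
  have a: "gl_equivariant od I (e (Suc r)) (e r)"
    unfolding e_Suc[abs_def]
    by (rule gl_equivariant_extend[OF Suc]) (simp add: E_e_comm)
  have "gl_equivariant od I (\<lambda>a b. E (Suc r) a b + e r a b) (E (Suc r))"
    by (rule gl_equivariant_extend[OF E_E_equivariant]) (simp add: e_E_comm)
  then have b: "gl_equivariant od I (e (Suc r)) (E (Suc r))"
    unfolding e_Suc[abs_def] by (simp add: add.commute)
  show ?case using gl_equivariant_add[OF a b] unfolding e_Suc[abs_def] .
qed

lemma e_Suc_E: "gl_equivariant od I (e (Suc r)) (E (Suc r))"
proof -
  have "gl_equivariant od I (\<lambda>a b. E (Suc r) a b + e r a b) (E (Suc r))"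
    by (rule gl_equivariant_extend[OF E_E_equivariant]) (simp add: e_E_comm)
  then show ?thesis
    unfolding e_Suc[abs_def] by (simp add: add.commute)
qed

lemma e_Suc_e: "gl_equivariant od I (e (Suc r)) (e r)"
    unfolding e_Suc[abs_def]
    by (rule gl_equivariant_extend[OF e_eqv]) (simp add: E_e_comm)

lemma commute_left: "x * y = y * x \<Longrightarrow> x * (y * z) = y * (x * z)" for x y z :: 'a
  by (metis mult.assoc)

lemma h2_left: "x * ((h + h) * y) = (h + h) * (x * y)"
  by (rule commute_left) (simp add: distrib_left distrib_right h_central)

lemma E_u_left: "E k a b * (u j * x) = u j * (E k a b * x)"
  by (rule commute_left) (simp add: u_E)

lemma e_u_left: "e r a b * (u j * x) = u j * (e r a b * x)"
  by (rule commute_left) (simp add: u_e)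

text \<open>The inner index occurs once in each factor, so its parity drops out of the total
  sign.\<close>

lemma E_super_prod_comm:
  assumes "r < k" "r' < k" "k \<noteq> k'"
  shows "E k a b * super_prod od C (e r) (E k') c d = \<epsilon> a b c d * (super_prod od C (e r) (E k') c d * E k a b)"
  unfolding super_prod_def sum_distrib_left sum_distrib_right
proof (rule sum.cong)
  fix x
  have "E k a b * (s x * (e r c x * E k' x d)) = s x * ((E k a b * e r c x) * E k' x d)"
    by (simp add: sgn1_def mult.assoc)
  also have "\<dots> = s x * (\<epsilon> a b c x * (e r c x * (E k a b * E k' x d)))"
    unfolding E_e_comm[OF assms(1)] by (simp add: mult.assoc)
  also have "\<dots> = s x * (\<epsilon> a b c x * (\<epsilon> a b x d * (e r c x * (E k' x d * E k a b))))"
    unfolding E_comm[OF assms(3)] by (simp add: sgn2_def)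
  also have "\<dots> = \<epsilon> a b c d * (s x * (e r c x * E k' x d) * E k a b)"
    by (auto simp: sgn1_def sgn2_def mult.assoc)
  finally show "E k a b * (s x * (e r c x * E k' x d)) = \<epsilon> a b c d * (s x * (e r c x * E k' x d) * E k a b)" .
qed simp

text \<open>\<open>T r\<close> is built from the first r sites, and site k lies beyond them.\<close>

lemma E_T_comm: "r < k \<Longrightarrow> E k a b * T r c d = \<epsilon> a b c d * (T r c d * E k a b)"
proof (induction r)
  case (Suc r)
  have 1: "E k a b * (u (Suc r) * E (Suc r) c d) = \<epsilon> a b c d * (u (Suc r) * E (Suc r) c d * E k a b)"
  proof -
    have "E k a b * (u (Suc r) * E (Suc r) c d) = u (Suc r) * (E k a b * E (Suc r) c d)"
      by (rule E_u_left)
    also have "E k a b * E (Suc r) c d = \<epsilon> a b c d * (E (Suc r) c d * E k a b)"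
      using Suc.prems by (intro E_comm) simp
    finally show ?thesis by (simp add: sgn2_def mult.assoc)
  qed
  have "E k a b * ((h + h) * super_prod od I (e r) (E (Suc r)) c d)
      = (h + h) * (E k a b * super_prod od I (e r) (E (Suc r)) c d)"
    by (rule h2_left)
  also have "\<dots> = \<epsilon> a b c d * ((h + h) * super_prod od I (e r) (E (Suc r)) c d * E k a b)"
    using Suc.prems by (subst E_super_prod_comm[of r k r]) (simp_all add: mult.assoc sgn2_def)
  finally show ?case
    using Suc 1 by (simp add: distrib_left distrib_right left_diff_distrib right_diff_distrib)
qed simp

text \<open>Each summand of the recursion is equivariant under all r + 1 sites. The crossing term
  sums over the whole of \<open>I\<close>, so it has no defect.\<close>

lemma T_eqv: "gl_equivariant od I (e r) (T r)"
proof (induction r)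
  case 0 show ?case by (simp add: gl_equivariant_def)
next
  case (Suc r)
  have 1: "gl_equivariant od I (e (Suc r)) (T r)"
    unfolding e_Suc[abs_def] by (rule gl_equivariant_extend[OF Suc]) (simp add: E_T_comm)
  have 2: "gl_equivariant od I (e (Suc r)) (\<lambda>a b. u (Suc r) * E (Suc r) a b)"
    by (rule gl_equivariant_scale[OF e_Suc_E u_e])
  have 3: "gl_equivariant od I (e (Suc r)) (\<lambda>a b. (- (h + h)) * super_prod od I (e r) (E (Suc r)) a b)"
    by (rule gl_equivariant_scale[OF gl_equivariant_super_prod[OF e_Suc_e e_Suc_E finite_I]])
       (simp add: h_central algebra_simps)
  have "T (Suc r) = (\<lambda>a b. T r a b + u (Suc r) * E (Suc r) a b
     + (- (h + h)) * super_prod od I (e r) (E (Suc r)) a b)"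
    by (intro ext) (simp only: T.simps mult_minus_left diff_conv_add_uminus)
  then show ?case
    using gl_equivariant_add[OF gl_equivariant_add[OF 1 2] 3] by (simp only:)
qed

lemma u_super_prod: "u j * super_prod od C (e r) (E k) a b = super_prod od C (e r) (E k) a b * u j"
  unfolding super_prod_def sum_distrib_left sum_distrib_right
  by (rule sum.cong) (auto simp: sgn1_def mult.assoc[symmetric] u_e, simp_all add: mult.assoc u_E)

lemma u_T: "u j * T r a b = T r a b * u j"
proof (induction r)
  case (Suc r)
  have "u j * (u (Suc r) * E (Suc r) a b) = u (Suc r) * E (Suc r) a b * u j"
    by (subst commute_left[OF u_comm], subst u_E[of j]) (simp only: mult.assoc)
  moreover have "u j * ((h + h) * super_prod od I (e r) (E (Suc r)) a b)
     = (h + h) * super_prod od I (e r) (E (Suc r)) a b * u j"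
    by (simp add: h2_left u_super_prod mult.assoc)
  ultimately show ?case
    using Suc by (simp add: distrib_left distrib_right left_diff_distrib right_diff_distrib)
qed simp

lemma T_E_comm: "r < k \<Longrightarrow> T r c d * E k a b = \<epsilon> a b c d * (E k a b * T r c d)"
  by (auto simp: E_T_comm sgn2_def)

section \<open>Commutators of the diagonal monodromy coefficients\<close>

definition comm :: "'a \<Rightarrow> 'a \<Rightarrow> 'a" where "comm x y = x * y - y * x"

context
  fixes r a b :: nat
  assumes ab: "a \<in> I" "b \<in> I" "a \<noteq> b"
begin

abbreviation (input) "cross \<equiv> super_prod od I (e r) (E (Suc r))"
abbreviation (input) "newE \<equiv> E (Suc r)"

lemma sum_delta_sgn:
  "c \<in> I \<Longrightarrow> (\<Sum>x\<in>I. s x * (if x = c then f x else 0)) = s c * f c"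
  "c \<in> I \<Longrightarrow> (\<Sum>x\<in>I. s x * (if c = x then f x else 0)) = s c * f c"
  by (simp_all add: if_distrib[of "\<lambda>x. _ * x"] finite_I cong: if_cong)

text \<open>Since a and b differ, moving T_aa past e_bc leaves a correction only at c = a. Past the
  new site T_aa moves freely, being even.\<close>

lemma T_cross: "comm (T r a a) (cross b b) = - (s a * (T r b a * newE a b))"
proof -
  have "T r a a * (s c * (e r b c * newE c b)) = s c * (e r b c * newE c b) * T r a a
     - s c * (if c = a then T r b a * newE c b else 0)" if c: "c \<in> I" for c
  proof -
    have "e r b c * T r a a = T r a a * e r b c + (if c = a then T r b a else 0)"
      using gl_equivariantD[OF T_eqv ab(2) c, of r a a] ab(3) by (simp add: sgn2_def)
    then have "T r a a * e r b c = e r b c * T r a a - (if c = a then T r b a else 0)"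
      by simp
    then have "(T r a a * e r b c) * newE c b = (e r b c * T r a a - (if c = a then T r b a else 0)) * newE c b"
      by simp
    also have "\<dots> = e r b c * newE c b * T r a a - (if c = a then T r b a * newE c b else 0)"
      using T_E_comm[of r "Suc r" a a c b] by (auto simp: left_diff_distrib mult.assoc sgn2_def)
    finally show ?thesis by (simp add: sgn1_def mult.assoc algebra_simps)
  qed
  then show ?thesis
    unfolding comm_def super_prod_def sum_distrib_left sum_distrib_right
    by (simp add: sum_subtractf sum_delta_sgn ab)
qed

text \<open>On one site E_aa E_cb survives only for c = a, while E_cb E_aa vanishes because a and b
  differ.\<close>

lemma newE_cross: "comm (newE a a) (cross b b) = s a * (e r b a * newE a b)"
proof -
  have "newE a a * (s c * (e r b c * newE c b)) = s c * (if a = c then e r b c * newE a b else 0)" for c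
    by (simp add: E_e_left E_same sgn1_def sgn2_def)
  moreover have "s c * (e r b c * newE c b) * newE a a = 0" for c
    using E_same[of "Suc r" c b a a] ab(3) by (simp add: mult.assoc)
  ultimately show ?thesis
    unfolding comm_def super_prod_def sum_distrib_left sum_distrib_right
    by (simp add: sum_delta_sgn ab del: mult_minus_left)
qed

lemma newE_cross_gen:
  assumes "x \<in> I" "y \<in> I"
  shows "newE c x * cross y y = s x * (\<epsilon> c x y x * (e r y x * newE c y))"
proof -
  have "newE c x * (s d * (e r y d * newE d y)) = s d * (if x = d then \<epsilon> c x y d * (e r y d * newE c y) else 0)" for d
    by (simp add: E_e_left E_same sgn1_def sgn2_def)
  then show ?thesis
    unfolding super_prod_def sum_distrib_left
    by (simp add: sum_delta_sgn assms)
qed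

lemma cross_cross_sum:
  assumes "x \<in> I" "y \<in> I"
  shows "cross x x * cross y y = (\<Sum>c\<in>I. s c * (s x * (\<epsilon> c x y x * (e r x c * (e r y x * newE c y)))))"
proof -
  have "s c * (e r x c * newE c x) * cross y y = s c * (s x * (\<epsilon> c x y x * (e r x c * (e r y x * newE c y))))" for c
    using newE_cross_gen[OF assms, of c] by (simp add: mult.assoc) (simp add: sgn1_def sgn2_def mult.assoc)
  then show ?thesis
    by (subst super_prod_def) (simp add: sum_distrib_right)
qed

text \<open>The product of the two crossing terms contains e_ac e_ba. Reordering e_ba e_ac to it
  costs e_bc for every c, and e_aa at c = b. These two corrections are cancelled later by
  \<open>cross_newE\<close> and \<open>newE_cross2\<close>.\<close>

lemma e_cross: "s a * (e r b a * cross a b) = cross a a * cross b b + s a * cross b b - e r a a * newE b b"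
proof -
  have "s a * (e r b a * (s c * (e r a c * newE c b))) = s c * (s a * (\<epsilon> c a b a * (e r a c * (e r b a * newE c b))))
     + s a * (s c * (e r b c * newE c b)) - s c * (if c = b then s b * (e r a a * newE b b) else 0)" if c: "c \<in> I" for c
  proof -
    have "e r b a * e r a c = \<epsilon> b a a c * (e r a c * e r b a) + e r b c
       - \<epsilon> b a a c * (if b = c then e r a a else 0)"
      using gl_equivariantD[OF e_eqv ab(2) ab(1), of r a c] by simp
    then have "(e r b a * e r a c) * newE c b = (\<epsilon> b a a c * (e r a c * e r b a) + e r b c
       - \<epsilon> b a a c * (if b = c then e r a a else 0)) * newE c b" by simp
    then have 1: "e r b a * (e r a c * newE c b) = \<epsilon> b a a c * (e r a c * (e r b a * newE c b)) + e r b c * newE c b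
       - \<epsilon> b a a c * (if c = b then e r a a * newE b b else 0)"
      by (auto simp: mult.assoc distrib_right left_diff_distrib)
    have "s a * (e r b a * (s c * (e r a c * newE c b))) = s c * (s a * (e r b a * (e r a c * newE c b)))"
      by (simp add: sgn1_def)
    also have "\<dots> = s c * (s a * (\<epsilon> c a b a * (e r a c * (e r b a * newE c b))))
     + s a * (s c * (e r b c * newE c b)) - s c * (if c = b then s b * (e r a a * newE b b) else 0)"
      unfolding 1 by (auto simp: sgn1_def sgn2_def)
    finally show ?thesis .
  qed
  then have "s a * (e r b a * cross a b) = cross a a * cross b b + s a * cross b b - s b * (s b * (e r a a * newE b b))"
    unfolding cross_cross_sum[OF ab(1,2)]
    unfolding super_prod_def sum_distrib_left
    by (simp add: sum.distrib sum_subtractf sum_delta_sgn ab)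
  then show ?thesis by (simp add: sgn1_def)
qed

lemma newE_cross2: "newE b a * cross a b = s a * (e r a a * newE b b)"
proof -
  have "newE b a * (s c * (e r a c * newE c b)) = s c * (if a = c then e r a c * newE b b else 0)" for c
    by (simp add: E_e_left E_same sgn1_def sgn2_def)
  then show ?thesis
    unfolding super_prod_def sum_distrib_left
    by (simp add: sum_delta_sgn ab)
qed

lemma cross_newE: "cross b a * newE a b = cross b b"
  unfolding super_prod_def sum_distrib_right
  by (simp add: E_same mult.assoc)

text \<open>Moving e_ab past the new site costs only a sign, and e_bc e_ab already has the order
  that occurs in the product of the two crossing terms. Hence there is no correction, in contrast to
  \<open>e_cross\<close>.\<close>

lemma cross_e: "s a * (cross b a * e r a b) = cross b b * cross a a"
proof -
  have "s a * (s c * (e r b c * newE c a) * e r a b) = s c * (s b * (\<epsilon> c b a b * (e r b c * (e r a b * newE c a))))" for c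
  proof -
    have "s a * (s c * (e r b c * newE c a) * e r a b) = s a * (s c * (e r b c * (newE c a * e r a b)))"
      by (simp add: mult.assoc)
    also have "\<dots> = s c * (s b * (\<epsilon> c b a b * (e r b c * (e r a b * newE c a))))"
      by (subst E_e_comm) (auto simp: sgn1_def sgn2_def mult.assoc)
    finally show ?thesis .
  qed
  then show ?thesis
    unfolding cross_cross_sum[OF ab(2,1)]
    unfolding super_prod_def sum_distrib_left sum_distrib_right
    by simp
qed

text \<open>The bracket on the right is what the crossing terms contribute to e_ba T_ab - T_ba e_ab
  when one site is added, up to the factor -\<lambda>. In this form it is the coefficient of
  \<lambda> squared in the induction step of \<open>T_T\<close>.\<close>

lemma cross_cross: "comm (cross a a) (cross b b) =
  s a * (e r b a * cross a b + newE b a * cross a b - cross b a * e r a b - cross b a * newE a b)"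
  using e_cross newE_cross2 cross_newE cross_e
  by (simp add: comm_def distrib_left right_diff_distrib) (simp add: sgn1_def)

end

lemma comm_anti: "comm x y = - comm y x" by (simp add: comm_def)

text \<open>The RTT relation for two second coefficients; diagonal entries are even, so the plain
  commutator is the supercommutator. After adding a site both sides are polynomials in the new
  \<open>u\<close> and in \<lambda>, and their coefficients are compared.\<close>

lemma T_T:
  assumes "a \<in> I" "b \<in> I" "a \<noteq> b"
  shows "comm (T r a a) (T r b b) = - ((h + h) * (s a * (e r b a * T r a b - T r b a * e r a b)))"
proof (induction r)
  case 0 show ?case by (simp add: comm_def)
next
  case (Suc r)
  let ?P = "super_prod od I (e r) (E (Suc r))" and ?F = "E (Suc r)" and ?U = "u (Suc r)" and ?L = "h + h"
  note ab = assms assms(2,1) assms(3)[symmetric]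
  \<comment> \<open>The three parts are the old coefficient, the new matrix unit and the crossing
    term. Since \<lambda> is central and the new \<open>u\<close> commutes with all parts, the
    commutator expands like that of polynomials.\<close>
  have expand: "comm (x1 + ?U * x2 - ?L * x3) (y1 + ?U * y2 - ?L * y3) =
      comm x1 y1 + ?U * (comm x1 y2 + comm x2 y1) + ?U * ?U * comm x2 y2
      - ?L * (comm x1 y3 + comm x3 y1) - ?L * (?U * (comm x2 y3 + comm x3 y2)) + ?L * (?L * comm x3 y3)"
    if U: "?U * x1 = x1 * ?U" "?U * x2 = x2 * ?U" "?U * x3 = x3 * ?U"
      "?U * y1 = y1 * ?U" "?U * y2 = y2 * ?U" "?U * y3 = y3 * ?U" for x1 x2 x3 y1 y2 y3
  proof -
    note 1 = h2_left[of x1] h2_left[of x2] h2_left[of x3] h2_left[of y1] h2_left[of y2] h2_left[of y3]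
      h2_left[of ?U]
    have 2: "x1 * (?U * y) = ?U * (x1 * y)" "x2 * (?U * y) = ?U * (x2 * y)" "x3 * (?U * y) = ?U * (x3 * y)"
      "y1 * (?U * y) = ?U * (y1 * y)" "y2 * (?U * y) = ?U * (y2 * y)" "y3 * (?U * y) = ?U * (y3 * y)" for y
      using U by (simp_all add: commute_left)
    \<comment> \<open>\<lambda> = h + h is made an atom, since distributivity would otherwise split
      it.\<close>
    obtain L where L: "L = ?L" by simp
    show ?thesis
      using 1 2 unfolding L[symmetric] comm_def
      by (simp add: distrib_left distrib_right left_diff_distrib right_diff_distrib mult.assoc)
  qed
  \<comment> \<open>This removes every new commutator that contains no crossing term, in particular
    the part quadratic in the new \<open>u\<close>.\<close>
  have z: "comm (T r a a) (?F b b) = 0" "comm (?F a a) (T r b b) = 0" "comm (?F a a) (?F b b) = 0"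
    using E_T_comm[of r "Suc r"] E_same ab(3) by (simp_all add: comm_def sgn2_def)
  have "comm (T (Suc r) a a) (T (Suc r) b b) = comm (T r a a) (T r b b)
      - ?L * (comm (T r a a) (?P b b) + comm (?P a a) (T r b b))
      - ?L * (?U * (comm (?F a a) (?P b b) + comm (?P a a) (?F b b))) + ?L * (?L * comm (?P a a) (?P b b))"
    unfolding T.simps
    by (subst expand) (simp_all add: u_T u_E u_super_prod z)
  also have "comm (?P a a) (T r b b) = s b * (T r a b * ?F b a)"
    by (subst comm_anti) (simp add: T_cross[OF ab(4-6)])
  also have "comm (?P a a) (?F b b) = - (s b * (e r a b * ?F b a))"
    by (subst comm_anti) (simp add: newE_cross[OF ab(4-6)])
  finally have 1: "comm (T (Suc r) a a) (T (Suc r) b b) =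
     - (?L * (s a * (e r b a * T r a b - T r b a * e r a b)))
      - ?L * (- (s a * (T r b a * ?F a b)) + s b * (T r a b * ?F b a))
      - ?L * (?U * (s a * (e r b a * ?F a b) - s b * (e r a b * ?F b a)))
      + ?L * (?L * (s a * (e r b a * ?P a b + ?F b a * ?P a b - ?P b a * e r a b - ?P b a * ?F a b)))"
    unfolding Suc T_cross[OF ab(1-3)] newE_cross[OF ab(1-3)] cross_cross[OF ab(1-3)] by simp
  have 2: "s b * (T r a b * ?F b a) = s a * (?F b a * T r a b)"
     "s b * (e r a b * ?F b a) = s a * (?F b a * e r a b)"
    by (simp_all add: E_T_comm E_e_comm) (simp_all add: sgn1_def sgn2_def)
  have 3: "e r b a * (?U * x) = ?U * (e r b a * x)" "?F b a * (?U * x) = ?U * (?F b a * x)" for x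
    by (rule e_u_left E_u_left)+
  note 4 = h2_left[of "e r b a"] h2_left[of "?F b a"] h2_left[of "T r b a"] h2_left[of ?U]
  have 5: "(e r b a + ?F b a) * (T r a b + ?U * ?F a b - ?L * ?P a b)
     - (T r b a + ?U * ?F b a - ?L * ?P b a) * (e r a b + ?F a b) =
     (e r b a * T r a b - T r b a * e r a b) + (?F b a * T r a b - T r b a * ?F a b)
     + ?U * (e r b a * ?F a b - ?F b a * e r a b)
     - ?L * (e r b a * ?P a b + ?F b a * ?P a b - ?P b a * e r a b - ?P b a * ?F a b)"
  proof -
    obtain L where L: "L = ?L" by simp
    show ?thesis
      using 4 unfolding L[symmetric]
      by (simp add: distrib_left distrib_right left_diff_distrib right_diff_distrib mult.assoc 3)
  qed
  show ?case
    unfolding 1 2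
    unfolding T.simps e_Suc 5
    by (simp add: sgn1_def distrib_left right_diff_distrib algebra_simps)
qed

section \<open>Cut corrections and the commuting diagonal elements\<close>

definition below :: "nat \<Rightarrow> nat set" where "below i = {k \<in> I. k \<le> i}"

definition \<sigma> :: "nat \<Rightarrow> 'a" where "\<sigma> i = (\<Sum>k\<in>below i. s k)"

text \<open>The linear term symmetrises the quadratic one. On the entry (i+1, i+2), passing from i
  to i + 1 adds, up to sign, h times the sum of e_{i+1,i+1} e_{i+1,i+2} and the same product in the
  opposite order. The squares in \<open>ht\<close> contribute exactly such sums when bracketed with
  a neighbouring root vector.\<close>

definition G :: "nat \<Rightarrow> nat \<Rightarrow> nat \<Rightarrow> nat \<Rightarrow> 'a" where
  "G r i a b = T r a b + (h + h) * super_prod od (below i) (e r) (e r) a b - h * (\<sigma> i * e r a b)"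

text \<open>The cut depends on the entry here, not on a node. By \<open>ht_alt\<close> the Cartan
  elements are polynomials in these elements and in the diagonal \<open>e\<close>.\<close>

definition D :: "nat \<Rightarrow> nat \<Rightarrow> 'a" where
  "D r a = T r a a + (h + h) * super_prod od {k \<in> I. k < a} (e r) (e r) a a"

lemma s_comm: "s c * x = x * s c" by (simp add: sgn1_def)
lemma s_sq: "s c * s c = 1" "s c * (s c * x) = x" by (simp_all add: sgn1_def)

lemma \<sigma>_comm: "\<sigma> i * x = x * \<sigma> i"
  by (simp add: \<sigma>_def sum_distrib_left sum_distrib_right s_comm)

lemma h_left: "x * (h * y) = h * (x * y)" by (rule commute_left) (simp add: h_central)

lemma finite_below: "finite (below i)" using finite_I by (simp add: below_def)

lemma e_e:
  assumes "i \<in> I" "j \<in> I"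
  shows "e r i j * e r c d = \<epsilon> i j c d * (e r c d * e r i j) + (if j = c then e r i d else 0)
       - \<epsilon> i j c d * (if i = d then e r c j else 0)"
  by (rule gl_equivariantD[OF e_eqv assms])

text \<open>The defect is present only if exactly one of i and j is at most k. It is the source of
  the quadratic terms in the brackets of generators at the same node.\<close>

lemma e_G:
  assumes "i \<in> I" "j \<in> I"
  shows "e r i j * G r k c d = \<epsilon> i j c d * (G r k c d * e r i j) + (if j = c then G r k i d else 0)
       - \<epsilon> i j c d * (if i = d then G r k c j else 0)
       + (h + h) * (\<epsilon> i j c j * s j *
           ((if j \<le> k then e r c j * e r i d else 0) - (if i \<le> k then e r c j * e r i d else 0)))"
proof -
  \<comment> \<open>\<open>X\<close> is the equivariant part of \<open>G\<close>, and
    \<open>Q\<close> is the cut sum, the only part with a defect.\<close>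
  define X where "X c d = T r c d + (- (h * \<sigma> k)) * e r c d" for c d
  define Q where "Q c d = super_prod od (below k) (e r) (e r) c d" for c d
  obtain L where L: "L = h + h" by simp
  have GX: "G r k c d = X c d + L * Q c d" for c d
    by (simp add: G_def X_def Q_def L mult.assoc)
  have "gl_equivariant od I (e r) (\<lambda>c d. (- (h * \<sigma> k)) * e r c d)"
    by (rule gl_equivariant_scale[OF e_eqv]) (simp add: h_left \<sigma>_comm mult.assoc)
  then have "gl_equivariant od I (e r) X"
    unfolding X_def[abs_def] by (rule gl_equivariant_add[OF T_eqv])
  note X = gl_equivariantD[OF this assms, of c d]
  have Q: "e r i j * Q c d = \<epsilon> i j c d * (Q c d * e r i j) + (if j = c then Q i d else 0)
      - \<epsilon> i j c d * (if i = d then Q c j else 0) + \<epsilon> i j c j * s j *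
          ((if j \<le> k then e r c j * e r i d else 0) - (if i \<le> k then e r c j * e r i d else 0))"
    unfolding Q_def using gl_equivariant_prod[OF e_eqv[of r] e_eqv[of r] assms finite_below[of k], where a = c and b = d] assms
    by (simp add: below_def)
  have 0: "e r i j * G r k c d = e r i j * X c d + L * (e r i j * Q c d)"
    unfolding GX distrib_left by (simp add: L h2_left)
  show ?thesis
    unfolding 0 unfolding X Q GX L[symmetric] by (simp add: sgn2_def algebra_simps)
qed

lemma below_Suc: "Suc i \<in> I \<Longrightarrow> below (Suc i) = insert (Suc i) (below i)" "Suc i \<notin> below i"
  by (auto simp: below_def)

text \<open>Neighbouring nodes use cuts that differ by one index; this is how their generators of
  level 1 are compared.\<close>

lemma G_Suc:
  assumes "Suc i \<in> I"
  shows "G r (Suc i) a b = G r i a b + (h + h) * (s (Suc i) * (e r a (Suc i) * e r (Suc i) b))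
     - h * (s (Suc i) * e r a b)"
  using below_Suc[of i] assms finite_below
  by (simp add: G_def \<sigma>_def super_prod_def algebra_simps)

lemma sum_delta_sgn':
  "finite C \<Longrightarrow> c \<in> C \<Longrightarrow> (\<Sum>x\<in>C. s x * (if x = c then f x else 0)) = s c * f c"
  by (simp add: if_distrib[of "\<lambda>x. _ * x"] cong: if_cong)

lemma e_T: "i \<in> I \<Longrightarrow> j \<in> I \<Longrightarrow> e r i j * T r c d = \<epsilon> i j c d * (T r c d * e r i j) + (if j = c then T r i d else 0)
       - \<epsilon> i j c d * (if i = d then T r c j else 0)"
  by (rule gl_equivariantD[OF T_eqv])

text \<open>In the correction for b only the summand k = a fails to commute with T_aa, and it
  produces what cancels \<open>T_T\<close>. The correction for a involves only indices below b,
  which lie inside the cut for b, so it commutes with T_bb and with the correction for b.\<close>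

lemma D_commute_less:
  assumes "a \<in> I" "b \<in> I" "a < b"
  shows "comm (D r a) (D r b) = 0"
proof -
  define Q where "Q a = super_prod od {k \<in> I. k < a} (e r) (e r) a a" for a
  have TQ: "comm (T r a a) (Q b) = s a * (e r b a * T r a b - T r b a * e r a b)"
  proof -
    have "T r a a * (s k * (e r b k * e r k b)) = s k * (e r b k * e r k b) * T r a a
      + s k * (if k = a then e r b a * T r a b - T r b a * e r a b else 0)" if "k \<in> I" for k
    proof -
      have 1: "T r a a * e r b k = e r b k * T r a a - (if k = a then T r b a else 0)"
        using e_T[OF assms(2) that, of r a a] assms(3) by (simp add: sgn2_def)
      have 2: "T r a a * e r k b = e r k b * T r a a + (if k = a then T r a b else 0)"
        using e_T[OF that assms(2), of r a a] assms(3) by (simp add: sgn2_def)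
      have "T r a a * (e r b k * e r k b) = e r b k * (T r a a * e r k b) - (if k = a then T r b a * e r k b else 0)"
        using 1 by (simp add: mult.assoc[symmetric] left_diff_distrib)
      then show ?thesis unfolding 2
        by (cases "k = a") (simp_all add: sgn1_def algebra_simps)
    qed
    then show ?thesis unfolding comm_def Q_def super_prod_def sum_distrib_left sum_distrib_right
      using assms finite_I by (simp add: sum.distrib sum_delta_sgn')
  qed
  have QT: "comm (Q a) (T r b b) = 0"
  proof -
    have "s k * (e r a k * e r k a) * T r b b = T r b b * (s k * (e r a k * e r k a))" if "k \<in> I" "k < a" for k
    proof -
      have 1: "e r a k * T r b b = T r b b * e r a k" "e r k a * T r b b = T r b b * e r k a"
        using e_T[of a k r b b] e_T[of k a r b b] assms that by (simp_all add: sgn2_def)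
      have "e r a k * e r k a * T r b b = T r b b * (e r a k * e r k a)"
        using 1 by (metis mult.assoc)
      then show ?thesis by (simp add: sgn1_def)
    qed
    then show ?thesis unfolding comm_def Q_def super_prod_def sum_distrib_left sum_distrib_right
      by simp
  qed
  have QQ: "comm (Q a) (Q b) = 0"
  proof -
    have "s k * (e r a k * e r k a) * Q b = Q b * (s k * (e r a k * e r k a))" if "k \<in> I" "k < a" for k
    proof -
      have 1: "e r a k * Q b = Q b * e r a k" "e r k a * Q b = Q b * e r k a"
        unfolding Q_def using assms that finite_I
        by (simp_all add: gl_equivariant_prod[OF e_eqv e_eqv] sgn2_def)
      have "e r a k * e r k a * Q b = Q b * (e r a k * e r k a)"
        using 1 by (metis mult.assoc)
      then show ?thesis by (simp add: sgn1_def)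
    qed
    then show ?thesis unfolding comm_def Q_def[of a] super_prod_def sum_distrib_left sum_distrib_right
      by simp
  qed
  have "comm (D r a) (D r b) = comm (T r a a) (T r b b) + (h + h) * comm (T r a a) (Q b)
     + (h + h) * comm (Q a) (T r b b) + (h + h) * ((h + h) * comm (Q a) (Q b))"
  proof -
    obtain L where L: "L = h + h" by simp
    note 1 = h2_left[of "Q a"] h2_left[of "Q b"] h2_left[of "T r b b"] h2_left[of "T r a a"]
    show ?thesis
      using 1 unfolding D_def Q_def[symmetric] L[symmetric] comm_def
      by (simp add: algebra_simps)
  qed
  then show ?thesis unfolding TQ QT QQ using T_T[of a b r] assms by simp
qed

lemma D_D: "a \<in> I \<Longrightarrow> b \<in> I \<Longrightarrow> D r a * D r b = D r b * D r a"
  using D_commute_less[of a b r] D_commute_less[of b a r]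
  by (cases a b rule: linorder_cases) (simp_all add: comm_def)

text \<open>The diagonal \<open>e\<close> measure weights, and \<open>D\<close> has weight
  0.\<close>

lemma e_D: "a \<in> I \<Longrightarrow> b \<in> I \<Longrightarrow> e r a a * D r b = D r b * e r a a"
  unfolding D_def distrib_left h2_left distrib_right[of _ _ "e r a a"] using finite_I
  by (simp add: gl_equivariant_prod[OF e_eqv e_eqv] e_T sgn2_def mult.assoc)

lemma e_e_diag: "a \<in> I \<Longrightarrow> b \<in> I \<Longrightarrow> e r a a * e r b b = e r b b * e r a a"
  using e_e[of a a r b b] by (simp add: sgn2_def)

end

section \<open>The relations of the Yangian\<close>

context super_sites
begin

definition x0 :: "nat \<Rightarrow> pm \<Rightarrow> nat \<Rightarrow> 'a" where
  "x0 r p i = (case p of Plus \<Rightarrow> e r i (Suc i) | Minus \<Rightarrow> s i * e r (Suc i) i)"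

definition x1 :: "nat \<Rightarrow> pm \<Rightarrow> nat \<Rightarrow> 'a" where
  "x1 r p i = (case p of Plus \<Rightarrow> G r i i (Suc i) | Minus \<Rightarrow> s i * G r i (Suc i) i)"

definition h0 :: "nat \<Rightarrow> nat \<Rightarrow> 'a" where
  "h0 r i = s i * e r i i - s (Suc i) * e r (Suc i) (Suc i)"

text \<open>The squares are chosen so that adding h times the square of \<open>h0\<close> leaves
  only the mixed product in \<open>h1_alt\<close>. That product is the defect in the bracket of
  opposite root vectors.\<close>

definition ht :: "nat \<Rightarrow> nat \<Rightarrow> 'a" where
  "ht r i = s i * G r i i i - s (Suc i) * G r i (Suc i) (Suc i)
     - h * (e r i i * e r i i + e r (Suc i) (Suc i) * e r (Suc i) (Suc i))"

definition h1 :: "nat \<Rightarrow> nat \<Rightarrow> 'a" where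
  "h1 r i = ht r i + h * (h0 r i * h0 r i)"

text \<open>The ring carries no grading, so the parities of the two arguments are passed along as
  Booleans.\<close>

definition brp :: "bool \<Rightarrow> bool \<Rightarrow> 'a \<Rightarrow> 'a \<Rightarrow> 'a" where
  "brp v w x y = x * y - (if v \<and> w then -1 else 1) * (y * x)"

abbreviation q :: "nat \<Rightarrow> bool" where "q i \<equiv> od i \<noteq> od (Suc i)"

abbreviation "sbr i j \<equiv> brp (q i) (q j)"

definition car :: "nat \<Rightarrow> nat \<Rightarrow> 'a" where
  "car i j = (if j = i then s i + s (Suc i) else if j = Suc i then - s (Suc i)
     else if i = Suc j then - s i else 0)"

definition psgn :: "pm \<Rightarrow> 'a" where "psgn p = (case p of Plus \<Rightarrow> 1 | Minus \<Rightarrow> -1)"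

lemma h1_alt:
  assumes "i \<in> I" "Suc i \<in> I"
  shows "h1 r i = s i * G r i i i - s (Suc i) * G r i (Suc i) (Suc i)
     - (h + h) * (s i * s (Suc i) * (e r i i * e r (Suc i) (Suc i)))"
  using e_e_diag[OF assms, of r]
  by (cases "od i"; cases "od (Suc i)") (simp_all add: h1_def ht_def h0_def sgn1_def algebra_simps)

text \<open>The cut c \<le> i is the strict cut below i + 1, so the second entry of \<open>G\<close>
  is \<open>D r (Suc i)\<close> up to a linear term. For the first entry it exceeds the cut of
  \<open>D r i\<close> by c = i alone, which gives the square of e_ii.\<close>

lemma ht_alt:
  assumes "i \<in> I" "Suc i \<in> I"
  shows "ht r i = s i * D r i - s (Suc i) * D r (Suc i) + h * (e r i i * e r i i)
     - h * (e r (Suc i) (Suc i) * e r (Suc i) (Suc i)) - h * (\<sigma> i * h0 r i)"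
proof -
  have b: "below i = insert i {k \<in> I. k < i}" "below i = {k \<in> I. k < Suc i}"
    using assms by (auto simp: below_def)
  have sp: "super_prod od (below i) (e r) (e r) i i = super_prod od {k \<in> I. k < i} (e r) (e r) i i
     + s i * (e r i i * e r i i)"
    unfolding b(1) super_prod_def using finite_I by (subst sum.insert) simp_all
  show ?thesis
    unfolding ht_def G_def D_def h0_def b(2)[symmetric] sp
    by (cases "od i"; cases "od (Suc i)") (simp_all add: sgn1_def algebra_simps)
qed

lemma commute_add: "x * y = y * x \<Longrightarrow> x * z = z * x \<Longrightarrow> x * (y + z) = (y + z) * x"
  and commute_diff: "x * y = y * x \<Longrightarrow> x * z = z * x \<Longrightarrow> x * (y - z) = (y - z) * x"
  and commute_mult: "x * y = y * x \<Longrightarrow> x * z = z * x \<Longrightarrow> x * (y * z) = (y * z) * x"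
  for x y z :: 'a
  by (simp_all add: algebra_simps, metis mult.assoc)

lemma h0_commute:
  assumes "i \<in> I" "Suc i \<in> I" "\<And>a. a \<in> I \<Longrightarrow> y * e r a a = e r a a * y"
  shows "y * h0 r i = h0 r i * y"
  unfolding h0_def by (intro commute_diff commute_mult s_comm[symmetric] assms)

text \<open>The element y is arbitrary, so that the lemma can be applied to each side of a
  commutator in turn; this reduces all Cartan relations to \<open>D_D\<close>, \<open>e_D\<close>
  and \<open>e_e_diag\<close>.\<close>

lemma h1_commute:
  assumes "i \<in> I" "Suc i \<in> I"
    and "\<And>a. a \<in> I \<Longrightarrow> y * e r a a = e r a a * y" and "\<And>a. a \<in> I \<Longrightarrow> y * D r a = D r a * y"
  shows "y * h1 r i = h1 r i * y"
  unfolding h1_def ht_alt[OF assms(1,2)]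
  by (intro commute_diff commute_add commute_mult s_comm[symmetric] \<sigma>_comm[symmetric] h_central[symmetric]
     h0_commute assms)

lemma h0_h0: "i \<in> I \<Longrightarrow> Suc i \<in> I \<Longrightarrow> j \<in> I \<Longrightarrow> Suc j \<in> I \<Longrightarrow> h0 r i * h0 r j = h0 r j * h0 r i"
  by (intro h0_commute h0_commute[symmetric] e_e_diag)

lemma h0_h1: "i \<in> I \<Longrightarrow> Suc i \<in> I \<Longrightarrow> j \<in> I \<Longrightarrow> Suc j \<in> I \<Longrightarrow> h0 r i * h1 r j = h1 r j * h0 r i"
  by (intro h1_commute h0_commute[symmetric] e_e_diag e_D e_D[symmetric])

lemma h1_h1: "i \<in> I \<Longrightarrow> Suc i \<in> I \<Longrightarrow> j \<in> I \<Longrightarrow> Suc j \<in> I \<Longrightarrow> h1 r i * h1 r j = h1 r j * h1 r i"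
  by (intro h1_commute h1_commute[symmetric] e_e_diag e_D e_D[symmetric] D_D)

lemma e_h_left: "e r a b * (h * x) = h * (e r a b * x)" by (rule h_left)

lemma diag_e:
  "a \<in> I \<Longrightarrow> c \<noteq> d \<Longrightarrow> e r a a * e r c d = e r c d * e r a a + (if a = c then e r c d else 0)
     - (if a = d then e r c d else 0)"
  using e_e[of a a r c d] by (simp add: sgn2_def)

lemma diag_e_left:
  "a \<in> I \<Longrightarrow> c \<noteq> d \<Longrightarrow> e r a a * (e r c d * x) = e r c d * (e r a a * x)
     + (if a = c then e r c d * x else 0) - (if a = d then e r c d * x else 0)"
  by (simp add: mult.assoc[symmetric] diag_e) (simp add: algebra_simps)

lemma diag_G:
  "a \<in> I \<Longrightarrow> e r a a * G r k c d = G r k c d * e r a a + (if a = c then G r k c d else 0)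
     - (if a = d then G r k c d else 0)"
  using e_G[of a a r k c d] by (simp add: sgn2_def)

lemma brp_gl:
  "a \<in> I \<Longrightarrow> b \<in> I \<Longrightarrow> brp (od a \<noteq> od b) (od c \<noteq> od d) (e r a b) (e r c d) = (if b = c then e r a d else 0)
      - \<epsilon> a b c d * (if a = d then e r c b else 0)"
  using e_e[of a b r c d] by (simp add: brp_def sgn2_def)

lemma brp_s: "brp v w (s c * x) y = s c * brp v w x y" "brp v w x (s c * y) = s c * brp v w x y"
  by (simp_all add: brp_def sgn1_def)

section \<open>Brackets of the generators\<close>

context
  fixes r i j :: nat
  assumes I: "i \<in> I" "Suc i \<in> I" "j \<in> I" "Suc j \<in> I"
begin

lemma x0_x0: "sbr i j (x0 r Plus i) (x0 r Minus j) = (if i = j then h0 r i else 0)"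
  using e_e[of i "Suc i" r "Suc j" j] I
  by (cases "od i"; cases "od (Suc i)"; cases "od j"; cases "od (Suc j)")
    (auto simp add: brp_def x0_def h0_def sgn1_def sgn2_def)

text \<open>The defect in \<open>e_G\<close> requires j \<le> i but not j + 1 \<le> i, hence i = j.
  It is then the mixed product of \<open>h1_alt\<close>.\<close>

lemma x1_x0: "sbr i j (x1 r Plus i) (x0 r Minus j) = (if i = j then h1 r i else 0)"
  using e_G[of "Suc j" j r i i "Suc i"] I
  by (cases "od i"; cases "od (Suc i)"; cases "od j"; cases "od (Suc j)")
    (auto simp add: brp_def x0_def x1_def h1_alt sgn1_def sgn2_def Suc_le_eq)

lemma x0_x1: "sbr i j (x0 r Plus i) (x1 r Minus j) = (if i = j then h1 r i else 0)"
  using e_G[of i "Suc i" r j "Suc j" j] I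
  using e_e_diag[of i "Suc i"]
  by (cases "od i"; cases "od (Suc i)"; cases "od j"; cases "od (Suc j)")
    (auto simp add: brp_def x0_def x1_def h1_alt sgn1_def sgn2_def Suc_le_eq)

lemma h0_x0: "h0 r i * x0 r p j - x0 r p j * h0 r i = psgn p * car i j * x0 r p j"
  using I
  by (cases p; cases "od i"; cases "od (Suc i)"; cases "od j")
    (auto simp add: h0_def x0_def psgn_def car_def sgn1_def diag_e mult_2 algebra_simps)

lemma h0_x1: "h0 r i * x1 r p j - x1 r p j * h0 r i = psgn p * car i j * x1 r p j"
  using I
  by (cases p; cases "od i"; cases "od (Suc i)"; cases "od j")
    (auto simp add: h0_def x1_def psgn_def car_def sgn1_def diag_G mult_2 algebra_simps)

text \<open>At i = j the defect of the cut cancels against the brackets of the squares. For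
  neighbours there is no defect, but the bracket yields \<open>G\<close> with the cut of node i, and
  the squares together with \<open>G_Suc\<close> change it to the cut of node j. For distant nodes
  everything vanishes.\<close>

lemma ht_x0: "ht r i * x0 r p j - x0 r p j * ht r i = psgn p * car i j * x1 r p j"
proof -
  consider "i = j" | "i = Suc j" | "j = Suc i" | "i \<noteq> j" "i \<noteq> Suc j" "j \<noteq> Suc i" by blast
  then show ?thesis
  proof cases
    case 1
    then show ?thesis using I
      by (cases p; cases "od i"; cases "od (Suc i)")
        (simp_all add: ht_def x0_def x1_def psgn_def car_def sgn1_def sgn2_def e_G diag_e diag_e_left e_h_left mult_2 algebra_simps)
  next
    case 2 then show ?thesis using I
      by (cases p; cases "od i"; cases "od (Suc i)"; cases "od j")
        (simp_all add: ht_def x0_def x1_def psgn_def car_def sgn1_def sgn2_def e_G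
          diag_e diag_e_left e_h_left mult_2 algebra_simps,
         simp_all add: sgn1_def G_Suc diag_e algebra_simps)
  next
    case 3 then show ?thesis using I
      by (cases p; cases "od i"; cases "od (Suc i)"; cases "od (Suc j)")
        (simp_all add: ht_def x0_def x1_def psgn_def car_def sgn1_def sgn2_def e_G
          diag_e diag_e_left e_h_left mult_2 algebra_simps,
         simp_all add: sgn1_def G_Suc diag_e algebra_simps)
  next
    case 4
    then have "(Suc j \<le> i) = (j \<le> i)" by auto
    with 4 show ?thesis using I
      by (cases p; cases "od i"; cases "od (Suc i)"; cases "od j"; cases "od (Suc j)")
        (simp_all add: ht_def x0_def x1_def psgn_def car_def sgn1_def sgn2_def e_G diag_e diag_e_left e_h_left mult_2 algebra_simps)
  qed
qed

text \<open>
  The hypothesis is needed because the right-hand side has an anticommutator without sign, which is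
  wrong for two different odd simple roots.
\<close>

lemma x1_x0_same:
  assumes "i = j \<or> \<not> (q i \<and> q j)"
  shows "sbr i j (x1 r p i) (x0 r p j) - sbr i j (x0 r p i) (x1 r p j)
   = psgn p * h * car i j * (x0 r p i * x0 r p j + x0 r p j * x0 r p i)"
proof -
  consider "i = j" | "i = Suc j" | "j = Suc i" | "i \<noteq> j" "i \<noteq> Suc j" "j \<noteq> Suc i" by blast
  then show ?thesis
  proof cases
    case 1
    then show ?thesis using I assms
      by (cases p; cases "od i"; cases "od (Suc i)")
        (simp_all add: brp_def x0_def x1_def psgn_def car_def sgn1_def sgn2_def e_G diag_e e_h_left mult_2 algebra_simps)
  next
    case 2 then show ?thesis using I assms
      by (cases p; cases "od i"; cases "od (Suc i)"; cases "od j")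
        (simp_all add: brp_def x0_def x1_def psgn_def car_def sgn1_def sgn2_def e_G
          diag_e e_h_left mult_2 algebra_simps,
         simp_all add: sgn1_def sgn2_def G_Suc e_e[of "Suc j" "Suc (Suc j)" r j "Suc j"] e_e[of "Suc j" j r "Suc (Suc j)" "Suc j"]
          algebra_simps)
  next
    case 3 then show ?thesis using I assms
      by (cases p; cases "od i"; cases "od (Suc i)"; cases "od (Suc j)")
        (simp_all add: brp_def x0_def x1_def psgn_def car_def sgn1_def sgn2_def e_G
          diag_e e_h_left mult_2 algebra_simps,
         simp_all add: sgn1_def sgn2_def G_Suc e_e[of "Suc i" "Suc (Suc i)" r i "Suc i"] e_e[of "Suc i" i r "Suc (Suc i)" "Suc i"]
          algebra_simps)
  next
    case 4
    then have "(Suc j \<le> i) = (j \<le> i)" by auto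
    with 4 show ?thesis using I
      by (cases p; cases "od i"; cases "od (Suc i)"; cases "od j"; cases "od (Suc j)")
        (simp_all add: brp_def x0_def x1_def psgn_def car_def sgn1_def sgn2_def e_G diag_e e_h_left mult_2 algebra_simps)
  qed
qed

lemma x0_brp:
  "sbr i j (x0 r Plus i) (x0 r Plus j) = (if Suc i = j then e r i (Suc j) else 0)
     - sgn2 od i (Suc i) j (Suc j) * (if i = Suc j then e r j (Suc i) else 0)"
  "sbr i j (x0 r Minus i) (x0 r Minus j) = s i * s j * ((if i = Suc j then e r (Suc i) j else 0)
     - sgn2 od i (Suc i) j (Suc j) * (if Suc i = j then e r (Suc j) i else 0))"
  using e_e[of i "Suc i" r j "Suc j"] e_e[of "Suc i" i r "Suc j" j] I
  by (auto simp: x0_def brp_s, auto simp: brp_def sgn1_def sgn2_def)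

lemma x0_serre0:
  assumes "i \<noteq> j" "i \<noteq> Suc j" "j \<noteq> Suc i"
  shows "sbr i j (x0 r p i) (x0 r p j) = 0"
  using assms x0_brp by (cases p) simp_all

text \<open>For neighbours the inner bracket is, up to sign, a single unit. It has no index left
  that matches the root vector of node i, so the outer bracket vanishes; this includes the odd
  node.\<close>

lemma x0_serre1:
  assumes "i = Suc j \<or> j = Suc i"
  shows "brp (q i) (q i \<noteq> q j) (x0 r p i) (sbr i j (x0 r p i) (x0 r p j)) = 0"
proof (cases p)
  case Plus
  show ?thesis unfolding Plus x0_brp
    using assms I e_e[of i "Suc i" r i "Suc j"] e_e[of i "Suc i" r j "Suc i"]
    by (auto simp: x0_def brp_def sgn2_def)
next
  case Minus
  show ?thesis unfolding Minus x0_brp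
    using assms I e_e[of "Suc i" i r "Suc i" j] e_e[of "Suc i" i r "Suc j" i]
    by (auto simp: x0_def brp_def sgn1_def sgn2_def)
qed

end

lemma x0_odd: "i \<in> I \<Longrightarrow> Suc i \<in> I \<Longrightarrow> sbr i i (x0 r p i) (x0 r p i) = 0"
  using x0_brp[of i i r] by (cases p) (simp_all add: x0_def brp_s)

text \<open>Up to sign and transposition the inner brackets are the units at (i, i+2) and (i+1,
  i+3). No index of one meets the other, so they supercommute.\<close>

lemma x0_quartic:
  assumes "i \<in> I" "Suc i \<in> I" "Suc (Suc i) \<in> I" "Suc (Suc (Suc i)) \<in> I"
  shows "brp (q i \<noteq> q (Suc i)) (q (Suc i) \<noteq> q (Suc (Suc i))) (sbr i (Suc i) (x0 r p i) (x0 r p (Suc i)))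
     (sbr (Suc i) (Suc (Suc i)) (x0 r p (Suc i)) (x0 r p (Suc (Suc i)))) = 0"
proof (cases p)
  case Plus
  have "brp (q i \<noteq> q (Suc i)) (q (Suc i) \<noteq> q (Suc (Suc i))) (e r i (Suc (Suc i)))
      (e r (Suc i) (Suc (Suc (Suc i)))) = 0"
    using e_e[of i "Suc (Suc i)" r "Suc i" "Suc (Suc (Suc i))"] assms
    by (auto simp: brp_def sgn2_def)
  then show ?thesis unfolding Plus x0_brp(1)[OF assms(1,2,2,3)] x0_brp(1)[OF assms(2,3,3,4)]
    by simp
next
  case Minus
  have "brp (q i \<noteq> q (Suc i)) (q (Suc i) \<noteq> q (Suc (Suc i))) (e r (Suc (Suc i)) i)
      (e r (Suc (Suc (Suc i))) (Suc i)) = 0"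
    using e_e[of "Suc (Suc i)" i r "Suc (Suc (Suc i))" "Suc i"] assms
    by (auto simp: brp_def sgn2_def)
  then show ?thesis unfolding Minus x0_brp(2)[OF assms(1,2,2,3)] x0_brp(2)[OF assms(2,3,3,4)]
    by (simp add: brp_def sgn1_def sgn2_def)
qed

section \<open>The symmetric matrices behind the generators J\<close>

definition \<tau> :: 'a where "\<tau> = (\<Sum>k\<in>I. s k)"

text \<open>The quadratic term is half the full sum over \<open>I\<close>; the linear term removes
  the part of it in which both units sit on the same site.\<close>

definition J :: "nat \<Rightarrow> nat \<Rightarrow> nat \<Rightarrow> 'a" where
  "J r a b = T r a b + h * super_prod od I (e r) (e r) a b - h * (\<tau> * e r a b)"

definition ksgn :: "nat \<Rightarrow> nat \<Rightarrow> 'a" where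
  "ksgn k i = (if k < i then -1 else if i < k then 1 else 0)"

definition above :: "nat \<Rightarrow> nat set" where "above i = {k \<in> I. Suc i < k}"

lemma I_split:
  assumes "i \<in> I" "Suc i \<in> I"
  shows "I = {k \<in> I. k < i} \<union> {i, Suc i} \<union> above i" "below i = insert i {k \<in> I. k < i}"
    "I - {i, Suc i} = {k \<in> I. k < i} \<union> above i"
    "I - {i} = {k \<in> I. k < i} \<union> {Suc i} \<union> above i"
    "I - {Suc i} = {k \<in> I. k < i} \<union> {i} \<union> above i"
  using assms by (auto simp: above_def below_def)

lemma sum_split:
  fixes f :: "nat \<Rightarrow> 'b::comm_monoid_add"
  assumes "i \<in> I" "Suc i \<in> I"
  shows "sum f I = sum f {k \<in> I. k < i} + f i + f (Suc i) + sum f (above i)"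
   "sum f (below i) = sum f {k \<in> I. k < i} + f i"
   "sum f (I - {i, Suc i}) = sum f {k \<in> I. k < i} + sum f (above i)"
   "sum f (I - {i}) = sum f {k \<in> I. k < i} + f (Suc i) + sum f (above i)"
   "sum f (I - {Suc i}) = sum f {k \<in> I. k < i} + f i + sum f (above i)"
proof -
  have fin: "finite {k \<in> I. k < i}" "finite (above i)" using finite_I by (simp_all add: above_def)
  have dis: "{k \<in> I. k < i} \<inter> above i = {}" by (auto simp: above_def)
  have dis2: "x \<notin> {k \<in> I. k < i} \<union> above i" if "x = i \<or> x = Suc i" for x using that by (auto simp: above_def)
  have u: "sum f ({k \<in> I. k < i} \<union> above i) = sum f {k \<in> I. k < i} + sum f (above i)"
    using fin dis by (rule sum.union_disjoint)
  note s = I_split[OF assms]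
  have "I = insert i (insert (Suc i) ({k \<in> I. k < i} \<union> above i))" using s(1) by blast
  also have "sum f \<dots> = f i + (f (Suc i) + sum f ({k \<in> I. k < i} \<union> above i))"
    using fin dis2 by (subst sum.insert; (subst sum.insert)?) auto
  finally show "sum f I = sum f {k \<in> I. k < i} + f i + f (Suc i) + sum f (above i)"
    by (simp only: u add.assoc add.commute add.left_commute)
  show "sum f (below i) = sum f {k \<in> I. k < i} + f i"
    unfolding s(2) using fin by (subst sum.insert) (auto simp: add.commute)
  show "sum f (I - {i, Suc i}) = sum f {k \<in> I. k < i} + sum f (above i)" unfolding s(3) by (rule u)
  have "I - {i} = insert (Suc i) ({k \<in> I. k < i} \<union> above i)" using s(4) by blast
  also have "sum f \<dots> = f (Suc i) + sum f ({k \<in> I. k < i} \<union> above i)"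
    using fin dis2 by (subst sum.insert) auto
  finally show "sum f (I - {i}) = sum f {k \<in> I. k < i} + f (Suc i) + sum f (above i)" by (simp only: u add.assoc add.commute add.left_commute)
  have "I - {Suc i} = insert i ({k \<in> I. k < i} \<union> above i)" using s(5) by blast
  also have "sum f \<dots> = f i + sum f ({k \<in> I. k < i} \<union> above i)"
    using fin dis2 by (subst sum.insert) auto
  finally show "sum f (I - {Suc i}) = sum f {k \<in> I. k < i} + f i + sum f (above i)" by (simp only: u add.assoc add.commute add.left_commute)
qed

lemma ksgn_sum:
  fixes f :: "nat \<Rightarrow> 'a"
  shows "(\<Sum>k\<in>{k \<in> I. k < i}. s k * ksgn k i * f k) = - (\<Sum>k\<in>{k \<in> I. k < i}. s k * f k)"
   "(\<Sum>k\<in>{k \<in> I. k < i}. s k * ksgn k (Suc i) * f k) = - (\<Sum>k\<in>{k \<in> I. k < i}. s k * f k)"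
   "(\<Sum>k\<in>above i. s k * ksgn k i * f k) = (\<Sum>k\<in>above i. s k * f k)"
   "(\<Sum>k\<in>above i. s k * ksgn k (Suc i) * f k) = (\<Sum>k\<in>above i. s k * f k)"
  by (simp_all add: ksgn_def above_def sum_negf[symmetric])

text \<open>The cut sum has coefficient 2h for k \<le> i and 0 above. Adding h sign(k - i) makes it
  h for all k other than i and i + 1. The product of \<open>h0\<close> and \<open>x0\<close> repairs
  these two indices, and reordering it supplies the missing term of index i + 1 in the passage from
  \<open>\<sigma>\<close> to \<open>\<tau>\<close>.\<close>

lemma J_plus:
  assumes "i \<in> I" "Suc i \<in> I"
  shows "x1 r Plus i + h * (- (\<Sum>k\<in>above i. s k) * x0 r Plus i
     + (\<Sum>k\<in>I - {i, Suc i}. s k * ksgn k i * (e r i k * e r k (Suc i))) - h0 r i * x0 r Plus i) = J r i (Suc i)"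
  unfolding J_def \<tau>_def x0_def x1_def h0_def G_def \<sigma>_def super_prod_def sum_split[OF assms] ksgn_sum
  using assms
  by (cases "od i"; cases "od (Suc i)") (simp_all add: diag_e sgn1_def[of _ i] sgn1_def[of _ "Suc i"] mult_2 algebra_simps)

lemma J_minus:
  assumes "i \<in> I" "Suc i \<in> I"
  shows "x1 r Minus i + h * (- (\<Sum>k\<in>above i. s k) * x0 r Minus i
     + s i * (\<Sum>k\<in>I - {i, Suc i}. s k * ksgn k i * (e r (Suc i) k * e r k i)) - x0 r Minus i * h0 r i) = s i * J r (Suc i) i"
  unfolding J_def \<tau>_def x0_def x1_def h0_def G_def \<sigma>_def super_prod_def sum_split[OF assms] ksgn_sum
  using assms
  by (cases "od i"; cases "od (Suc i)") (simp_all add: diag_e sgn1_def[of _ i] sgn1_def[of _ "Suc i"] mult_2 algebra_simps)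

text \<open>Here no reordering supplies the linear term of index i + 1, so it has to be part of the
  coefficient; accordingly theta contains (i-1)^(0) where varpi has i^(0).\<close>

lemma J_cartan:
  assumes "i \<in> I" "Suc i \<in> I"
  shows "ht r i + h * (- (s (Suc i) + (\<Sum>k\<in>above i. s k)) * h0 r i
     + s i * (\<Sum>k\<in>I - {i}. s k * ksgn k i * (e r i k * e r k i))
     - s (Suc i) * (\<Sum>k\<in>I - {Suc i}. s k * ksgn k (Suc i) * (e r (Suc i) k * e r k (Suc i)))) =
    s i * J r i i - s (Suc i) * J r (Suc i) (Suc i)"
  unfolding J_def \<tau>_def ht_def h0_def G_def \<sigma>_def super_prod_def sum_split[OF assms] ksgn_sum
  using e_e_diag[OF assms, of r]
  using assms
  by (cases "od i"; cases "od (Suc i)") (simp_all add: ksgn_def sgn1_def[of _ i] sgn1_def[of _ "Suc i"] mult_2 algebra_simps)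

lemma e_sum: "super_prod od C (e r) (E k) a b = (\<Sum>j\<in>{1..r}. super_prod od C (E j) (E k) a b)"
proof -
  have "super_prod od C (e r) (E k) a b = (\<Sum>c\<in>C. \<Sum>j\<in>{1..r}. s c * (E j a c * E k c b))"
    by (simp add: super_prod_def e_def sum_distrib_left sum_distrib_right)
  then show ?thesis unfolding super_prod_def by (subst (asm) sum.swap)
qed

lemma e_sum': "super_prod od C (e r) (e r') a b = (\<Sum>k\<in>{1..r'}. super_prod od C (e r) (E k) a b)"
proof -
  have "super_prod od C (e r) (e r') a b = (\<Sum>c\<in>C. \<Sum>k\<in>{1..r'}. s c * (e r a c * E k c b))"
    unfolding super_prod_def e_def[of r'] sum_distrib_left ..
  then show ?thesis unfolding super_prod_def by (subst (asm) sum.swap)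
qed

lemma T_sites: "T r a b = (\<Sum>k\<in>{1..r}. u k * E k a b
   - (h + h) * (\<Sum>j\<in>{1..<k}. super_prod od I (E j) (E k) a b))"
  by (induction r) (simp_all add: e_sum atLeastLessThanSuc_atLeastAtMost)

text \<open>Minus 2h times the sum over j < k from \<open>T\<close>, plus h times the full sum over
  j, leaves h times the sum weighted by sign(j - k). The term j = k is \<open>\<tau>\<close> times
  E_ab and cancels the linear term. This is the shape of z_k with each transposition replaced by a
  product of two sites.\<close>

lemma J_sites: "J r a b = (\<Sum>k\<in>{1..r}. u k * E k a b
    + h * (\<Sum>j\<in>{1..r} - {k}. ksgn j k * super_prod od I (E j) (E k) a b))"
proof -
  have 1: "super_prod od I (E k) (E k) a b = \<tau> * E k a b" for k
    by (simp add: super_prod_def \<tau>_def E_same sum_distrib_right)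
  let ?f = "\<lambda>k j. super_prod od I (E j) (E k) a b"
  have 2: "(\<Sum>j\<in>{1..r}. ?f k j) = ?f k k + (\<Sum>j\<in>{1..<k}. ?f k j) + (\<Sum>j\<in>{k<..r}. ?f k j)"
    and 3: "(\<Sum>j\<in>{1..r} - {k}. ksgn j k * ?f k j) = (\<Sum>j\<in>{k<..r}. ?f k j) - (\<Sum>j\<in>{1..<k}. ?f k j)"
    if k: "k \<in> {1..r}" for k
  proof -
    have u: "sum g ({1..<k} \<union> {k<..r}) = sum g {1..<k} + sum g {k<..r}" for g :: "nat \<Rightarrow> 'a"
      by (rule sum.union_disjoint) auto
    have ins: "sum g (insert k ({1..<k} \<union> {k<..r})) = g k + sum g {1..<k} + sum g {k<..r}" for g :: "nat \<Rightarrow> 'a"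
    proof -
      have 1: "finite ({1..<k} \<union> {k<..r})" and 2: "k \<notin> {1..<k} \<union> {k<..r}" by auto
      show ?thesis unfolding sum.insert[OF 1 2] u by (rule add.assoc[symmetric])
    qed
    have "{1..r} = insert k ({1..<k} \<union> {k<..r})" using k by auto
    then show "(\<Sum>j\<in>{1..r}. ?f k j) = ?f k k + (\<Sum>j\<in>{1..<k}. ?f k j) + (\<Sum>j\<in>{k<..r}. ?f k j)"
      using ins[of "?f k"] by metis
    have "{1..r} - {k} = {1..<k} \<union> {k<..r}" using k by auto
    then have "(\<Sum>j\<in>{1..r} - {k}. ksgn j k * ?f k j) = (\<Sum>j\<in>{1..<k}. ksgn j k * ?f k j) + (\<Sum>j\<in>{k<..r}. ksgn j k * ?f k j)"
      by (simp only: u)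
    also have "(\<Sum>j\<in>{1..<k}. ksgn j k * ?f k j) = (\<Sum>j\<in>{1..<k}. - ?f k j)"
      by (rule sum.cong) (auto simp: ksgn_def)
    also have "(\<Sum>j\<in>{k<..r}. ksgn j k * ?f k j) = (\<Sum>j\<in>{k<..r}. ?f k j)"
      by (rule sum.cong) (auto simp: ksgn_def)
    finally show "(\<Sum>j\<in>{1..r} - {k}. ksgn j k * ?f k j) = (\<Sum>j\<in>{k<..r}. ?f k j) - (\<Sum>j\<in>{1..<k}. ?f k j)"
      by (simp add: sum_negf)
  qed
  have "J r a b = (\<Sum>k\<in>{1..r}. (u k * E k a b - (h + h) * (\<Sum>j\<in>{1..<k}. ?f k j))
      + h * (\<Sum>j\<in>{1..r}. ?f k j) - h * (\<tau> * E k a b))"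
    unfolding J_def T_sites e_sum' e_sum e_def[of r]
    by (simp add: sum.distrib sum_subtractf sum_distrib_left)
  also have "\<dots> = (\<Sum>k\<in>{1..r}. u k * E k a b
    + h * (\<Sum>j\<in>{1..r} - {k}. ksgn j k * super_prod od I (E j) (E k) a b))"
    by (rule sum.cong, rule refl, unfold 2 3 1) (simp add: distrib_left distrib_right right_diff_distrib)
  finally show ?thesis .
qed

end

section \<open>Linear operators and evaluation of free algebras\<close>

lemma lookup_scale: "Poly_Mapping.lookup (c *\<^sub>C f) k = c * Poly_Mapping.lookup f k"
  by (simp add: scale_def Poly_Mapping.map.rep_eq when_def)

lemma scale_add: "c *\<^sub>C (f + g) = c *\<^sub>C f + c *\<^sub>C g"
  and scale_add_left: "(c + d) *\<^sub>C f = c *\<^sub>C f + d *\<^sub>C f"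
  and scale_diff: "c *\<^sub>C (f - g) = c *\<^sub>C f - c *\<^sub>C g"
  and scale_minus: "c *\<^sub>C (- f) = - (c *\<^sub>C f)"
  and scale_minus_left: "(- c) *\<^sub>C f = - (c *\<^sub>C f)"
  and scale_scale: "c *\<^sub>C d *\<^sub>C f = (c * d) *\<^sub>C f"
  by (rule poly_mapping_eqI; simp add: lookup_scale lookup_add lookup_minus algebra_simps)+

lemma scale_simps [simp]: "1 *\<^sub>C f = f" "0 *\<^sub>C f = 0" "c *\<^sub>C 0 = 0"
  "c *\<^sub>C Poly_Mapping.single k x = Poly_Mapping.single k (c * x)"
  by (rule poly_mapping_eqI; simp add: lookup_scale lookup_single when_def)+

lemma scale_minus_one: "(-1) *\<^sub>C f = - f"
  by (simp add: scale_minus_left)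

lemma scale_sum: "c *\<^sub>C (\<Sum>x\<in>S. f x) = (\<Sum>x\<in>S. c *\<^sub>C f x)"
  by (rule poly_mapping_eqI) (simp add: lookup_scale lookup_sum sum_distrib_left)

lemma keys_scale: "Poly_Mapping.keys (c *\<^sub>C f) \<subseteq> Poly_Mapping.keys f"
  by (auto simp: in_keys_iff lookup_scale)

lemma poly_mapping_expand:
  "f = (\<Sum>k\<in>Poly_Mapping.keys f. Poly_Mapping.single k (Poly_Mapping.lookup f k))"
  by (rule poly_mapping_eqI)
     (auto simp: lookup_sum lookup_single when_def in_keys_iff sum.delta)

lemma poly_mapping_span_induct [consumes 1, case_names zero add single]:
  fixes f :: "'a \<Rightarrow>\<^sub>0 'b::comm_monoid_add"
  assumes "Poly_Mapping.keys f \<subseteq> B"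
    and "P 0"
    and "\<And>f g. Poly_Mapping.keys f \<subseteq> B \<Longrightarrow> Poly_Mapping.keys g \<subseteq> B \<Longrightarrow> P f \<Longrightarrow> P g \<Longrightarrow> P (f + g)"
    and "\<And>k c. k \<in> B \<Longrightarrow> P (Poly_Mapping.single k c)"
  shows "P f"
proof -
  have "P (\<Sum>k\<in>S. Poly_Mapping.single k (c k)) \<and> Poly_Mapping.keys (\<Sum>k\<in>S. Poly_Mapping.single k (c k)) \<subseteq> B"
    if "finite S" "S \<subseteq> B" for S and c :: "'a \<Rightarrow> 'b"
    using that
  proof (induction S)
    case (insert x S)
    then have 1: "P (\<Sum>k\<in>S. Poly_Mapping.single k (c k))"
      "Poly_Mapping.keys (\<Sum>k\<in>S. Poly_Mapping.single k (c k)) \<subseteq> B" "x \<in> B" by auto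
    have 2: "Poly_Mapping.keys (Poly_Mapping.single x (c x)) \<subseteq> B" using 1(3) by (simp add: keys_single)
    show ?case
      using insert assms(3)[OF 2 1(2) assms(4)[OF 1(3)] 1(1)]
        Poly_Mapping.keys_add[of "Poly_Mapping.single x (c x)" "\<Sum>k\<in>S. Poly_Mapping.single k (c k)"] 1 2
      by (simp, blast)
  qed (use assms in simp)
  from this[OF finite_keys assms(1), of "Poly_Mapping.lookup f"] show ?thesis
    by (subst poly_mapping_expand) blast
qed

definition is_lin :: "(('a \<Rightarrow>\<^sub>0 complex) \<Rightarrow> ('b \<Rightarrow>\<^sub>0 complex)) \<Rightarrow> bool" where
  "is_lin T \<longleftrightarrow> (\<forall>f g. T (f + g) = T f + T g) \<and> (\<forall>c f. T (c *\<^sub>C f) = c *\<^sub>C T f)"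

lemma is_linD: "is_lin T \<Longrightarrow> T (f + g) = T f + T g" "is_lin T \<Longrightarrow> T (c *\<^sub>C f) = c *\<^sub>C T f"
  by (simp_all add: is_lin_def)

lemma is_lin_0: "is_lin T \<Longrightarrow> T 0 = 0"
  using is_linD(2)[of T 0 0] by simp

lemma is_lin_diff: "is_lin T \<Longrightarrow> T (f - g) = T f - T g"
  using is_linD(1)[of T "f - g" g] by simp

lemma is_lin_sum: "is_lin T \<Longrightarrow> T (\<Sum>x\<in>S. f x) = (\<Sum>x\<in>S. T (f x))"
  by (induction S rule: infinite_finite_induct) (simp_all add: is_linD is_lin_0)

lemma is_lin_eqI:
  assumes "is_lin S" "is_lin T" "Poly_Mapping.keys f \<subseteq> B"
    and "\<And>b. b \<in> B \<Longrightarrow> S (Poly_Mapping.single b 1) = T (Poly_Mapping.single b 1)"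
  shows "S f = T f"
  using assms(3)
proof (induction f rule: poly_mapping_span_induct)
  case (single k c)
  have "Poly_Mapping.single k c = c *\<^sub>C Poly_Mapping.single k 1" by simp
  with single show ?case by (metis assms(1,2,4) is_linD(2))
qed (simp_all add: is_linD is_lin_0 assms)

lemma lin_ext_superset:
  assumes "finite S" "Poly_Mapping.keys f \<subseteq> S"
  shows "lin_ext g f = (\<Sum>a\<in>S. Poly_Mapping.lookup f a *\<^sub>C g a)"
  unfolding lin_ext_def using assms by (intro sum.mono_neutral_left) (auto simp: in_keys_iff)

lemma is_lin_lin_ext: "is_lin (lin_ext g)"
  unfolding is_lin_def
proof (intro conjI allI)
  fix f f' :: "'a \<Rightarrow>\<^sub>0 complex" and c
  let ?S = "Poly_Mapping.keys f \<union> Poly_Mapping.keys f'"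
  have "Poly_Mapping.keys (f + f') \<subseteq> ?S" by (rule Poly_Mapping.keys_add)
  then show "lin_ext g (f + f') = lin_ext g f + lin_ext g f'"
    by (simp add: lin_ext_superset[of ?S] lookup_add scale_add_left sum.distrib)
  show "lin_ext g (c *\<^sub>C f) = c *\<^sub>C lin_ext g f"
    using keys_scale[of c f]
    by (simp add: lin_ext_superset[of "Poly_Mapping.keys f"] lookup_scale scale_sum scale_scale)
qed

lemma lin_ext_single [simp]: "lin_ext g (Poly_Mapping.single a c) = c *\<^sub>C g a"
  using lin_ext_superset[of "{a}" "Poly_Mapping.single a c" g] by (simp add: keys_single)

lemma is_lin_comp: "is_lin S \<Longrightarrow> is_lin T \<Longrightarrow> is_lin (\<lambda>f. S (T f))"
  by (simp add: is_lin_def)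

text \<open>A type instead of a carrier set, so that the operators are an instance of
  \<open>ring_1\<close> and can interpret \<open>super_sites\<close>.\<close>

typedef 'b lop = "{T :: ('b \<Rightarrow>\<^sub>0 complex) \<Rightarrow> ('b \<Rightarrow>\<^sub>0 complex). is_lin T}"
  morphisms app Lop
  by (rule exI[of _ "\<lambda>f. f"]) (simp add: is_lin_def)

setup_lifting type_definition_lop

lemma is_lin_app: "is_lin (app T)" using app[of T] by simp

instantiation lop :: (type) ring_1
begin

lift_definition zero_lop :: "'a lop" is "\<lambda>_. 0" by (simp add: is_lin_def)
lift_definition one_lop :: "'a lop" is "\<lambda>f. f" by (simp add: is_lin_def)
lift_definition plus_lop :: "'a lop \<Rightarrow> 'a lop \<Rightarrow> 'a lop" is "\<lambda>S T f. S f + T f"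
  by (simp add: is_lin_def scale_add)
lift_definition minus_lop :: "'a lop \<Rightarrow> 'a lop \<Rightarrow> 'a lop" is "\<lambda>S T f. S f - T f"
  by (simp add: is_lin_def scale_diff)
lift_definition uminus_lop :: "'a lop \<Rightarrow> 'a lop" is "\<lambda>S f. - S f"
  by (simp add: is_lin_def scale_minus)
lift_definition times_lop :: "'a lop \<Rightarrow> 'a lop \<Rightarrow> 'a lop" is "\<lambda>S T f. S (T f)"
  by (simp add: is_lin_def)

instance
proof
  \<comment> \<open>Types are inhabited, so the free space contains a basis vector, which separates
    the two operators.\<close>
  show "(0 :: 'a lop) \<noteq> 1"
  proof
    assume "(0 :: 'a lop) = 1"
    then have "(0 :: 'a \<Rightarrow>\<^sub>0 complex) = Poly_Mapping.single undefined 1"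
      by transfer (rule fun_cong)
    then show False by (metis lookup_single_eq lookup_zero zero_neq_one)
  qed
qed (transfer; simp add: fun_eq_iff is_lin_def algebra_simps)+

end

lift_definition sc :: "complex \<Rightarrow> 'b lop" is "\<lambda>c f. c *\<^sub>C f"
  by (simp add: is_lin_def scale_add scale_scale mult.commute)

lift_definition basis_op :: "('b \<Rightarrow> 'b \<Rightarrow>\<^sub>0 complex) \<Rightarrow> 'b lop" is lin_ext
  by (rule is_lin_lin_ext)

lemma app_simps [simp]: "app 0 f = 0" "app 1 f = f" "app (S + T) f = app S f + app T f"
  "app (S - T) f = app S f - app T f" "app (- S) f = - app S f" "app (S * T) f = app S (app T f)"
  "app (sc c) f = c *\<^sub>C f" "app (basis_op g) f = lin_ext g f"
  by (transfer; simp)+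

lemma app_sum: "app (\<Sum>x\<in>A. S x) f = (\<Sum>x\<in>A. app (S x) f)"
  by (induction A rule: infinite_finite_induct) simp_all

lemma lop_eqI: "(\<And>b. app S (Poly_Mapping.single b 1) = app T (Poly_Mapping.single b 1)) \<Longrightarrow> S = T"
  by (rule app_inject[THEN iffD1], rule ext, rule is_lin_eqI[OF is_lin_app is_lin_app, of _ UNIV]) auto

lemma sc_comm: "sc c * T = T * sc c"
  by (rule lop_eqI) (simp only: app_simps is_linD(2)[OF is_lin_app])

lemma sc_add: "sc (c + d) = sc c + sc d" and sc_mult: "sc (c * d) = sc c * sc d"
  and sc_1: "sc 1 = 1" and sc_0: "sc 0 = 0" and sc_minus: "sc (- c) = - sc c"
  by (rule lop_eqI; simp add: scale_add_left scale_minus_left single_add single_uminus)+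

lemma sc_sum: "sc (\<Sum>x\<in>A. f x) = (\<Sum>x\<in>A. sc (f x))"
  by (induction A rule: infinite_finite_induct) (simp_all add: sc_0 sc_add)

section \<open>Evaluation of the free algebra in operators\<close>

lemma letters_plus [simp]: "letters (u + v) = letters u @ letters v" and letters_zero [simp]: "letters 0 = []"
  by (simp_all add: plus_word_def zero_word_def)

lemma free_mult_expand:
  fixes f g :: "'g free"
  shows "f * g = (\<Sum>x\<in>Poly_Mapping.keys f. \<Sum>y\<in>Poly_Mapping.keys g.
    Poly_Mapping.single (x + y) (Poly_Mapping.lookup f x * Poly_Mapping.lookup g y))"
  by (subst poly_mapping_expand[of f], subst poly_mapping_expand[of g])
    (simp only: sum_product mult_single)

definition aeval :: "('g \<Rightarrow> 'b lop) \<Rightarrow> 'g free \<Rightarrow> 'b lop" where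
  "aeval \<phi> f = (\<Sum>w\<in>Poly_Mapping.keys f. sc (Poly_Mapping.lookup f w) * prod_list (map \<phi> (letters w)))"

lemma aeval_superset:
  assumes "finite S" "Poly_Mapping.keys f \<subseteq> S"
  shows "aeval \<phi> f = (\<Sum>w\<in>S. sc (Poly_Mapping.lookup f w) * prod_list (map \<phi> (letters w)))"
  unfolding aeval_def using assms by (intro sum.mono_neutral_left) (auto simp: in_keys_iff sc_0)

lemma aeval_add: "aeval \<phi> (f + g) = aeval \<phi> f + aeval \<phi> g"
proof -
  let ?S = "Poly_Mapping.keys f \<union> Poly_Mapping.keys g"
  have "Poly_Mapping.keys (f + g) \<subseteq> ?S" by (rule Poly_Mapping.keys_add)
  then show ?thesis
    by (simp add: aeval_superset[of ?S] lookup_add sc_add distrib_right sum.distrib)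
qed

lemma aeval_scale: "aeval \<phi> (c *\<^sub>C f) = sc c * aeval \<phi> f"
  using keys_scale[of c f]
  by (simp add: aeval_superset[of "Poly_Mapping.keys f"] lookup_scale sc_mult sum_distrib_left mult.assoc)

lemma aeval_0: "aeval \<phi> 0 = 0" by (simp add: aeval_def)

lemma aeval_minus: "aeval \<phi> (- f) = - aeval \<phi> f"
  using aeval_scale[of \<phi> "-1" f] by (simp add: scale_minus_left sc_minus sc_1)

lemma aeval_diff: "aeval \<phi> (f - g) = aeval \<phi> f - aeval \<phi> g"
  using aeval_add[of \<phi> f "- g"] by (simp add: aeval_minus)

lemma aeval_sum: "aeval \<phi> (\<Sum>x\<in>A. f x) = (\<Sum>x\<in>A. aeval \<phi> (f x))"
  by (induction A rule: infinite_finite_induct) (simp_all add: aeval_0 aeval_add)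

lemma aeval_single: "aeval \<phi> (Poly_Mapping.single w c) = sc c * prod_list (map \<phi> (letters w))"
  by (cases "c = 0") (simp_all add: aeval_def keys_single sc_0)

lemma aeval_gen: "aeval \<phi> (gen g) = \<phi> g" by (simp add: gen_def aeval_single sc_1)

lemma aeval_1: "aeval \<phi> 1 = 1"
  using aeval_single[of \<phi> 0 1] by (simp add: sc_1)

lemma aeval_mult: "aeval \<phi> (f * g) = aeval \<phi> f * aeval \<phi> g"
proof -
  have "aeval \<phi> (f * g) = (\<Sum>x\<in>Poly_Mapping.keys f. \<Sum>y\<in>Poly_Mapping.keys g.
     (sc (Poly_Mapping.lookup f x) * prod_list (map \<phi> (letters x))) *
     (sc (Poly_Mapping.lookup g y) * prod_list (map \<phi> (letters y))))"
    unfolding free_mult_expand aeval_sum aeval_single sc_mult letters_plus map_append prod_list.append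
    by (intro sum.cong refl) (metis mult.assoc sc_comm)
  then show ?thesis by (simp only: aeval_def sum_product)
qed

lemmas aeval_simps = aeval_add aeval_diff aeval_minus aeval_sum aeval_0 aeval_1 aeval_scale aeval_mult aeval_gen

section \<open>Parity in the free algebra\<close>

definition homog :: "nat \<Rightarrow> nat \<Rightarrow> yangian_gen free \<Rightarrow> bool" where
  "homog m p f \<longleftrightarrow> (\<forall>w\<in>Poly_Mapping.keys f. word_par m w mod 2 = p mod 2)"

lemma minus_one_power_mod2: "(-1 :: complex) ^ a = (-1) ^ b" if "a mod 2 = b mod 2" for a b :: nat
  using that by (metis even_iff_mod_2_eq_zero minus_one_power_iff)

text \<open>\<open>super_comm\<close> attaches a sign to each pair of words, and this sign depends
  only on the parities modulo 2. For homogeneous arguments it is therefore constant, and the bracket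
  becomes an expression that evaluation respects.\<close>

lemma super_comm_homog:
  assumes "homog m p f" "homog m q g"
  shows "super_comm m f g = f * g - (-1) ^ (p * q) *\<^sub>C (g * f)"
proof -
  have *: "(-1 :: complex) ^ (word_par m x * word_par m y) = (-1) ^ (p * q)"
    if "x \<in> Poly_Mapping.keys f" "y \<in> Poly_Mapping.keys g" for x y
    using assms that unfolding homog_def by (intro minus_one_power_mod2) (metis mod_mult_eq)
  have "super_comm m f g = (\<Sum>x\<in>Poly_Mapping.keys f. \<Sum>y\<in>Poly_Mapping.keys g.
      Poly_Mapping.single (x + y) (Poly_Mapping.lookup f x * Poly_Mapping.lookup g y)
      - (-1) ^ (p * q) *\<^sub>C Poly_Mapping.single (y + x) (Poly_Mapping.lookup g y * Poly_Mapping.lookup f x))"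
    unfolding super_comm_def
    by (intro sum.cong refl) (simp add: * scale_diff mult.assoc mult.left_commute mult.commute)
  also have "\<dots> = f * g - (-1) ^ (p * q) *\<^sub>C (g * f)"
    unfolding free_mult_expand[of f g] free_mult_expand[of g f]
    by (subst (2) sum.swap) (simp only: sum_subtractf scale_sum)
  finally show ?thesis .
qed

lemma keys_free_mult: "w \<in> Poly_Mapping.keys (f * g :: 'g free) \<Longrightarrow>
   \<exists>x\<in>Poly_Mapping.keys f. \<exists>y\<in>Poly_Mapping.keys g. w = x + y"
  using Poly_Mapping.keys_mult[of f g] by blast

lemma homog_diff: "homog m p f \<Longrightarrow> homog m p g \<Longrightarrow> homog m p (f - g)"
  using keys_diff[of f g] by (auto simp: homog_def)

lemma homog_scale: "homog m p f \<Longrightarrow> homog m p (c *\<^sub>C f)"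
  using keys_scale[of c f] by (auto simp: homog_def)

lemma homog_mult: "homog m p f \<Longrightarrow> homog m q g \<Longrightarrow> homog m (p + q) (f * g)"
  unfolding homog_def
  by (auto dest!: keys_free_mult simp: word_par_def) (metis mod_add_eq)

lemma homog_gen: "homog m (gen_par m g) (gen g)"
  by (simp add: homog_def gen_def keys_single word_par_def)

lemma homog_super_comm: "homog m p f \<Longrightarrow> homog m q g \<Longrightarrow> homog m (p + q) (super_comm m f g)"
  by (simp add: super_comm_homog) (metis homog_diff homog_mult homog_scale add.commute)

lemma homog_X: "homog m (if i = m then 1 else 0) (X_elt e i r)" and homog_H: "homog m 0 (H_elt i r)"
  using homog_gen[of m "Xgen e i r"] homog_gen[of m "Hgen i r"] by (simp_all add: X_elt_def H_elt_def)

lemma homog_cong: "homog m p f \<Longrightarrow> p mod 2 = q mod 2 \<Longrightarrow> homog m q f"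
  by (simp add: homog_def)

section \<open>Quotients and presentations\<close>

lemma cring_complex_ring: "cring complex_ring"
  by (rule cringI, rule abelian_groupI)
     (auto simp: complex_ring_def algebra_simps intro!: comm_monoidI exI[of _ "- _"])

lemma complex_ring_simps [simp]: "carrier complex_ring = UNIV" "a \<oplus>\<^bsub>complex_ring\<^esub> b = a + b"
  "a \<otimes>\<^bsub>complex_ring\<^esub> b = a * b" "\<one>\<^bsub>complex_ring\<^esub> = 1"
  by (simp_all add: complex_ring_def)

text \<open>Free vector spaces and free algebras share the linear structure of finitely supported
  functions. The locale treats their quotients together, whether by a subspace or by an
  ideal.\<close>

locale lin_space =
  fixes A :: "(complex, 'a \<Rightarrow>\<^sub>0 complex) module"
  assumes add_eq [simp]: "add A = (+)" and zero_eq [simp]: "\<zero>\<^bsub>A\<^esub> = 0" and smult_eq [simp]: "smult A = (*\<^sub>C)"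
    and carrier_zero: "0 \<in> carrier A"
    and carrier_add: "f \<in> carrier A \<Longrightarrow> g \<in> carrier A \<Longrightarrow> f + g \<in> carrier A"
    and carrier_scale: "f \<in> carrier A \<Longrightarrow> c *\<^sub>C f \<in> carrier A"
begin

lemma carrier_minus: "f \<in> carrier A \<Longrightarrow> - f \<in> carrier A"
  using carrier_scale[of f "-1"] by (simp add: scale_minus_one)

lemma carrier_diff: "f \<in> carrier A \<Longrightarrow> g \<in> carrier A \<Longrightarrow> f - g \<in> carrier A"
  using carrier_add[of f "- g"] by (simp add: carrier_minus)

lemma abelian_group: "abelian_group A"
  by (rule abelian_groupI)
     (auto simp: carrier_add carrier_zero ac_simps intro: carrier_minus bexI[of _ "- _"])

lemma is_module: "module complex_ring A"
  by (rule moduleI[OF cring_complex_ring abelian_group])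
     (simp_all add: carrier_scale scale_add scale_add_left scale_scale)

definition subspace :: "('a \<Rightarrow>\<^sub>0 complex) set \<Rightarrow> bool" where
  "subspace K \<longleftrightarrow> K \<subseteq> carrier A \<and> 0 \<in> K \<and> (\<forall>f\<in>K. \<forall>g\<in>K. f + g \<in> K) \<and> (\<forall>c. \<forall>f\<in>K. c *\<^sub>C f \<in> K)"

lemma a_inv_eq: "f \<in> carrier A \<Longrightarrow> \<ominus>\<^bsub>A\<^esub> f = - f"
  by (rule abelian_group.minus_equality[OF abelian_group]) (simp_all add: carrier_minus)

lemma submodule_iff: "submodule K complex_ring A \<longleftrightarrow> subspace K"
proof
  assume K: "submodule K complex_ring A"
  note E = module.submoduleE[OF is_module K]
  obtain x where x: "x \<in> K" using E(2) by blast
  have "0 \<in> K" using E(4)[of 0 x] x by simp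
  then show "subspace K" using E(1,5) E(4) by (auto simp: subspace_def)
next
  assume K: "subspace K"
  show "submodule K complex_ring A"
  proof (rule module.submoduleI[OF is_module])
    fix f assume f: "f \<in> K"
    have "(-1) *\<^sub>C f \<in> K" using K f by (simp add: subspace_def)
    then show "\<ominus>\<^bsub>A\<^esub> f \<in> K" using K f by (subst a_inv_eq) (auto simp: subspace_def scale_minus_one)
  qed (use K in \<open>auto simp: subspace_def\<close>)
qed

lemma gen_subspace:
  assumes "S \<subseteq> carrier A"
  shows "subspace (gen_subspace A S)" and "S \<subseteq> gen_subspace A S"
    and "subspace K \<Longrightarrow> S \<subseteq> K \<Longrightarrow> gen_subspace A S \<subseteq> K"
proof -
  have "subspace (carrier A)" by (simp add: subspace_def carrier_zero carrier_add carrier_scale)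
  then show "subspace (gen_subspace A S)"
    unfolding gen_subspace_def submodule_iff using assms unfolding subspace_def by blast
qed (auto simp: gen_subspace_def submodule_iff)

end

locale lin_quot = lin_space +
  fixes K assumes K: "subspace K"
begin

definition cls :: "('a \<Rightarrow>\<^sub>0 complex) \<Rightarrow> ('a \<Rightarrow>\<^sub>0 complex) set" where
  "cls f = K +>\<^bsub>A\<^esub> f"

lemma K_D: "f \<in> K \<Longrightarrow> f \<in> carrier A" "0 \<in> K" "f \<in> K \<Longrightarrow> g \<in> K \<Longrightarrow> f + g \<in> K" "f \<in> K \<Longrightarrow> c *\<^sub>C f \<in> K"
  using K by (auto simp: subspace_def)

lemma K_minus: "f \<in> K \<Longrightarrow> - f \<in> K"
  using K_D(4)[of f "-1"] by (simp add: scale_minus_one)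

lemma K_diff: "f \<in> K \<Longrightarrow> g \<in> K \<Longrightarrow> f - g \<in> K"
  using K_D(3)[of f "- g"] by (simp add: K_minus)

lemma cls_eq: "cls f = {g. g - f \<in> K}"
proof -
  have "\<exists>h\<in>K. g = h + f" if "g - f \<in> K" for g using that by (metis diff_add_cancel)
  then show ?thesis by (auto simp: cls_def a_r_coset_def')
qed

lemma cls_eq_iff: "cls f = cls g \<longleftrightarrow> f - g \<in> K"
proof
  assume "cls f = cls g"
  moreover have "f \<in> cls f" by (simp add: cls_eq K_D)
  ultimately show "f - g \<in> K" by (simp add: cls_eq)
next
  assume d: "f - g \<in> K"
  have "h - f \<in> K \<longleftrightarrow> h - g \<in> K" for h
    using K_D(3)[OF _ d, of "h - f"] K_diff[OF _ d, of "h - g"] by auto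
  then show "cls f = cls g" by (simp add: cls_eq)
qed

lemma cls_self: "f \<in> cls f" by (simp add: cls_eq K_D)

lemma quot_carrier: "carrier (quot A K) = cls ` carrier A"
  by (auto simp: quot_def ring.defs FactRing_def A_RCOSETS_def' cls_def)

lemma quot_zero: "\<zero>\<^bsub>quot A K\<^esub> = cls 0"
  by (auto simp: quot_def ring.defs FactRing_def cls_eq)

lemma quot_add: "cls f \<oplus>\<^bsub>quot A K\<^esub> cls g = cls (f + g)"
proof -
  have "\<exists>a. a - f \<in> K \<and> (\<exists>b. b - g \<in> K \<and> h = a + b)" if "h - (f + g) \<in> K" for h
    using that by (intro exI[of _ f] exI[of _ "h - f"] conjI) (simp_all add: K_D algebra_simps)
  moreover have "a + b - (f + g) \<in> K" if "a - f \<in> K" "b - g \<in> K" for a b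
    using K_D(3)[OF that] by (simp add: algebra_simps)
  ultimately show ?thesis
    by (auto simp: quot_def ring.defs FactRing_def set_add_def set_mult_def cls_eq)
qed

text \<open>The scalar multiplication of the quotient is a union over representatives; all of them
  give the same class because \<open>K\<close> is closed under scaling.\<close>

lemma quot_smult: "c \<odot>\<^bsub>quot A K\<^esub> cls f = cls (c *\<^sub>C f)"
proof -
  have "cls (c *\<^sub>C x) = cls (c *\<^sub>C f)" if "x \<in> cls f" for x
    using that K_D(4)[of "x - f" c] by (simp add: cls_eq_iff scale_diff) (simp add: cls_eq)
  then have "(\<Union>x\<in>cls f. cls (c *\<^sub>C x)) = (\<Union>x\<in>cls f. cls (c *\<^sub>C f))" by (rule SUP_cong[OF refl])
  also have "\<dots> = cls (c *\<^sub>C f)" using cls_self[of f] by blast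
  finally have "(\<Union>x\<in>cls f. cls (c *\<^sub>C x)) = cls (c *\<^sub>C f)" .
  then show ?thesis by (simp add: quot_def ring.defs module.defs cls_def[symmetric])
qed

lemma quot_module: "module complex_ring (quot A K)"
proof (rule moduleI[OF cring_complex_ring])
  show "abelian_group (quot A K)"
  proof (rule abelian_groupI)
    fix x assume "x \<in> carrier (quot A K)"
    then obtain f where "x = cls f" "f \<in> carrier A" by (auto simp: quot_carrier)
    then show "\<exists>y\<in>carrier (quot A K). y \<oplus>\<^bsub>quot A K\<^esub> x = \<zero>\<^bsub>quot A K\<^esub>"
      by (intro bexI[of _ "cls (- f)"]) (simp_all add: quot_carrier quot_add quot_zero carrier_minus)
  qed (auto simp: quot_carrier quot_add quot_zero carrier_add carrier_zero ac_simps)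
qed (auto simp: quot_carrier quot_smult quot_add carrier_add carrier_scale scale_add scale_add_left scale_scale)

lemma quot_sum:
  assumes "finite S" "\<And>x. x \<in> S \<Longrightarrow> f x \<in> carrier A"
  shows "(\<Oplus>\<^bsub>quot A K\<^esub>x\<in>S. cls (f x)) = cls (\<Sum>x\<in>S. f x) \<and> (\<Sum>x\<in>S. f x) \<in> carrier A"
proof -
  interpret Q: module complex_ring "quot A K" by (rule quot_module)
  show ?thesis using assms
  proof (induction S)
    case empty then show ?case by (simp add: quot_zero carrier_zero)
  next
    case (insert x S)
    then show ?case
      by (subst Q.finsum_insert) (auto simp: quot_add quot_carrier carrier_add)
  qed
qed

end

lemma lin_space_free_space: "lin_space (free_space B)"
proof
  fix f g :: "'a \<Rightarrow>\<^sub>0 complex"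
  show "f \<in> carrier (free_space B) \<Longrightarrow> g \<in> carrier (free_space B) \<Longrightarrow> f + g \<in> carrier (free_space B)"
    using Poly_Mapping.keys_add[of f g] by (auto simp: free_space_def)
  fix c show "f \<in> carrier (free_space B) \<Longrightarrow> c *\<^sub>C f \<in> carrier (free_space B)"
    using keys_scale[of c f] by (auto simp: free_space_def)
qed (simp_all add: free_space_def)

lemma lin_space_free_algebra: "lin_space (free_algebra G)"
proof
  fix f g :: "'a free"
  show "f \<in> carrier (free_algebra G) \<Longrightarrow> g \<in> carrier (free_algebra G) \<Longrightarrow> f + g \<in> carrier (free_algebra G)"
    using Poly_Mapping.keys_add[of f g] by (fastforce simp: free_algebra_def)
  fix c show "f \<in> carrier (free_algebra G) \<Longrightarrow> c *\<^sub>C f \<in> carrier (free_algebra G)"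
    using keys_scale[of c f] by (auto simp: free_algebra_def)
qed (simp_all add: free_algebra_def)

interpretation FA: lin_space "free_algebra G" for G by (rule lin_space_free_algebra)

lemma free_algebra_simps [simp]: "f \<otimes>\<^bsub>free_algebra G\<^esub> g = f * g" "\<one>\<^bsub>free_algebra G\<^esub> = 1"
  by (simp_all add: free_algebra_def)

lemma free_algebra_mult:
  "f \<in> carrier (free_algebra G) \<Longrightarrow> g \<in> carrier (free_algebra G) \<Longrightarrow> f * g \<in> carrier (free_algebra G)"
  unfolding free_algebra_def by (fastforce dest: keys_free_mult)

lemma free_algebra_single: "set (letters w) \<subseteq> G \<Longrightarrow> Poly_Mapping.single w c \<in> carrier (free_algebra G)"
  by (simp add: free_algebra_def keys_single)

lemma free_algebra_one: "1 \<in> carrier (free_algebra G)"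
  by (simp add: free_algebra_def)

lemma free_algebra_gen: "g \<in> G \<Longrightarrow> gen g \<in> carrier (free_algebra G)"
  unfolding gen_def by (rule free_algebra_single) simp

lemma free_algebra_sum: "(\<And>x. x \<in> S \<Longrightarrow> f x \<in> carrier (free_algebra G)) \<Longrightarrow> (\<Sum>x\<in>S. f x) \<in> carrier (free_algebra G)"
  by (induction S rule: infinite_finite_induct) (auto simp: FA.carrier_zero FA.carrier_add)

lemmas free_algebra_closed = FA.carrier_zero FA.carrier_add FA.carrier_diff FA.carrier_minus FA.carrier_scale
  free_algebra_mult free_algebra_one free_algebra_gen free_algebra_sum

lemma free_algebra_induct [consumes 1, case_names one add scale mult gen]:
  assumes "f \<in> carrier (free_algebra G)"
    and one: "P 1"
    and add: "\<And>f g. f \<in> carrier (free_algebra G) \<Longrightarrow> g \<in> carrier (free_algebra G) \<Longrightarrow> P f \<Longrightarrow> P g \<Longrightarrow> P (f + g)"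
    and scale: "\<And>c f. f \<in> carrier (free_algebra G) \<Longrightarrow> P f \<Longrightarrow> P (c *\<^sub>C f)"
    and mult: "\<And>f g. f \<in> carrier (free_algebra G) \<Longrightarrow> g \<in> carrier (free_algebra G) \<Longrightarrow> P f \<Longrightarrow> P g \<Longrightarrow> P (f * g)"
    and gen: "\<And>g. g \<in> G \<Longrightarrow> P (gen g)"
  shows "P f"
proof -
  have word: "P (Poly_Mapping.single (Word xs) 1)" if "set xs \<subseteq> G" for xs
    using that
  proof (induction xs)
    case Nil
    have "Poly_Mapping.single (Word []) 1 = (1 :: 'a free)" by (metis single_one zero_word_def)
    then show ?case using one by simp
  next
    case (Cons x xs)
    have "Poly_Mapping.single (Word (x # xs)) 1 = gen x * Poly_Mapping.single (Word xs) 1"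
      by (simp add: gen_def mult_single plus_word_def)
    moreover have "Poly_Mapping.single (Word xs) 1 \<in> carrier (free_algebra G)"
      using Cons.prems by (intro free_algebra_single) simp
    ultimately show ?case using Cons mult[of "gen x"] gen[of x] free_algebra_gen[of x G] by simp
  qed
  have "Poly_Mapping.keys f \<subseteq> {w. set (letters w) \<subseteq> G}" using assms(1) by (auto simp: free_algebra_def)
  then show ?thesis
  proof (induction f rule: poly_mapping_span_induct)
    case zero
    show ?case using scale[OF free_algebra_one one, of 0] by simp
  next
    case (add f g)
    then show ?case by (intro assms(3)) (auto simp: free_algebra_def)
  next
    case (single k c)
    then have "P (c *\<^sub>C Poly_Mapping.single (Word (letters k)) 1)"
      by (intro scale word free_algebra_single) auto
    then show ?case by simp
  qed
qed

lemma ring_free_algebra: "ring (free_algebra G)"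
  by (rule ringI[OF FA.abelian_group monoidI])
    (simp_all add: free_algebra_closed mult.assoc distrib_left distrib_right)

text \<open>A scalar acts as multiplication by a multiple of the empty word, which is central. Hence
  ideals of the free algebra are subspaces.\<close>

lemma scale_conv_mult: "c *\<^sub>C f = (c *\<^sub>C 1) * (f :: 'g free)"
  and scale_mult_left: "(c *\<^sub>C f) * g = c *\<^sub>C (f * (g :: 'g free))"
  and scale_mult_right: "f * (c *\<^sub>C g) = c *\<^sub>C (f * (g :: 'g free))"
proof -
  have 0: "c *\<^sub>C f = Poly_Mapping.single 0 c * f" for f :: "'g free"
    by (simp add: scale_def mult_map_scale_conv_mult)
  have 1: "f * Poly_Mapping.single 0 c = Poly_Mapping.single 0 c * f" for f :: "'g free"
    by (induction f rule: poly_mapping_span_induct[OF subset_UNIV])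
       (simp_all add: distrib_left distrib_right mult_single mult.commute)
  show "c *\<^sub>C f = (c *\<^sub>C 1) * f" using 0[of f] 0[of 1] by simp
  show "(c *\<^sub>C f) * g = c *\<^sub>C (f * g)" by (simp only: 0 mult.assoc)
  show "f * (c *\<^sub>C g) = c *\<^sub>C (f * g)" by (simp only: 0 mult.assoc[symmetric] 1)
qed

locale presentation =
  fixes G :: "'g set" and R :: "'g free set"
  assumes rels: "R \<subseteq> carrier (free_algebra G)"
begin

abbreviation "rel_ideal \<equiv> Idl\<^bsub>free_algebra G\<^esub> R"

lemma ideal: "ideal rel_ideal (free_algebra G)"
  by (rule ring.genideal_ideal[OF ring_free_algebra rels])

lemma Id_subspace: "lin_space.subspace (free_algebra G) rel_ideal"
proof -
  interpret ideal rel_ideal "free_algebra G" by (rule ideal)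
  have "c *\<^sub>C f \<in> rel_ideal" if "f \<in> rel_ideal" for c f
    using I_l_closed[OF that, of "c *\<^sub>C 1"] by (simp add: scale_conv_mult[of c f] FA.carrier_scale free_algebra_one)
  then show ?thesis
    using a_subset additive_subgroup.zero_closed[OF is_additive_subgroup] additive_subgroup.a_closed[OF is_additive_subgroup]
    by (auto simp: FA.subspace_def)
qed

sublocale lin_quot "free_algebra G" rel_ideal
  by unfold_locales (rule Id_subspace)

lemma class_eq: "presented_class G R f = cls f"
  by (simp add: presented_class_def cls_def)

lemma presented_carrier: "carrier (presented_algebra G R) = cls ` carrier (free_algebra G)"
  by (simp add: presented_algebra_def quot_carrier)

lemma presented_add: "cls f \<oplus>\<^bsub>presented_algebra G R\<^esub> cls g = cls (f + g)"
  by (simp add: presented_algebra_def quot_add)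

lemma presented_smult: "c \<odot>\<^bsub>presented_algebra G R\<^esub> cls f = cls (c *\<^sub>C f)"
  by (simp add: presented_algebra_def quot_smult)

lemma presented_one: "\<one>\<^bsub>presented_algebra G R\<^esub> = cls 1"
  by (simp add: presented_algebra_def quot_def ring.defs FactRing_def cls_def)

lemma presented_mult:
  assumes "f \<in> carrier (free_algebra G)" "g \<in> carrier (free_algebra G)"
  shows "cls f \<otimes>\<^bsub>presented_algebra G R\<^esub> cls g = cls (f * g)"
  using ideal.rcoset_mult_add[OF ideal assms]
  by (simp add: presented_algebra_def quot_def ring.defs FactRing_def cls_def)

text \<open>The kernel of evaluation is an ideal that contains the relations, so evaluation factors
  through the presented algebra.\<close>

lemma aeval_Id:
  assumes "\<And>r. r \<in> R \<Longrightarrow> aeval \<phi> r = 0" "f \<in> rel_ideal"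
  shows "aeval \<phi> f = 0"
proof -
  let ?J = "{f \<in> carrier (free_algebra G). aeval \<phi> f = 0}"
  have "ideal ?J (free_algebra G)"
  proof (rule idealI[OF ring_free_algebra])
    have "FA.subspace G ?J" by (auto simp: FA.subspace_def free_algebra_closed aeval_simps)
    then have "submodule ?J complex_ring (free_algebra G)" by (simp add: FA.submodule_iff)
    then show "subgroup ?J (add_monoid (free_algebra G))" by (rule submodule.axioms(1))
  qed (auto simp: free_algebra_closed aeval_simps)
  moreover have "R \<subseteq> ?J" using rels assms(1) by auto
  ultimately have "rel_ideal \<subseteq> ?J" by (rule ring.genideal_minimal[OF ring_free_algebra])
  with assms(2) show ?thesis by auto
qed

end

section \<open>Matrix units and signed flips on words\<close>

text \<open>The number of odd letters before position k, which a matrix unit at k has to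
  pass.\<close>

definition psum :: "nat \<Rightarrow> nat \<Rightarrow> nat list \<Rightarrow> nat" where
  "psum m k w = (\<Sum>j\<in>{1..<k}. par m (w ! (j - 1)))"

lemma psum_update_ge: "k \<le> j \<Longrightarrow> psum m k (w[j - 1 := a]) = psum m k w"
  unfolding psum_def by (rule sum.cong) auto

text \<open>Stated additively because natural subtraction would truncate.\<close>

lemma psum_update_less:
  assumes "1 \<le> j" "j < k" "j \<le> length w"
  shows "psum m k (w[j - 1 := a]) + par m (w ! (j - 1)) = psum m k w + par m a"
proof -
  have *: "psum m k v = par m (v ! (j - 1)) + (\<Sum>i\<in>{1..<k} - {j}. par m (v ! (i - 1)))" for v
    unfolding psum_def using assms by (subst sum.remove[of _ j]) auto
  have "(\<Sum>i\<in>{1..<k} - {j}. par m (w[j - 1 := a] ! (i - 1))) = (\<Sum>i\<in>{1..<k} - {j}. par m (w ! (i - 1)))"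
    using assms by (intro sum.cong) (auto simp: nth_list_update)
  then show ?thesis using assms by (simp add: *)
qed

lemma unit_at_single:
  "unit_at m a b k (Poly_Mapping.single w c) = (if w ! (k - 1) = b then
     Poly_Mapping.single (w[k - 1 := a]) (c * (-1) ^ ((par m a + par m b) * psum m k w)) else 0)"
  by (simp add: unit_at_def psum_def)

lemma is_lin_unit_at: "is_lin (unit_at m a b k)"
  by (simp add: unit_at_def is_lin_lin_ext)

lemma par_cases: "par m a = 0 \<or> par m a = 1" by (simp add: par_def)

definition fsgn :: "nat \<Rightarrow> nat \<Rightarrow> nat \<Rightarrow> nat \<Rightarrow> nat \<Rightarrow> complex" where
  "fsgn m a b c d = (if (m < a) \<noteq> (m < b) \<and> (m < c) \<noteq> (m < d) then -1 else 1)"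

lemma minus_one_power_eq: "even a = even b \<Longrightarrow> (-1 :: complex) ^ a = (-1) ^ b"
  by (simp add: minus_one_power_iff)

lemmas psum_update_ge' = psum_update_ge[unfolded One_nat_def]

lemma unit_at_same:
  assumes "1 \<le> k" "k \<le> length w"
  shows "unit_at m a b k (unit_at m c d k (Poly_Mapping.single w 1)) =
     (if b = c then unit_at m a d k (Poly_Mapping.single w 1) else 0)"
proof -
  have 1: "w[k - 1 := c] ! (k - 1) = c" using assms by simp
  have 2: "(-1 :: complex) ^ ((par m c + par m d) * p) * (-1) ^ ((par m a + par m c) * p) = (-1) ^ ((par m a + par m d) * p)" for p
    unfolding power_add[symmetric] by (rule minus_one_power_eq) auto
  show ?thesis
    by (simp only: unit_at_single 1 2 psum_update_ge[OF order_refl] list_update_overwrite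
      is_lin_0[OF is_lin_unit_at] mult_1_left if_distrib[of "unit_at m a b k"]) (auto simp: 2)
qed

text \<open>The unit at j replaces a letter to the left of k and so changes the number of odd
  letters before k by its own parity. The sign at j does not see position k.\<close>

lemma unit_at_commute_less:
  assumes "1 \<le> j" "j < k" "k \<le> length w"
  shows "unit_at m a b j (unit_at m c d k (Poly_Mapping.single w 1)) =
     fsgn m a b c d *\<^sub>C unit_at m c d k (unit_at m a b j (Poly_Mapping.single w 1))"
proof -
  have ne: "w[k - 1 := c] ! (j - 1) = w ! (j - 1)" "w[j - 1 := a] ! (k - 1) = w ! (k - 1)"
    "w[k - 1 := c, j - 1 := a] = w[j - 1 := a, k - 1 := c]"
    using assms by (auto simp: nth_list_update intro: list_update_swap)
  show ?thesis
  proof (cases "w ! (k - 1) = d \<and> w ! (j - 1) = b")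
    case True
    have p: "psum m k (w[j - 1 := a]) + par m b = psum m k w + par m a"
      using psum_update_less[of j k w m a] assms True by simp
    have "(-1 :: complex) ^ ((par m c + par m d) * psum m k w) = fsgn m a b c d * (-1) ^ ((par m c + par m d) * psum m k (w[j - 1 := a]))"
    proof -
      have "even (psum m k w) = (even (psum m k (w[j - 1 := a])) = even (par m a + par m b))"
        using arg_cong[OF p, of even] by auto
      then show ?thesis by (auto simp: minus_one_power_iff fsgn_def par_def)
    qed
    then show ?thesis using True assms
      by (simp add: unit_at_single ne[unfolded One_nat_def] psum_update_ge' mult.commute mult.left_commute)
  next
    case False
    then show ?thesis by (auto simp: unit_at_single ne[unfolded One_nat_def] is_lin_0[OF is_lin_unit_at])
  qed
qed

lemma fsgn_sq: "fsgn m a b c d * fsgn m c d a b = 1" by (auto simp: fsgn_def)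

lemma unit_at_commute:
  assumes "j \<noteq> k" "1 \<le> j" "j \<le> length w" "1 \<le> k" "k \<le> length w"
  shows "unit_at m a b j (unit_at m c d k (Poly_Mapping.single w 1)) =
     fsgn m a b c d *\<^sub>C unit_at m c d k (unit_at m a b j (Poly_Mapping.single w 1))"
proof (cases "j < k")
  case True then show ?thesis using unit_at_commute_less assms by blast
next
  case False
  then have "k < j" using assms by simp
  then show ?thesis using unit_at_commute_less[of k j w m c d a b] assms by (simp add: scale_scale fsgn_sq)
qed

section \<open>Signed flips and their products with matrix units\<close>

lemma super_swap_single:
  "super_swap m i (Poly_Mapping.single w c) =
     Poly_Mapping.single (w[i - 1 := w ! i, i := w ! (i - 1)]) (c * (-1) ^ (par m (w ! (i - 1)) * par m (w ! i)))"
  by (simp add: super_swap_def)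

lemma is_lin_super_swap: "is_lin (super_swap m i)"
  by (simp add: super_swap_def is_lin_lin_ext)

definition words :: "nat \<Rightarrow> nat list set" where "words l = {w. length w = l}"

lemma super_swap_square:
  assumes "1 \<le> i" "i < length w"
  shows "super_swap m i (super_swap m i (Poly_Mapping.single w 1)) = Poly_Mapping.single w 1"
  using assms par_cases[of m "w ! (i - 1)"] par_cases[of m "w ! i"]
  by (auto simp: super_swap_single nth_list_update list_update_swap)

lemma psum_Suc: "1 \<le> i \<Longrightarrow> psum m (Suc i) w = psum m i w + par m (w ! (i - 1))"
  by (simp add: psum_def)

lemma psum_swap:
  assumes "1 \<le> i" "i < length w"
  shows "k \<le> i \<or> i + 1 < k \<Longrightarrow> psum m k (w[i - 1 := w ! i, i := w ! (i - 1)]) = psum m k w"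
    and "psum m (i + 1) (w[i - 1 := w ! i, i := w ! (i - 1)]) = psum m i w + par m (w ! i)"
proof -
  assume "k \<le> i \<or> i + 1 < k"
  then show "psum m k (w[i - 1 := w ! i, i := w ! (i - 1)]) = psum m k w"
  proof
    assume "k \<le> i"
    then show ?thesis using psum_update_ge[of k "i + 1"] psum_update_ge[of k i] by simp
  next
    assume k: "i + 1 < k"
    show ?thesis
      using psum_update_less[of i k w m "w ! i"] psum_update_less[of "i + 1" k "w[i - 1 := w ! i]" m "w ! (i - 1)"] assms k
      by simp
  qed
next
  have "psum m i (w[i - 1 := w ! i, i := w ! (i - 1)]) = psum m i w"
    using psum_update_ge[of i "i + 1"] psum_update_ge[of i i] by simp
  then show "psum m (i + 1) (w[i - 1 := w ! i, i := w ! (i - 1)]) = psum m i w + par m (w ! i)"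
    using psum_Suc[of i m "w[i - 1 := w ! i, i := w ! (i - 1)]"] assms by simp
qed

text \<open>At k = i and k = i + 1 the unit passes one letter more or fewer, while the sign of the
  flip changes with the replaced letter; the two effects agree modulo 2. Elsewhere the flip does not
  alter the number of odd letters before k.\<close>

lemma super_swap_unit:
  assumes "1 \<le> i" "i < length w" "1 \<le> k" "k \<le> length w"
  shows "super_swap m i (unit_at m a b k (Poly_Mapping.single w 1)) =
    unit_at m a b (Transposition.transpose i (i + 1) k) (super_swap m i (Poly_Mapping.single w 1))"
proof -
  let ?w = "w[i - 1 := w ! i, i := w ! (i - 1)]"
  consider "k = i" | "k = i + 1" | "k < i \<or> i + 1 < k" by linarith
  then show ?thesis
  proof cases
    case 1
    have s: "(-1 :: complex) ^ ((par m a + par m b) * psum m i w) * (-1) ^ (par m a * par m (w ! i)) =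
       (-1) ^ (par m b * par m (w ! i)) * (-1) ^ ((par m a + par m b) * psum m (i + 1) ?w)"
      unfolding psum_swap(2)[OF assms(1,2)] power_add[symmetric]
      by (rule minus_one_power_eq) auto
    have "w[i - 1 := a, i - 1 := w ! i, i := a] = ?w[i := a]" by simp
    then show ?thesis using assms 1 s
      by (auto simp: unit_at_single super_swap_single is_lin_0[OF is_lin_super_swap])
  next
    case 2
    have s: "(-1 :: complex) ^ ((par m a + par m b) * psum m (i + 1) w) * (-1) ^ (par m (w ! (i - 1)) * par m a) =
       (-1) ^ (par m (w ! (i - 1)) * par m b) * (-1) ^ ((par m a + par m b) * psum m i ?w)"
      using psum_swap(1)[OF assms(1,2), of i m] psum_Suc[OF assms(1), of m w]
      unfolding power_add[symmetric]
      by (intro minus_one_power_eq) auto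
    have "w[i := a, i - 1 := a, i := w ! (i - 1)] = ?w[i - 1 := a]"
      using assms(1,2) by (intro nth_equalityI) (auto simp: nth_list_update)
    then show ?thesis using assms 2 s
      by (auto simp: unit_at_single super_swap_single is_lin_0[OF is_lin_super_swap] nth_list_update)
  next
    case 3
    have t: "Transposition.transpose i (i + 1) k = k" using 3 by (auto simp: transpose_def)
    have n: "?w ! (k - 1) = w ! (k - 1)" "w[k - 1 := a] ! (i - 1) = w ! (i - 1)" "w[k - 1 := a] ! i = w ! i"
      using assms 3 by (auto simp: nth_list_update)
    have u: "w[k - 1 := a, i - 1 := w ! i, i := w ! (i - 1)] = ?w[k - 1 := a]"
      using assms 3 by (intro nth_equalityI) (auto simp: nth_list_update)
    have p: "psum m k ?w = psum m k w" using 3 by (intro psum_swap assms) auto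
    show ?thesis
      by (simp only: t unit_at_single super_swap_single n u p if_distrib[of "super_swap m i"]
        is_lin_0[OF is_lin_super_swap] mult_1_left mult.commute)
  qed
qed

text \<open>On a basis word only the d equal to the letter at site i survives. The unit at i + 1
  writes this letter there and the unit at i replaces it by a, which is what the flip does to the
  letters; the rest is a parity check.\<close>

lemma super_swap_unit_prod:
  assumes "1 \<le> i" "i < length w" "set w \<subseteq> {1..N}"
  shows "super_swap m i (unit_at m a b (i + 1) (Poly_Mapping.single w 1)) =
    (\<Sum>d\<in>{1..N}. sg m d *\<^sub>C unit_at m a d i (unit_at m d b (i + 1) (Poly_Mapping.single w 1)))"
proof (cases "w ! i = b")
  case True
  let ?x = "w ! (i - 1)"
  have "?x \<in> set w" using assms by (intro nth_mem) auto
  then have x: "?x \<in> {1..N}" using assms(3) by blast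
  have "sg m d *\<^sub>C unit_at m a d i (unit_at m d b (i + 1) (Poly_Mapping.single w 1)) =
    (if d = ?x then Poly_Mapping.single (w[i := ?x, i - 1 := a]) (sg m ?x * (-1) ^ ((par m ?x + par m b) * psum m (i + 1) w)
       * (-1) ^ ((par m a + par m ?x) * psum m i w)) else 0)" for d
    using True assms psum_update_ge[of i "i + 1" m w]
    by (auto simp: unit_at_single nth_list_update mult.assoc)
  then have "(\<Sum>d\<in>{1..N}. sg m d *\<^sub>C unit_at m a d i (unit_at m d b (i + 1) (Poly_Mapping.single w 1))) =
     Poly_Mapping.single (w[i := ?x, i - 1 := a]) (sg m ?x * (-1) ^ ((par m ?x + par m b) * psum m (i + 1) w)
       * (-1) ^ ((par m a + par m ?x) * psum m i w))"
    using x by simp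
  moreover have "sg m ?x * (-1) ^ ((par m ?x + par m b) * psum m (i + 1) w)
       * (-1) ^ ((par m a + par m ?x) * psum m i w) =
      (-1) ^ ((par m a + par m b) * psum m (i + 1) w) * (-1) ^ (par m ?x * par m a)"
    unfolding sg_def power_add[symmetric] using psum_Suc[OF assms(1), of m w]
    by (intro minus_one_power_eq) auto
  moreover have "w[i := a, i - 1 := a, i := ?x] = w[i := ?x, i - 1 := a]"
    using assms(1,2) by (intro nth_equalityI) (auto simp: nth_list_update)
  ultimately show ?thesis using True assms
    by (simp add: unit_at_single super_swap_single nth_list_update)
next
  case False
  then show ?thesis
    by (simp add: unit_at_single is_lin_0[OF is_lin_super_swap] is_lin_0[OF is_lin_unit_at])
qed

lemma keys_lin_ext: "Poly_Mapping.keys (lin_ext g f) \<subseteq> (\<Union>a\<in>Poly_Mapping.keys f. Poly_Mapping.keys (g a))"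
  unfolding lin_ext_def by (rule order_trans[OF keys_sum UN_mono[OF order_refl keys_scale]])

lemma keys_lin_ext_subset:
  "(\<And>a. a \<in> Poly_Mapping.keys f \<Longrightarrow> Poly_Mapping.keys (g a) \<subseteq> B) \<Longrightarrow> Poly_Mapping.keys (lin_ext g f) \<subseteq> B"
  using keys_lin_ext[of g f] by blast

lemma keys_unit_at:
  assumes "Poly_Mapping.keys v \<subseteq> B" "\<And>w. w \<in> B \<Longrightarrow> w ! (k - 1) = b \<Longrightarrow> w[k - 1 := a] \<in> B'"
  shows "Poly_Mapping.keys (unit_at m a b k v) \<subseteq> B'"
  unfolding unit_at_def using assms
  by (intro keys_lin_ext_subset) (auto simp: keys_single)

lemma keys_super_swap:
  assumes "Poly_Mapping.keys v \<subseteq> B" "\<And>w. w \<in> B \<Longrightarrow> w[i - 1 := w ! i, i := w ! (i - 1)] \<in> B"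
  shows "Poly_Mapping.keys (super_swap m i v) \<subseteq> B"
  unfolding super_swap_def using assms
  by (intro keys_lin_ext_subset) (auto simp: keys_single)

lemma unit_at_words: "Poly_Mapping.keys v \<subseteq> words l \<Longrightarrow> Poly_Mapping.keys (unit_at m a b k v) \<subseteq> words l"
  by (rule keys_unit_at) (auto simp: words_def)

lemma tensor_words_words: "tensor_words m n l \<subseteq> words l"
  by (auto simp: tensor_words_def words_def)

lemma unit_at_tensor:
  "Poly_Mapping.keys v \<subseteq> tensor_words m n l \<Longrightarrow> a \<in> {1..m + n} \<Longrightarrow> Poly_Mapping.keys (unit_at m' a b k v) \<subseteq> tensor_words m n l"
  by (erule keys_unit_at) (auto simp: tensor_words_def dest!: set_update_subset_insert[THEN subsetD])

lemma super_swap_tensor: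
  "Poly_Mapping.keys v \<subseteq> tensor_words m n l \<Longrightarrow> i < l \<Longrightarrow> Poly_Mapping.keys (super_swap m' i v) \<subseteq> tensor_words m n l"
proof (erule keys_super_swap)
  fix w assume w: "w \<in> tensor_words m n l" "i < l"
  then have "w ! i \<in> set w" "w ! (i - 1) \<in> set w" by (auto simp: tensor_words_def)
  then have "set (w[i - 1 := w ! i, i := w ! (i - 1)]) \<subseteq> set w"
    by (meson insert_subset order_refl order_trans set_update_subsetI)
  then show "w[i - 1 := w ! i, i := w ! (i - 1)] \<in> tensor_words m n l"
    using w by (auto simp: tensor_words_def)
qed

lemma super_swap_unit_vec:
  assumes "1 \<le> i" "i < l" "1 \<le> k" "k \<le> l" "Poly_Mapping.keys v \<subseteq> words l"
  shows "super_swap m i (unit_at m a b k v) =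
    unit_at m a b (Transposition.transpose i (i + 1) k) (super_swap m i v)"
  by (rule is_lin_eqI[OF is_lin_comp[OF is_lin_super_swap is_lin_unit_at] is_lin_comp[OF is_lin_unit_at is_lin_super_swap] assms(5)])
    (rule super_swap_unit, use assms in \<open>auto simp: words_def\<close>)

lemma is_lin_ident: "is_lin (\<lambda>v. v)" by (simp add: is_lin_def)

lemma is_lin_sum_fun: "(\<And>x. x \<in> S \<Longrightarrow> is_lin (T x)) \<Longrightarrow> is_lin (\<lambda>v. \<Sum>x\<in>S. T x v)"
  by (simp add: is_lin_def sum.distrib scale_sum)

lemma is_lin_scale_fun: "is_lin T \<Longrightarrow> is_lin (\<lambda>v. c *\<^sub>C T v)"
  by (simp add: is_lin_def scale_add scale_scale mult.commute)

lemma super_swap_square_vec: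
  assumes "1 \<le> i" "i < l" "Poly_Mapping.keys v \<subseteq> words l"
  shows "super_swap m i (super_swap m i v) = v"
  by (rule is_lin_eqI[OF is_lin_comp[OF is_lin_super_swap is_lin_super_swap] is_lin_ident assms(3)])
    (rule super_swap_square, use assms in \<open>auto simp: words_def\<close>)

lemma super_swap_unit_prod_vec:
  assumes "1 \<le> i" "i < l" "Poly_Mapping.keys v \<subseteq> tensor_words m n l"
  shows "super_swap m i (unit_at m a b (i + 1) v) =
    (\<Sum>d\<in>{1..m + n}. sg m d *\<^sub>C unit_at m a d i (unit_at m d b (i + 1) v))"
  by (rule is_lin_eqI[OF is_lin_comp[OF is_lin_super_swap is_lin_unit_at]
       is_lin_sum_fun[OF is_lin_scale_fun[OF is_lin_comp[OF is_lin_unit_at is_lin_unit_at]]] assms(3)])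
    (rule super_swap_unit_prod, use assms in \<open>auto simp: tensor_words_def\<close>)

text \<open>The preceding identity conjugated by the flip, which exchanges the two sites and squares
  to the identity.\<close>

lemma super_swap_unit_prod_vec':
  assumes "1 \<le> i" "i < l" "Poly_Mapping.keys v \<subseteq> tensor_words m n l"
  shows "super_swap m i (unit_at m a b i v) =
    (\<Sum>d\<in>{1..m + n}. sg m d *\<^sub>C unit_at m a d (i + 1) (unit_at m d b i v))"
proof -
  have w: "Poly_Mapping.keys v \<subseteq> words l" using assms(3) tensor_words_words by blast
  let ?S = "super_swap m i"
  have Sv: "Poly_Mapping.keys (?S v) \<subseteq> tensor_words m n l" using assms by (intro super_swap_tensor)
  have Sw: "Poly_Mapping.keys (?S v) \<subseteq> words l" using Sv tensor_words_words by blast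
  have "?S (unit_at m a b i v) = unit_at m a b (i + 1) (?S v)"
    using assms w by (subst super_swap_unit_vec) simp_all
  also have "\<dots> = ?S (?S (unit_at m a b (i + 1) (?S v)))"
    using assms unit_at_words[OF Sw] by (simp add: super_swap_square_vec)
  also have "\<dots> = ?S (\<Sum>d\<in>{1..m + n}. sg m d *\<^sub>C unit_at m a d i (unit_at m d b (i + 1) (?S v)))"
    using assms Sv by (simp only: super_swap_unit_prod_vec)
  also have "\<dots> = (\<Sum>d\<in>{1..m + n}. sg m d *\<^sub>C ?S (unit_at m a d i (unit_at m d b (i + 1) (?S v))))"
    by (simp only: is_lin_sum[OF is_lin_super_swap] is_linD(2)[OF is_lin_super_swap])
  also have "\<dots> = (\<Sum>d\<in>{1..m + n}. sg m d *\<^sub>C unit_at m a d (i + 1) (unit_at m d b i v))"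
    using assms w unit_at_words[OF Sw] Sw
    by (simp add: super_swap_unit_vec super_swap_square_vec)
  finally show ?thesis .
qed

lemma super_perm_right:
  assumes "(\<sigma>, T) \<in> super_perm m l" "1 \<le> i" "i < l"
  shows "(\<sigma> \<circ> Transposition.transpose i (i + 1), T \<circ> super_swap m i) \<in> super_perm m l"
  using assms
proof (induction rule: super_perm.induct)
  case super_perm_id
  then show ?case using super_perm_step[OF super_perm.super_perm_id, of i] by simp
next
  case (super_perm_step \<sigma> T j)
  show ?case
    unfolding comp_assoc
    using super_perm_step by (blast intro: super_perm.super_perm_step)
qed

text \<open>Induction on k with (j, k+1) = s_k (j, k) s_k. Conjugation by the flip at k moves site k
  to k + 1 and fixes site j, so it carries both formulas along.\<close>

lemma super_perm_transpose:
  assumes "1 \<le> j" "j < k" "k \<le> l"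
  shows "\<exists>T. (Transposition.transpose j k, T) \<in> super_perm m l \<and>
    (\<forall>v a b. Poly_Mapping.keys v \<subseteq> tensor_words m n l \<longrightarrow>
       T (unit_at m a b k v) = (\<Sum>d\<in>{1..m + n}. sg m d *\<^sub>C unit_at m a d j (unit_at m d b k v)) \<and>
       T (unit_at m a b j v) = (\<Sum>d\<in>{1..m + n}. sg m d *\<^sub>C unit_at m a d k (unit_at m d b j v)))"
proof -
  have "Suc j \<le> k" using assms(2) by simp
  then show ?thesis using assms(3)
  proof (induction k rule: dec_induct)
    case base
    have "(Transposition.transpose j (Suc j), super_swap m j) \<in> super_perm m l"
      using super_perm.super_perm_step[OF super_perm.super_perm_id, of j l m] assms(1) base by simp
    moreover have "super_swap m j (unit_at m a b (Suc j) v) = (\<Sum>d\<in>{1..m + n}. sg m d *\<^sub>C unit_at m a d j (unit_at m d b (Suc j) v))"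
      "super_swap m j (unit_at m a b j v) = (\<Sum>d\<in>{1..m + n}. sg m d *\<^sub>C unit_at m a d (Suc j) (unit_at m d b j v))"
      if "Poly_Mapping.keys v \<subseteq> tensor_words m n l" for v a b
      using super_swap_unit_prod_vec[of j l v m n a b] super_swap_unit_prod_vec'[of j l v m n a b] assms(1) base that
      by simp_all
    ultimately show ?case by blast
  next
    case (step k)
    then obtain T where T: "(Transposition.transpose j k, T) \<in> super_perm m l"
      and T1: "\<And>v a b. Poly_Mapping.keys v \<subseteq> tensor_words m n l \<Longrightarrow>
         T (unit_at m a b k v) = (\<Sum>d\<in>{1..m + n}. sg m d *\<^sub>C unit_at m a d j (unit_at m d b k v))"
      and T2: "\<And>v a b. Poly_Mapping.keys v \<subseteq> tensor_words m n l \<Longrightarrow>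
         T (unit_at m a b j v) = (\<Sum>d\<in>{1..m + n}. sg m d *\<^sub>C unit_at m a d k (unit_at m d b j v))"
      by auto
    let ?S = "super_swap m k"
    have k: "1 \<le> k" "k < l" "j < k" using step assms(1) by auto
    have "Transposition.transpose j (Suc k) = Transposition.transpose k (k + 1) \<circ> (Transposition.transpose j k \<circ> Transposition.transpose k (k + 1))"
      using k(3) by (auto simp: fun_eq_iff Transposition.transpose_def)
    then have "(Transposition.transpose j (Suc k), ?S \<circ> (T \<circ> ?S)) \<in> super_perm m l"
      using super_perm.super_perm_step[OF super_perm_right[OF T k(1,2)] k(1,2)] by simp
    moreover have "(?S \<circ> (T \<circ> ?S)) (unit_at m a b (Suc k) v) = (\<Sum>d\<in>{1..m + n}. sg m d *\<^sub>C unit_at m a d j (unit_at m d b (Suc k) v))"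
      "(?S \<circ> (T \<circ> ?S)) (unit_at m a b j v) = (\<Sum>d\<in>{1..m + n}. sg m d *\<^sub>C unit_at m a d (Suc k) (unit_at m d b j v))"
      if v: "Poly_Mapping.keys v \<subseteq> tensor_words m n l" for v a b
    proof -
      have w: "Poly_Mapping.keys v \<subseteq> words l" using v tensor_words_words by blast
      have Sv: "Poly_Mapping.keys (?S v) \<subseteq> tensor_words m n l" using k v by (intro super_swap_tensor)
      have Sw: "Poly_Mapping.keys (?S v) \<subseteq> words l" using Sv tensor_words_words by blast
      have tj: "Transposition.transpose k (Suc k) j = j" using k(3) by (simp add: Transposition.transpose_def)
      have "(?S \<circ> (T \<circ> ?S)) (unit_at m a b (Suc k) v) = ?S (T (unit_at m a b k (?S v)))"
        using k w by (simp add: super_swap_unit_vec)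
      also have "\<dots> = (\<Sum>d\<in>{1..m + n}. sg m d *\<^sub>C ?S (unit_at m a d j (unit_at m d b k (?S v))))"
        by (simp only: T1[OF Sv] is_lin_sum[OF is_lin_super_swap] is_linD(2)[OF is_lin_super_swap])
      also have "\<dots> = (\<Sum>d\<in>{1..m + n}. sg m d *\<^sub>C unit_at m a d j (unit_at m d b (Suc k) v))"
        using k assms(1) w Sw unit_at_words[OF Sw] by (simp add: super_swap_unit_vec super_swap_square_vec tj)
      finally show "(?S \<circ> (T \<circ> ?S)) (unit_at m a b (Suc k) v) = (\<Sum>d\<in>{1..m + n}. sg m d *\<^sub>C unit_at m a d j (unit_at m d b (Suc k) v))" .
      have "(?S \<circ> (T \<circ> ?S)) (unit_at m a b j v) = ?S (T (unit_at m a b j (?S v)))"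
        using k assms(1) w by (simp add: super_swap_unit_vec tj)
      also have "\<dots> = (\<Sum>d\<in>{1..m + n}. sg m d *\<^sub>C ?S (unit_at m a d k (unit_at m d b j (?S v))))"
        by (simp only: T2[OF Sv] is_lin_sum[OF is_lin_super_swap] is_linD(2)[OF is_lin_super_swap])
      also have "\<dots> = (\<Sum>d\<in>{1..m + n}. sg m d *\<^sub>C unit_at m a d (Suc k) (unit_at m d b j v))"
        using k assms(1) w Sw unit_at_words[OF Sw] by (simp add: super_swap_unit_vec super_swap_square_vec tj)
      finally show "(?S \<circ> (T \<circ> ?S)) (unit_at m a b j v) = (\<Sum>d\<in>{1..m + n}. sg m d *\<^sub>C unit_at m a d (Suc k) (unit_at m d b j v))" .
    qed
    ultimately show ?case by blast
  qed
qed

lemma super_perm_props: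
  assumes "(\<sigma>, T) \<in> super_perm m l"
  shows "\<sigma> permutes {1..l}" "is_lin T"
    "Poly_Mapping.keys v \<subseteq> tensor_words m n l \<Longrightarrow> Poly_Mapping.keys (T v) \<subseteq> tensor_words m n l"
  using assms
proof (induction rule: super_perm.induct)
  case super_perm_id
  { case 1 show ?case by (rule permutes_id) }
  { case 2 show ?case using is_lin_ident by (simp add: id_def) }
  { case 3 then show ?case by simp }
next
  case (super_perm_step \<sigma> T i)
  { case 1 show ?case using super_perm_step
     by (intro permutes_compose permutes_swap_id) auto }
  { case 2 show ?case using super_perm_step is_lin_comp[OF is_lin_super_swap] by (simp add: comp_def) }
  { case 3 then show ?case using super_perm_step super_swap_tensor by simp }
qed

section \<open>The degenerate affine Hecke algebra\<close>

context lin_quot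
begin

definition eqv :: "('a \<Rightarrow>\<^sub>0 complex) \<Rightarrow> ('a \<Rightarrow>\<^sub>0 complex) \<Rightarrow> bool" (infix \<open>\<approx>\<close> 50) where
  "f \<approx> g \<longleftrightarrow> f - g \<in> K"

lemma eqv_iff: "f \<approx> g \<longleftrightarrow> cls f = cls g"
  by (simp add: eqv_def cls_eq_iff)

lemma eqv_refl [simp]: "f \<approx> f" and eqv_sym: "f \<approx> g \<Longrightarrow> g \<approx> f"
  and eqv_trans [trans]: "f \<approx> g \<Longrightarrow> g \<approx> k \<Longrightarrow> f \<approx> k"
  by (simp_all add: eqv_iff)

lemma eqv_add: "f \<approx> f' \<Longrightarrow> g \<approx> g' \<Longrightarrow> f + g \<approx> f' + g'"
  using K_D(3)[of "f - f'" "g - g'"] by (simp add: eqv_def algebra_simps)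

lemma eqv_diff: "f \<approx> f' \<Longrightarrow> g \<approx> g' \<Longrightarrow> f - g \<approx> f' - g'"
  using K_diff[of "f - f'" "g - g'"] by (simp add: eqv_def algebra_simps)

lemma eqv_scale: "f \<approx> f' \<Longrightarrow> c *\<^sub>C f \<approx> c *\<^sub>C f'"
  using K_D(4)[of "f - f'" c] by (simp add: eqv_def scale_diff)

lemma eqv_sum: "(\<And>x. x \<in> S \<Longrightarrow> f x \<approx> g x) \<Longrightarrow> (\<Sum>x\<in>S. f x) \<approx> (\<Sum>x\<in>S. g x)"
  by (induction S rule: infinite_finite_induct) (simp_all add: eqv_add)

lemma eqv_0_iff: "f \<approx> 0 \<longleftrightarrow> f \<in> K" by (simp add: eqv_def)

end

context presentation
begin

lemma eqv_rel: "f - g \<in> R \<Longrightarrow> eqv f g"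
  using ring.genideal_self[OF ring_free_algebra rels] by (auto simp: eqv_def)

end

lemma transpose_permutes: "i \<in> S \<Longrightarrow> j \<in> S \<Longrightarrow> Transposition.transpose i j permutes S"
  by (rule permutes_swap_id)

lemma hecke_presentation: "presentation (hecke_gens l) (hecke_rels l lam)"
proof
  have u: "gen (U i) \<in> carrier (free_algebra (hecke_gens l))" if "i \<in> {1..l}" for i
    using that by (intro free_algebra_gen) (simp add: hecke_gens_def)
  have p: "gen (Perm \<sigma>) \<in> carrier (free_algebra (hecke_gens l))" if "\<sigma> permutes {1..l}" for \<sigma>
    using that by (intro free_algebra_gen) (simp add: hecke_gens_def)
  have s: "swap_gen i (Suc i) \<in> carrier (free_algebra (hecke_gens l))" if "1 \<le> i" "i < l" for i
    unfolding swap_gen_def using that by (intro p transpose_permutes) auto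
  have comp: "\<sigma> \<circ> \<tau> permutes {1..l}" if "\<sigma> permutes {1..l}" "\<tau> permutes {1..l}" for \<sigma> \<tau>
    using that by (intro permutes_compose)
  show "hecke_rels l lam \<subseteq> carrier (free_algebra (hecke_gens l))"
    unfolding hecke_rels_def Let_def
    by (intro Un_least subsetI; clarsimp simp del: One_nat_def)
       (auto intro!: free_algebra_closed(1-7) u p s comp permutes_id simp del: One_nat_def Suc_eq_plus1 simp: Suc_eq_plus1[symmetric])
qed

lemma hecke_rels_U:
  "i \<in> {1..<l} \<Longrightarrow> gen (U i) * swap_gen i (i + 1) - (swap_gen i (i + 1) * gen (U (i + 1)) - lam *\<^sub>C 1) \<in> hecke_rels l lam"
  "i \<in> {1..<l} \<Longrightarrow> gen (U (i + 1)) * swap_gen i (i + 1) - (swap_gen i (i + 1) * gen (U i) + lam *\<^sub>C 1) \<in> hecke_rels l lam"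
  "k \<in> {1..l} \<Longrightarrow> i \<in> {1..<l} \<Longrightarrow> k \<noteq> i \<Longrightarrow> k \<noteq> i + 1 \<Longrightarrow>
     gen (U k) * swap_gen i (i + 1) - swap_gen i (i + 1) * gen (U k) \<in> hecke_rels l lam"
  "k \<in> {1..l} \<Longrightarrow> j \<in> {1..l} \<Longrightarrow> gen (U k) * gen (U j) - gen (U j) * gen (U k) \<in> hecke_rels l lam"
  unfolding hecke_rels_def Let_def by blast+

locale hecke_algebra =
  fixes l :: nat and lam :: complex
begin

sublocale H: presentation "hecke_gens l" "hecke_rels l lam"
  by (rule hecke_presentation)

abbreviation "HC \<equiv> carrier (free_algebra (hecke_gens l))"

text \<open>A lift of z_k to the free algebra, so that products can be computed on representatives
  modulo the relation ideal.\<close>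

definition zt :: "nat \<Rightarrow> hecke_gen free" where
  "zt k = gen (U k) + (lam / 2) *\<^sub>C (\<Sum>j\<in>{1..l} - {k}. of_int (sgn (int j - int k)) *\<^sub>C swap_gen k j)"

lemma gen_U_HC: "i \<in> {1..l} \<Longrightarrow> gen (U i) \<in> HC"
  by (intro free_algebra_gen) (simp add: hecke_gens_def)

lemma gen_Perm_HC: "\<sigma> permutes {1..l} \<Longrightarrow> gen (Perm \<sigma>) \<in> HC"
  by (intro free_algebra_gen) (simp add: hecke_gens_def)

lemma swap_gen_HC: "i \<in> {1..l} \<Longrightarrow> j \<in> {1..l} \<Longrightarrow> swap_gen i j \<in> HC"
  unfolding swap_gen_def by (intro gen_Perm_HC transpose_permutes)

lemma zt_HC: "k \<in> {1..l} \<Longrightarrow> zt k \<in> HC"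
  unfolding zt_def by (intro FA.carrier_add FA.carrier_scale free_algebra_sum gen_U_HC swap_gen_HC) auto

lemma perm_mult: "\<sigma> permutes {1..l} \<Longrightarrow> \<tau> permutes {1..l} \<Longrightarrow> H.eqv (gen (Perm \<sigma>) * gen (Perm \<tau>)) (gen (Perm (\<sigma> \<circ> \<tau>)))"
  by (rule H.eqv_rel) (auto simp: hecke_rels_def)

lemma perm_id: "H.eqv (gen (Perm id)) 1"
  by (rule H.eqv_rel) (auto simp: hecke_rels_def)

lemma swap_conj:
  assumes "k \<in> {1..l}" "j \<in> {1..l}" "1 \<le> i" "i < l"
  defines "t \<equiv> Transposition.transpose i (i + 1)"
  shows "H.eqv (swap_gen i (i + 1) * swap_gen k j) (swap_gen (t k) (t j) * swap_gen i (i + 1))"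
proof -
  have t: "t permutes {1..l}" unfolding t_def using assms by (intro transpose_permutes) auto
  have tk: "t k \<in> {1..l}" "t j \<in> {1..l}" using assms(1,2) by (simp_all only: permutes_in_image[OF t])
  have eq: "t \<circ> Transposition.transpose k j = Transposition.transpose (t k) (t j) \<circ> t"
    using permutes_inj[OF t] by (auto simp: fun_eq_iff Transposition.transpose_def inj_eq)
  have "H.eqv (swap_gen i (i + 1) * swap_gen k j) (gen (Perm (t \<circ> Transposition.transpose k j)))"
    unfolding swap_gen_def t_def[symmetric] using assms t by (intro perm_mult transpose_permutes)
  also have "H.eqv \<dots> (swap_gen (t k) (t j) * swap_gen i (i + 1))"
    unfolding eq swap_gen_def t_def[symmetric] using tk t by (rule_tac H.eqv_sym, intro perm_mult transpose_permutes)
  finally show ?thesis .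
qed

lemma swap_square: "1 \<le> i \<Longrightarrow> i < l \<Longrightarrow> H.eqv (swap_gen (i + 1) i * swap_gen i (i + 1)) 1"
  and swap_square': "1 \<le> i \<Longrightarrow> i < l \<Longrightarrow> H.eqv (swap_gen i (i + 1) * swap_gen i (i + 1)) 1"
proof -
  assume i: "1 \<le> i" "i < l"
  have "Transposition.transpose i (i + 1) permutes {1..l}" using i by (intro transpose_permutes) auto
  from H.eqv_trans[OF perm_mult[OF this this]] perm_id
  show "H.eqv (swap_gen i (i + 1) * swap_gen i (i + 1)) 1"
    by (simp add: swap_gen_def)
  then show "H.eqv (swap_gen (i + 1) i * swap_gen i (i + 1)) 1"
    by (simp add: swap_gen_def transpose_commute)
qed

text \<open>With s the transposition of i and i + 1, solving u_{i+1} s = s u_i + \<lambda> for s u_i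
  gives the constant -\<lambda>, and solving u_i s = s u_{i+1} - \<lambda> for s u_{i+1} gives
  \<lambda>.\<close>

lemma swap_U:
  assumes "k \<in> {1..l}" "1 \<le> i" "i < l"
  shows "H.eqv (swap_gen i (i + 1) * gen (U k)) (gen (U (Transposition.transpose i (i + 1) k)) * swap_gen i (i + 1)
     + (if k = i then - lam else if k = i + 1 then lam else 0) *\<^sub>C 1)"
proof -
  let ?u = "\<lambda>i. gen (U i)" and ?s = "swap_gen i (i + 1)"
  consider "k = i" | "k = i + 1" | "k \<noteq> i" "k \<noteq> i + 1" by blast
  then show ?thesis
  proof cases
    case 1
    have "H.eqv (?u (i + 1) * ?s) (?s * ?u i + lam *\<^sub>C 1)"
      using assms by (intro H.eqv_rel hecke_rels_U) auto
    from H.eqv_sym[OF H.eqv_diff[OF this H.eqv_refl[of "lam *\<^sub>C 1"]]] show ?thesis using 1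
      by (simp add: scale_minus_left)
  next
    case 2
    have "H.eqv (?u i * ?s) (?s * ?u (i + 1) - lam *\<^sub>C 1)"
      using assms by (intro H.eqv_rel hecke_rels_U) auto
    from H.eqv_sym[OF H.eqv_add[OF this H.eqv_refl[of "lam *\<^sub>C 1"]]] show ?thesis using 2
      by simp
  next
    case 3
    have "H.eqv (?u k * ?s) (?s * ?u k)"
      using assms 3 by (intro H.eqv_rel hecke_rels_U) auto
    from H.eqv_sym[OF this] show ?thesis using 3 by (simp add: Transposition.transpose_def)
  qed
qed

text \<open>Conjugation permutes the transpositions in z_k and keeps their signs, except for the
  transposition of i and i + 1. That term changes sign and so contributes twice \<lambda>/2 times a
  square equal to 1, which cancels the constant of \<open>swap_U\<close>.\<close>

lemma swap_zt:
  assumes "k \<in> {1..l}" "1 \<le> i" "i < l"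
  defines "t \<equiv> Transposition.transpose i (i + 1)"
  shows "H.eqv (swap_gen i (i + 1) * zt k) (zt (t k) * swap_gen i (i + 1))"
proof -
  let ?s = "swap_gen i (i + 1)"
  have t: "t permutes {1..l}" unfolding t_def using assms by (intro transpose_permutes) auto
  have tt: "t (t j) = j" for j by (simp add: t_def)
  have ti: "t j \<in> {1..l} \<longleftrightarrow> j \<in> {1..l}" for j by (rule permutes_in_image[OF t])
  have tk: "t k \<in> {1..l}" using assms(1) by (simp only: permutes_in_image[OF t])
  let ?c = "if k = i then - lam else if k = i + 1 then lam else 0"
  define D where "D = {1..l} - {t k}"
  \<comment> \<open>Reindexing by \<open>t\<close> puts the same transpositions on both sides, so
    that only the sign coefficients remain to be compared.\<close>
  have bij: "bij_betw t D ({1..l} - {k})"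
    unfolding D_def
    by (rule bij_betw_byWitness[where f' = t])
      (use ti in \<open>auto simp: tt simp del: atLeastAtMost_iff dest: arg_cong[of _ _ t]\<close>)
  let ?g = "\<lambda>j. of_int (sgn (int j - int (t k))) :: complex" and ?g' = "\<lambda>j. of_int (sgn (int (t j) - int k)) :: complex"
  have A: "H.eqv (?s * gen (U k)) (gen (U (t k)) * ?s + ?c *\<^sub>C 1)"
    using swap_U[OF assms(1-3)] unfolding t_def .
  have B: "H.eqv (?s * swap_gen k (t j)) (swap_gen (t k) (t (t j)) * ?s)" if "j \<in> D" for j
    using swap_conj[OF assms(1) _ assms(2,3), of "t j", folded t_def] that ti[of j] unfolding D_def by blast
  have "?s * zt k = ?s * gen (U k) + (lam / 2) *\<^sub>C (\<Sum>j\<in>{1..l} - {k}. of_int (sgn (int j - int k)) *\<^sub>C (?s * swap_gen k j))"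
    by (simp add: zt_def distrib_left scale_mult_right sum_distrib_left)
  also have "(\<Sum>j\<in>{1..l} - {k}. of_int (sgn (int j - int k)) *\<^sub>C (?s * swap_gen k j)) = (\<Sum>j\<in>D. ?g' j *\<^sub>C (?s * swap_gen k (t j)))"
    by (rule sum.reindex_bij_betw[OF bij, symmetric])
  also have "H.eqv (?s * gen (U k) + (lam / 2) *\<^sub>C (\<Sum>j\<in>D. ?g' j *\<^sub>C (?s * swap_gen k (t j))))
     ((gen (U (t k)) * ?s + ?c *\<^sub>C 1) + (lam / 2) *\<^sub>C (\<Sum>j\<in>D. ?g' j *\<^sub>C (swap_gen (t k) (t (t j)) * ?s)))"
    by (rule H.eqv_add[OF A], rule H.eqv_scale, rule H.eqv_sum, rule H.eqv_scale, erule B)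
  also have "\<dots> = (gen (U (t k)) * ?s + (lam / 2) *\<^sub>C (\<Sum>j\<in>D. ?g j *\<^sub>C (swap_gen (t k) j * ?s)))
     + (?c *\<^sub>C 1 + (lam / 2) *\<^sub>C (\<Sum>j\<in>D. (?g' j - ?g j) *\<^sub>C (swap_gen (t k) j * ?s)))"
    by (simp add: tt scale_add[symmetric] sum.distrib[symmetric] scale_add_left[symmetric] add.assoc add.left_commute)
  also have "gen (U (t k)) * ?s + (lam / 2) *\<^sub>C (\<Sum>j\<in>D. ?g j *\<^sub>C (swap_gen (t k) j * ?s)) = zt (t k) * ?s"
    by (simp add: zt_def D_def distrib_right scale_mult_left sum_distrib_right)
  finally have 1: "H.eqv (?s * zt k) (zt (t k) * ?s + (?c *\<^sub>C 1 + (lam / 2) *\<^sub>C (\<Sum>j\<in>D. (?g' j - ?g j) *\<^sub>C (swap_gen (t k) j * ?s))))" .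
  have "H.eqv (?c *\<^sub>C 1 + (lam / 2) *\<^sub>C (\<Sum>j\<in>D. (?g' j - ?g j) *\<^sub>C (swap_gen (t k) j * ?s))) 0"
  proof -
    \<comment> \<open>An adjacent transposition reverses the order of two numbers only if it
      exchanges them.\<close>
    have other: "?g' j = ?g j" if "j \<in> D" "\<not> (k = i \<and> j = i)" "\<not> (k = i + 1 \<and> j = i + 1)" for j
    proof -
      have "sgn (int (t j) - int k) = sgn (int j - int (t k))"
      proof -
        have sg: "sgn (int x - int y) = (if y < x then 1 else if x = y then 0 else -1)" for x y by simp
        have "j \<noteq> t k" using that(1) by (simp add: D_def)
        then show ?thesis using that(2,3) unfolding sg t_def Transposition.transpose_def
          by (auto split: if_split_asm)
      qed
      then show ?thesis by simp
    qed
    have red: "(\<Sum>j\<in>D. (?g' j - ?g j) *\<^sub>C (swap_gen (t k) j * ?s)) = (?g' x - ?g x) *\<^sub>C (swap_gen (t k) x * ?s)"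
      if "x \<in> D" "\<And>j. j \<in> D \<Longrightarrow> j \<noteq> x \<Longrightarrow> ?g' j = ?g j" for x
    proof -
      have "(\<Sum>j\<in>D. (?g' j - ?g j) *\<^sub>C (swap_gen (t k) j * ?s)) = (\<Sum>j\<in>{x}. (?g' j - ?g j) *\<^sub>C (swap_gen (t k) j * ?s))"
        using that by (intro sum.mono_neutral_right) (auto simp: D_def)
      then show ?thesis by simp
    qed
    consider "k = i" | "k = i + 1" | "k \<noteq> i" "k \<noteq> i + 1" by blast
    then show ?thesis
    proof cases
      case 1
      have "(\<Sum>j\<in>D. (?g' j - ?g j) *\<^sub>C (swap_gen (t k) j * ?s)) = 2 *\<^sub>C (swap_gen (i + 1) i * ?s)"
        using 1 assms other by (subst red[of i]) (auto simp: D_def t_def)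
      moreover have "H.eqv ((- lam) *\<^sub>C 1 + (lam / 2) *\<^sub>C 2 *\<^sub>C (swap_gen (i + 1) i * ?s)) ((- lam) *\<^sub>C 1 + (lam / 2) *\<^sub>C 2 *\<^sub>C 1)"
        using assms by (intro H.eqv_add H.eqv_scale swap_square) auto
      ultimately show ?thesis using 1 by (simp add: scale_scale scale_minus_left)
    next
      case 2
      have "(\<Sum>j\<in>D. (?g' j - ?g j) *\<^sub>C (swap_gen (t k) j * ?s)) = (-2) *\<^sub>C (swap_gen i (i + 1) * ?s)"
        using 2 assms other by (subst red[of "i + 1"]) (auto simp: D_def t_def)
      moreover have "H.eqv (lam *\<^sub>C 1 + (lam / 2) *\<^sub>C (-2) *\<^sub>C (swap_gen i (i + 1) * ?s)) (lam *\<^sub>C 1 + (lam / 2) *\<^sub>C (-2) *\<^sub>C 1)"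
        using assms by (intro H.eqv_add H.eqv_scale H.eqv_refl swap_square') auto
      moreover have "lam *\<^sub>C 1 + (lam / 2) *\<^sub>C (-2) *\<^sub>C (1 :: hecke_gen free) = 0"
        by (simp only: scale_scale scale_add_left[symmetric]) simp
      ultimately show ?thesis using 2 by simp
    next
      case 3
      then have "(\<Sum>j\<in>D. (?g' j - ?g j) *\<^sub>C (swap_gen (t k) j * ?s)) = 0"
        using other by (intro sum.neutral) auto
      with 3 show ?thesis by simp
    qed
  qed
  from H.eqv_add[OF H.eqv_refl this] have "H.eqv (zt (t k) * ?s + (?c *\<^sub>C 1 + (lam / 2) *\<^sub>C (\<Sum>j\<in>D. (?g' j - ?g j) *\<^sub>C (swap_gen (t k) j * ?s)))) (zt (t k) * ?s)"
    by simp
  with 1 show ?thesis by (rule H.eqv_trans)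
qed

end

section \<open>The tensor product over the symmetric group\<close>

locale sw_setup = hecke_algebra l lam for l lam +
  fixes m n :: nat and M :: "(complex, 'm) module" and ract :: "'m \<Rightarrow> hecke_gen free set \<Rightarrow> 'm"
  assumes ract: "right_module (hecke l lam) M ract"
begin

abbreviation "V \<equiv> tensor_power m n l"
abbreviation "bal \<equiv> sym_balance m l lam ract"
abbreviation "FS \<equiv> free_space (carrier M \<times> carrier V)"
abbreviation "KS \<equiv> tensor_kernel M V bal"

definition hact :: "'m \<Rightarrow> hecke_gen free \<Rightarrow> 'm" where "hact x f = ract x (hecke_class l lam f)"

lemma hact_cls: "hact x f = ract x (H.cls f)"
  by (simp add: hact_def hecke_class_def H.class_eq)

lemma hecke_eq: "hecke l lam = presented_algebra (hecke_gens l) (hecke_rels l lam)"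
  by (simp add: hecke_def)

lemma M_module: "module complex_ring M" using ract by (simp add: right_module_def)

sublocale M: module complex_ring M by (rule M_module)

lemma hact_closed: "x \<in> carrier M \<Longrightarrow> f \<in> HC \<Longrightarrow> hact x f \<in> carrier M"
  and hact_add_left: "x \<in> carrier M \<Longrightarrow> y \<in> carrier M \<Longrightarrow> f \<in> HC \<Longrightarrow> hact (x \<oplus>\<^bsub>M\<^esub> y) f = hact x f \<oplus>\<^bsub>M\<^esub> hact y f"
  and hact_scale_left: "x \<in> carrier M \<Longrightarrow> f \<in> HC \<Longrightarrow> hact (c \<odot>\<^bsub>M\<^esub> x) f = c \<odot>\<^bsub>M\<^esub> hact x f"
  and hact_add: "x \<in> carrier M \<Longrightarrow> f \<in> HC \<Longrightarrow> g \<in> HC \<Longrightarrow> hact x (f + g) = hact x f \<oplus>\<^bsub>M\<^esub> hact x g"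
  and hact_scale: "x \<in> carrier M \<Longrightarrow> f \<in> HC \<Longrightarrow> hact x (c *\<^sub>C f) = c \<odot>\<^bsub>M\<^esub> hact x f"
  and hact_mult: "x \<in> carrier M \<Longrightarrow> f \<in> HC \<Longrightarrow> g \<in> HC \<Longrightarrow> hact x (f * g) = hact (hact x f) g"
  and hact_one: "x \<in> carrier M \<Longrightarrow> hact x 1 = x"
  using ract unfolding right_module_def hecke_eq hact_cls
  by (auto simp: H.presented_carrier H.presented_add[symmetric] H.presented_smult[symmetric]
      H.presented_mult[symmetric] H.presented_one[symmetric])

lemma hact_eqv: "H.eqv f g \<Longrightarrow> hact x f = hact x g"
  by (simp add: hact_cls H.eqv_iff)

lemma carrier_V: "v \<in> carrier V \<longleftrightarrow> Poly_Mapping.keys v \<subseteq> tensor_words m n l"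
  by (simp add: tensor_power_def free_space_def)

sublocale V: lin_space V unfolding tensor_power_def by (rule lin_space_free_space)

lemma V_sum: "(\<And>x. x \<in> S \<Longrightarrow> f x \<in> carrier V) \<Longrightarrow> (\<Sum>x\<in>S. f x) \<in> carrier V"
  by (induction S rule: infinite_finite_induct) (auto simp: V.carrier_zero V.carrier_add)

lemma unit_at_V: "v \<in> carrier V \<Longrightarrow> a \<in> {1..m + n} \<Longrightarrow> unit_at m a b k v \<in> carrier V"
  unfolding carrier_V by (rule unit_at_tensor)

lemma FS_single: "x \<in> carrier M \<Longrightarrow> v \<in> carrier V \<Longrightarrow> Poly_Mapping.single (x, v) c \<in> carrier FS"
  by (simp add: free_space_def keys_single)

lemma bal_iff: "(\<rho>, T) \<in> bal \<longleftrightarrow> (\<exists>\<sigma>. (\<sigma>, T) \<in> super_perm m l \<and> \<rho> = (\<lambda>x. hact x (gen (Perm \<sigma>))))"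
  unfolding sym_balance_def hact_def by auto

interpretation FS: lin_space FS by (rule lin_space_free_space)

lemma bal_closed:
  assumes "(\<rho>, T) \<in> bal"
  shows "x \<in> carrier M \<Longrightarrow> \<rho> x \<in> carrier M" "v \<in> carrier V \<Longrightarrow> T v \<in> carrier V"
  using assms unfolding bal_iff carrier_V
  by (auto intro: hact_closed gen_Perm_HC super_perm_props(1) dest: super_perm_props(3))

lemma tensor_rels_closed: "tensor_rels M V bal \<subseteq> carrier FS"
proof
  note closed = FS.carrier_diff FS.carrier_scale FS_single V.carrier_add V.carrier_scale
  fix r assume "r \<in> tensor_rels M V bal"
  then show "r \<in> carrier FS"
    unfolding tensor_rels_def Let_def V.add_eq V.smult_eq
    apply (elim UnE CollectE exE conjE)
    subgoal by (simp add: closed)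
    subgoal by (simp add: closed)
    subgoal by (simp add: closed del: scale_simps)
    subgoal by (simp add: closed del: scale_simps)
    subgoal for \<rho> \<tau> x v using bal_closed(1)[of \<rho> \<tau> x] bal_closed(2)[of \<rho> \<tau> v] by (simp add: closed)
    done
qed

sublocale W: lin_quot FS KS
  by unfold_locales (unfold tensor_kernel_def, rule FS.gen_subspace(1)[OF tensor_rels_closed])

lemma tensor_rels_KS: "r \<in> tensor_rels M V bal \<Longrightarrow> r \<in> KS"
  unfolding tensor_kernel_def using FS.gen_subspace(2)[OF tensor_rels_closed] by blast

definition dl :: "'m \<Rightarrow> (nat list \<Rightarrow>\<^sub>0 complex) \<Rightarrow> ('m \<times> (nat list \<Rightarrow>\<^sub>0 complex)) \<Rightarrow>\<^sub>0 complex" where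
  "dl x v = Poly_Mapping.single (x, v) 1"

lemma dl_FS: "x \<in> carrier M \<Longrightarrow> v \<in> carrier V \<Longrightarrow> dl x v \<in> carrier FS"
  unfolding dl_def by (rule FS_single)

lemma dl_add_left: "x \<in> carrier M \<Longrightarrow> y \<in> carrier M \<Longrightarrow> v \<in> carrier V \<Longrightarrow> W.eqv (dl (x \<oplus>\<^bsub>M\<^esub> y) v) (dl x v + dl y v)"
  unfolding W.eqv_def diff_diff_eq[symmetric] dl_def by (rule tensor_rels_KS, unfold tensor_rels_def Let_def) blast

lemma dl_add: "x \<in> carrier M \<Longrightarrow> u \<in> carrier V \<Longrightarrow> v \<in> carrier V \<Longrightarrow> W.eqv (dl x (u + v)) (dl x u + dl x v)"
  unfolding W.eqv_def diff_diff_eq[symmetric] dl_def V.add_eq[symmetric] by (rule tensor_rels_KS, unfold tensor_rels_def Let_def) blast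

lemma dl_scale_left: "x \<in> carrier M \<Longrightarrow> v \<in> carrier V \<Longrightarrow> W.eqv (dl (c \<odot>\<^bsub>M\<^esub> x) v) (c *\<^sub>C dl x v)"
  unfolding W.eqv_def dl_def by (rule tensor_rels_KS, unfold tensor_rels_def Let_def) blast

lemma dl_scale: "x \<in> carrier M \<Longrightarrow> v \<in> carrier V \<Longrightarrow> W.eqv (dl x (c *\<^sub>C v)) (c *\<^sub>C dl x v)"
  unfolding W.eqv_def dl_def V.smult_eq[symmetric] by (rule tensor_rels_KS, unfold tensor_rels_def Let_def) blast

lemma dl_bal:
  assumes "x \<in> carrier M" "v \<in> carrier V" "(\<sigma>, T) \<in> super_perm m l"
  shows "W.eqv (dl (hact x (gen (Perm \<sigma>))) v) (dl x (T v))"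
proof -
  have "((\<lambda>x. hact x (gen (Perm \<sigma>))), T) \<in> bal" using assms(3) bal_iff by blast
  then show ?thesis using assms(1,2)
    unfolding W.eqv_def dl_def
    by (intro tensor_rels_KS, unfold tensor_rels_def Let_def, intro UnI2 CollectI)
      (rule exI[of _ "\<lambda>x. hact x (gen (Perm \<sigma>))"], blast)
qed

lemma dl_zero: "x \<in> carrier M \<Longrightarrow> W.eqv (dl x 0) 0"
  using dl_scale[of x 0 0] V.carrier_zero by simp

lemma dl_sum: "x \<in> carrier M \<Longrightarrow> (\<And>i. i \<in> S \<Longrightarrow> f i \<in> carrier V) \<Longrightarrow> W.eqv (dl x (\<Sum>i\<in>S. f i)) (\<Sum>i\<in>S. dl x (f i))"
proof (induction S rule: infinite_finite_induct)
  case (insert i S)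
  have "W.eqv (dl x (f i + (\<Sum>i\<in>S. f i))) (dl x (f i) + dl x (\<Sum>i\<in>S. f i))"
    using insert by (intro dl_add V_sum) auto
  also have "W.eqv \<dots> (dl x (f i) + (\<Sum>i\<in>S. dl x (f i)))"
    using insert by (intro W.eqv_add) auto
  finally show ?case using insert by simp
qed (auto simp: dl_zero)

section \<open>Formal pairs with basis words, and operators that descend\<close>

definition ten :: "'m \<Rightarrow> (nat list \<Rightarrow>\<^sub>0 complex) \<Rightarrow> ('m \<times> nat list) \<Rightarrow>\<^sub>0 complex" where
  "ten x = lin_ext (\<lambda>w. Poly_Mapping.single (x, w) 1)"

text \<open>
  \<open>\<beta>\<close> and \<open>\<pi>\<close> pass between formal pairs \<open>(x, w)\<close> with \<open>w\<close> a basis word, on which the operators act,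
  and formal pairs \<open>(x, v)\<close> with \<open>v\<close> any vector, of which the tensor product is a quotient.
\<close>

definition \<beta> :: "(('m \<times> nat list) \<Rightarrow>\<^sub>0 complex) \<Rightarrow> ('m \<times> (nat list \<Rightarrow>\<^sub>0 complex)) \<Rightarrow>\<^sub>0 complex" where
  "\<beta> = lin_ext (\<lambda>(x, w). dl x (Poly_Mapping.single w 1))"

definition \<pi> :: "(('m \<times> (nat list \<Rightarrow>\<^sub>0 complex)) \<Rightarrow>\<^sub>0 complex) \<Rightarrow> ('m \<times> nat list) \<Rightarrow>\<^sub>0 complex" where
  "\<pi> = lin_ext (\<lambda>(x, v). ten x v)"

lemma lin: "is_lin (ten x)" "is_lin \<beta>" "is_lin \<pi>"
  by (simp_all add: ten_def \<beta>_def \<pi>_def is_lin_lin_ext)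

definition Y0 :: "(('m \<times> nat list) \<Rightarrow>\<^sub>0 complex) set" where
  "Y0 = {y. Poly_Mapping.keys y \<subseteq> carrier M \<times> tensor_words m n l}"

lemma Y0_add: "f \<in> Y0 \<Longrightarrow> g \<in> Y0 \<Longrightarrow> f + g \<in> Y0" and Y0_scale: "f \<in> Y0 \<Longrightarrow> c *\<^sub>C f \<in> Y0"
  and Y0_zero: "0 \<in> Y0"
  using Poly_Mapping.keys_add[of f g] keys_scale[of c f] by (auto simp: Y0_def)

lemma ten_Y0: "x \<in> carrier M \<Longrightarrow> v \<in> carrier V \<Longrightarrow> ten x v \<in> Y0"
  unfolding ten_def Y0_def mem_Collect_eq carrier_V by (rule keys_lin_ext_subset) auto

lemma single_V: "w \<in> tensor_words m n l \<Longrightarrow> Poly_Mapping.single w c \<in> carrier V"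
  by (simp add: carrier_V keys_single)

lemma \<beta>_FS: "y \<in> Y0 \<Longrightarrow> \<beta> y \<in> carrier FS"
proof -
  assume "y \<in> Y0"
  then have "Poly_Mapping.keys (\<beta> y) \<subseteq> carrier M \<times> carrier V"
    unfolding \<beta>_def Y0_def by (intro keys_lin_ext_subset) (auto simp: dl_def keys_single intro!: single_V)
  then show ?thesis by (simp add: free_space_def)
qed

lemma \<pi>_Y0: "f \<in> carrier FS \<Longrightarrow> \<pi> f \<in> Y0"
proof -
  assume "f \<in> carrier FS"
  then have "Poly_Mapping.keys (\<pi> f) \<subseteq> carrier M \<times> tensor_words m n l"
    unfolding \<pi>_def free_space_def using ten_Y0 unfolding Y0_def by (intro keys_lin_ext_subset) auto
  then show ?thesis by (simp add: Y0_def)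
qed

lemma \<pi>_dl: "\<pi> (dl x v) = ten x v" and \<beta>_single: "\<beta> (Poly_Mapping.single (x, w) 1) = dl x (Poly_Mapping.single w 1)"
  and ten_single: "ten x (Poly_Mapping.single w c) = Poly_Mapping.single (x, w) c"
  by (simp_all add: \<pi>_def dl_def \<beta>_def ten_def)

lemma \<pi>_\<beta>: "\<pi> (\<beta> y) = y"
  by (rule is_lin_eqI[OF is_lin_comp[OF lin(3) lin(2)] is_lin_ident, of _ UNIV])
    (auto simp: \<beta>_def \<pi>_dl ten_single)

lemma \<beta>_ten:
  assumes "x \<in> carrier M" "v \<in> carrier V"
  shows "W.eqv (\<beta> (ten x v)) (dl x v)"
  using assms(2)[unfolded carrier_V]
proof (induction v rule: poly_mapping_span_induct)
  case zero
  show ?case using assms W.eqv_sym[OF dl_zero] by (simp add: is_lin_0 lin)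
next
  case (add f g)
  have "W.eqv (\<beta> (ten x (f + g))) (dl x f + dl x g)"
    using W.eqv_add[OF add(3,4)] by (simp add: is_linD lin)
  also have "W.eqv \<dots> (dl x (f + g))"
    using add assms by (rule_tac W.eqv_sym, intro dl_add) (auto simp: carrier_V)
  finally show ?case .
next
  case (single w c)
  have "\<beta> (ten x (Poly_Mapping.single w c)) = c *\<^sub>C dl x (Poly_Mapping.single w 1)"
    by (simp add: ten_single \<beta>_def)
  also have "W.eqv \<dots> (dl x (c *\<^sub>C Poly_Mapping.single w 1))"
    using single assms by (rule_tac W.eqv_sym, intro dl_scale single_V)
  finally show ?case by simp
qed

lemma \<beta>_\<pi>:
  assumes "f \<in> carrier FS"
  shows "W.eqv (\<beta> (\<pi> f)) f"
proof -
  have "Poly_Mapping.keys f \<subseteq> carrier M \<times> carrier V" using assms by (simp add: free_space_def)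
  then show ?thesis
  proof (induction f rule: poly_mapping_span_induct)
    case (single k c)
    obtain x v where k: "k = (x, v)" "x \<in> carrier M" "v \<in> carrier V" using single by auto
    have s: "Poly_Mapping.single k c = c *\<^sub>C dl x v" by (simp add: dl_def k)
    show ?case unfolding s using W.eqv_scale[OF \<beta>_ten[OF k(2,3)], of c]
      by (simp add: is_linD lin \<pi>_dl del: scale_simps)
  qed (simp_all add: is_lin_0 is_linD lin W.eqv_add)
qed

text \<open>By \<open>\<pi>_\<beta>\<close> and \<open>\<beta>_\<pi>\<close> the tensor product is
  \<open>Y0\<close> modulo \<open>KY\<close>, so an operator satisfying \<open>pres\<close> acts on
  it.\<close>

definition KY :: "(('m \<times> nat list) \<Rightarrow>\<^sub>0 complex) set" where "KY = {y \<in> Y0. \<beta> y \<in> KS}"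

definition pres :: "('m \<times> nat list) lop \<Rightarrow> bool" where
  "pres S \<longleftrightarrow> (\<forall>y\<in>Y0. app S y \<in> Y0) \<and> (\<forall>y\<in>KY. app S y \<in> KY)"

lemma KY_add: "f \<in> KY \<Longrightarrow> g \<in> KY \<Longrightarrow> f + g \<in> KY" and KY_scale: "f \<in> KY \<Longrightarrow> c *\<^sub>C f \<in> KY"
  and KY_zero: "0 \<in> KY"
  by (auto simp: KY_def Y0_add Y0_scale Y0_zero is_linD is_lin_0 lin W.K_D)

lemma pres_add: "pres S \<Longrightarrow> pres T \<Longrightarrow> pres (S + T)" and pres_mult: "pres S \<Longrightarrow> pres T \<Longrightarrow> pres (S * T)"
  and pres_sc: "pres (sc c)" and pres_zero: "pres 0" and pres_one: "pres 1"
  by (auto simp: pres_def Y0_add KY_add Y0_scale KY_scale Y0_zero KY_zero)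

lemma pres_minus: "pres S \<Longrightarrow> pres (- S)"
  using pres_mult[OF pres_sc[of "-1"], of S] by (simp add: sc_minus sc_1)

lemma pres_diff: "pres S \<Longrightarrow> pres T \<Longrightarrow> pres (S - T)"
  using pres_add[OF _ pres_minus, of S T] by simp

lemma pres_sum: "(\<And>x. x \<in> A \<Longrightarrow> pres (f x)) \<Longrightarrow> pres (\<Sum>x\<in>A. f x)"
  by (induction A rule: infinite_finite_induct) (auto simp: pres_zero pres_add)

text \<open>The f for which \<open>\<beta> (app S (\<pi> f))\<close> lies in the kernel form a
  subspace, so the generating relations suffice. An element y of \<open>KY\<close> is reached
  through f = \<open>\<beta> y\<close>, since \<open>\<pi>\<close> undoes
  \<open>\<beta>\<close>.\<close>

lemma presI:
  assumes Y: "\<And>y. y \<in> Y0 \<Longrightarrow> app S y \<in> Y0"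
    and rels: "\<And>r. r \<in> tensor_rels M V bal \<Longrightarrow> W.eqv (\<beta> (app S (\<pi> r))) 0"
  shows "pres S"
proof -
  let ?N = "{f \<in> carrier FS. W.eqv (\<beta> (app S (\<pi> f))) 0}"
  have "FS.subspace ?N"
    unfolding FS.subspace_def W.eqv_0_iff
    by (auto simp: FS.carrier_zero FS.carrier_add FS.carrier_scale is_lin_0 is_linD lin is_lin_app W.K_D)
  moreover have "tensor_rels M V bal \<subseteq> ?N" using rels tensor_rels_closed by auto
  ultimately have N: "KS \<subseteq> ?N" unfolding tensor_kernel_def by (rule FS.gen_subspace(3)[OF tensor_rels_closed])
  have "app S y \<in> KY" if "y \<in> KY" for y
  proof -
    have "\<beta> y \<in> ?N" using that N by (auto simp: KY_def)
    then show ?thesis using that Y by (auto simp: KY_def \<pi>_\<beta> W.eqv_0_iff)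
  qed
  with Y show ?thesis by (simp add: pres_def)
qed

definition EE :: "nat \<Rightarrow> nat \<Rightarrow> nat \<Rightarrow> ('m \<times> nat list) lop" where
  "EE k a b = (if k \<in> {1..l} then basis_op (\<lambda>(x, w). if x \<in> carrier M \<and> w \<in> words l
     then ten x (unit_at m a b k (Poly_Mapping.single w 1)) else 0) else 0)"

text \<open>Right multiplication on labels: the basis vector (x, w) goes to the basis vector (x u_k,
  w). The linear structure of M enters only with the quotient.\<close>

definition UU :: "nat \<Rightarrow> ('m \<times> nat list) lop" where
  "UU k = (if k \<in> {1..l} then basis_op (\<lambda>(x, w). if x \<in> carrier M
     then Poly_Mapping.single (hact x (gen (U k)), w) 1 else 0) else 0)"

lemma EE_single: "app (EE k a b) (Poly_Mapping.single (x, w) 1) = (if k \<in> {1..l} \<and> x \<in> carrier M \<and> w \<in> words l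
    then ten x (unit_at m a b k (Poly_Mapping.single w 1)) else 0)"
  by (simp add: EE_def)

lemma UU_single: "app (UU k) (Poly_Mapping.single (x, w) 1) = (if k \<in> {1..l} \<and> x \<in> carrier M
    then Poly_Mapping.single (hact x (gen (U k)), w) 1 else 0)"
  by (simp add: UU_def)

lemma EE_ten: "k \<in> {1..l} \<Longrightarrow> x \<in> carrier M \<Longrightarrow> Poly_Mapping.keys v \<subseteq> words l \<Longrightarrow>
    app (EE k a b) (ten x v) = ten x (unit_at m a b k v)"
  by (rule is_lin_eqI[OF is_lin_comp[OF is_lin_app lin(1)] is_lin_comp[OF lin(1) is_lin_unit_at]])
    (auto simp: ten_single EE_single)

lemma UU_ten: "k \<in> {1..l} \<Longrightarrow> x \<in> carrier M \<Longrightarrow> app (UU k) (ten x v) = ten (hact x (gen (U k))) v"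
  by (rule is_lin_eqI[OF is_lin_comp[OF is_lin_app lin(1)] lin(1), of _ UNIV])
    (auto simp: ten_single UU_single)

lemma keys_unit_single: "w \<in> words l \<Longrightarrow> Poly_Mapping.keys (unit_at m a b k (Poly_Mapping.single w 1)) \<subseteq> words l"
  by (rule unit_at_words) (simp add: keys_single)

lemma hact_U_comm: "x \<in> carrier M \<Longrightarrow> j \<in> {1..l} \<Longrightarrow> k \<in> {1..l} \<Longrightarrow>
   hact (hact x (gen (U j))) (gen (U k)) = hact (hact x (gen (U k))) (gen (U j))"
  by (simp only: hact_mult[symmetric] gen_U_HC) (intro hact_eqv H.eqv_rel hecke_rels_U)

abbreviation od :: "nat \<Rightarrow> bool" where "od i \<equiv> m < i"

lemma app_sgn2: "app (sgn2 od a b c d) f = fsgn m a b c d *\<^sub>C f"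
  by (simp add: sgn2_def fsgn_def scale_minus_one)

text \<open>A right action reverses products, which is harmless here because the u_k commute. They
  commute with the units because they change the label and not the word.\<close>

sublocale S: super_sites od "{1..m + n}" EE UU "sc (lam / 2)"
proof
  fix k a b c d
  show "EE k a b * EE k c d = (if b = c then EE k a d else 0)"
  proof (rule lop_eqI)
    fix y :: "'m \<times> nat list"
    obtain x w where y: "y = (x, w)" by (cases y)
    show "app (EE k a b * EE k c d) (Poly_Mapping.single y 1) = app (if b = c then EE k a d else 0) (Poly_Mapping.single y 1)"
    proof (cases "k \<in> {1..l} \<and> x \<in> carrier M \<and> w \<in> words l")
      case True
      then have "app (EE k a b * EE k c d) (Poly_Mapping.single y 1) = ten x (unit_at m a b k (unit_at m c d k (Poly_Mapping.single w 1)))"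
        by (simp only: app_simps y EE_single EE_ten keys_unit_single simp_thms if_True)
      then show ?thesis using True unit_at_same[of k w m a b c d]
        by (simp add: words_def y EE_single is_lin_0[OF lin(1)])
    next
      case False
      then show ?thesis by (auto simp: y EE_single is_lin_0[OF is_lin_app])
    qed
  qed
next
  fix j k :: nat and a b c d
  assume jk: "j \<noteq> k"
  show "EE j a b * EE k c d = sgn2 od a b c d * (EE k c d * EE j a b)"
  proof (rule lop_eqI)
    fix y :: "'m \<times> nat list"
    obtain x w where y: "y = (x, w)" by (cases y)
    show "app (EE j a b * EE k c d) (Poly_Mapping.single y 1) = app (sgn2 od a b c d * (EE k c d * EE j a b)) (Poly_Mapping.single y 1)"
    proof (cases "j \<in> {1..l} \<and> k \<in> {1..l} \<and> x \<in> carrier M \<and> w \<in> words l")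
      case True
      then have "app (EE j a b * EE k c d) (Poly_Mapping.single y 1) = ten x (unit_at m a b j (unit_at m c d k (Poly_Mapping.single w 1)))"
        by (simp only: app_simps y EE_single EE_ten keys_unit_single simp_thms if_True)
      also have "\<dots> = ten x (fsgn m a b c d *\<^sub>C unit_at m c d k (unit_at m a b j (Poly_Mapping.single w 1)))"
        using True jk by (subst unit_at_commute) (auto simp: words_def)
      also have "\<dots> = app (sgn2 od a b c d * (EE k c d * EE j a b)) (Poly_Mapping.single y 1)"
        using True by (simp only: app_simps app_sgn2 y EE_single EE_ten keys_unit_single simp_thms if_True is_linD[OF lin(1)])
      finally show ?thesis .
    next
      case False
      then have "app (EE j a b) (app (EE k c d) (Poly_Mapping.single y 1)) = 0 \<and> app (EE k c d) (app (EE j a b) (Poly_Mapping.single y 1)) = 0"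
        by (cases "j \<in> {1..l}"; cases "k \<in> {1..l}") (auto simp: y EE_single is_lin_0[OF is_lin_app], auto simp: EE_def)
      then show ?thesis by (simp add: app_sgn2)
    qed
  qed
next
  fix j k
  have cl: "hact x (gen (U i)) \<in> carrier M" if "x \<in> carrier M" "i \<in> {1..l}" for x i
    using that by (intro hact_closed gen_U_HC)
  show "UU j * UU k = UU k * UU j"
    by (cases "j \<in> {1..l}"; cases "k \<in> {1..l}"; rule lop_eqI)
      (auto simp: UU_single hact_U_comm cl is_lin_0[OF is_lin_app] simp del: atLeastAtMost_iff)
next
  fix j k a b
  show "UU j * EE k a b = EE k a b * UU j"
  proof (rule lop_eqI)
    fix y :: "'m \<times> nat list"
    obtain x w where y: "y = (x, w)" by (cases y)
    show "app (UU j * EE k a b) (Poly_Mapping.single y 1) = app (EE k a b * UU j) (Poly_Mapping.single y 1)"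
    proof (cases "j \<in> {1..l} \<and> k \<in> {1..l} \<and> x \<in> carrier M \<and> w \<in> words l")
      case True
      then have "hact x (gen (U j)) \<in> carrier M" by (intro hact_closed gen_U_HC) auto
      with True show ?thesis
        by (simp only: app_simps y EE_single UU_single EE_ten UU_ten keys_unit_single simp_thms if_True)
    next
      case False
      then show ?thesis
        by (cases "j \<in> {1..l}"; cases "k \<in> {1..l}") (auto simp: y EE_single UU_single is_lin_0[OF is_lin_app], auto simp: EE_def UU_def)
    qed
  qed
next
  show "sc (lam / 2) * x = x * sc (lam / 2)" for x :: "('m \<times> nat list) lop" by (rule sc_comm)
qed simp

lemma V_words: "v \<in> carrier V \<Longrightarrow> Poly_Mapping.keys v \<subseteq> words l"
  unfolding carrier_V by (rule order_trans[OF _ tensor_words_words])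

lemma e_ten: "x \<in> carrier M \<Longrightarrow> v \<in> carrier V \<Longrightarrow> app (S.e l a b) (ten x v) = ten x (unit_op m l a b v)"
  by (simp add: S.e_def app_sum unit_op_def is_lin_sum[OF lin(1)] EE_ten V_words del: One_nat_def)

lemma unit_op_V: "v \<in> carrier V \<Longrightarrow> a \<in> {1..m + n} \<Longrightarrow> unit_op m l a b v \<in> carrier V"
  unfolding unit_op_def by (intro V_sum unit_at_V)

lemma dl_hact_add: "x \<in> carrier M \<Longrightarrow> f \<in> HC \<Longrightarrow> g \<in> HC \<Longrightarrow> v \<in> carrier V \<Longrightarrow>
    W.eqv (dl (hact x (f + g)) v) (dl (hact x f) v + dl (hact x g) v)"
  by (simp add: hact_add dl_add_left hact_closed)

lemma dl_hact_scale: "x \<in> carrier M \<Longrightarrow> f \<in> HC \<Longrightarrow> v \<in> carrier V \<Longrightarrow>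
    W.eqv (dl (hact x (c *\<^sub>C f)) v) (c *\<^sub>C dl (hact x f) v)"
  by (simp add: hact_scale dl_scale_left hact_closed)

lemma dl_hact_sum: "x \<in> carrier M \<Longrightarrow> (\<And>i. i \<in> A \<Longrightarrow> f i \<in> HC) \<Longrightarrow> v \<in> carrier V \<Longrightarrow>
    W.eqv (dl (hact x (\<Sum>i\<in>A. f i)) v) (\<Sum>i\<in>A. dl (hact x (f i)) v)"
proof (induction A rule: infinite_finite_induct)
  case (insert i A)
  have "W.eqv (dl (hact x (f i + (\<Sum>i\<in>A. f i))) v) (dl (hact x (f i)) v + dl (hact x (\<Sum>i\<in>A. f i)) v)"
    using insert by (intro dl_hact_add free_algebra_sum) auto
  also have "W.eqv \<dots> (dl (hact x (f i)) v + (\<Sum>i\<in>A. dl (hact x (f i)) v))"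
    using insert by (intro W.eqv_add) auto
  finally show ?case using insert by simp
qed (use dl_hact_scale[of x 0 v 0] FA.carrier_zero in auto)

text \<open>Balancing moves the transposition from M to the words, where
  \<open>super_perm_transpose\<close> computes its product with a matrix unit.\<close>

lemma dl_swap:
  assumes "x \<in> carrier M" "v \<in> carrier V" "j \<in> {1..l}" "k \<in> {1..l}" "j \<noteq> k" "a \<in> {1..m + n}"
  shows "W.eqv (dl (hact x (swap_gen k j)) (unit_at m a b k v))
     (dl x (\<Sum>d\<in>{1..m + n}. sg m d *\<^sub>C unit_at m a d j (unit_at m d b k v)))"
proof -
  have "\<exists>T. (Transposition.transpose k j, T) \<in> super_perm m l \<and>
     T (unit_at m a b k v) = (\<Sum>d\<in>{1..m + n}. sg m d *\<^sub>C unit_at m a d j (unit_at m d b k v))"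
  proof (cases "j < k")
    case True
    then show ?thesis using super_perm_transpose[of j k l m n] assms unfolding carrier_V
      by (auto simp: transpose_commute[of k j] simp del: One_nat_def)
  next
    case False
    then show ?thesis using super_perm_transpose[of k j l m n] assms unfolding carrier_V
      by (auto simp del: One_nat_def)
  qed
  then obtain T where T: "(Transposition.transpose k j, T) \<in> super_perm m l"
     "T (unit_at m a b k v) = (\<Sum>d\<in>{1..m + n}. sg m d *\<^sub>C unit_at m a d j (unit_at m d b k v))" by blast
  show ?thesis unfolding T(2)[symmetric] swap_gen_def using assms T(1) by (intro dl_bal unit_at_V)
qed

lemma sgn1_sc: "sgn1 od d = (sc (sg m d) :: ('m \<times> nat list) lop)"
  by (simp add: sgn1_def sg_def par_def sc_minus sc_1)

lemma ksgn_sc: "S.ksgn j k = sc (of_int (sgn (int j - int k)))"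
  by (auto simp: S.ksgn_def sc_minus sc_1 sc_0)

text \<open>Modulo the tensor relations, the products of two sites in \<open>S.J_sites\<close> are
  the transpositions in z_k.\<close>

lemma J_ten:
  assumes "x \<in> carrier M" "v \<in> carrier V" "a \<in> {1..m + n}"
  shows "W.eqv (\<beta> (app (S.J l a b) (ten x v))) (\<Sum>k\<in>{1..l}. dl (hact x (zt k)) (unit_at m a b k v))"
proof -
  let ?P = "\<lambda>j k. \<Sum>d\<in>{1..m + n}. sg m d *\<^sub>C unit_at m a d j (unit_at m d b k v)"
  let ?s = "\<lambda>j k. of_int (sgn (int j - int k)) :: complex"
  have PV: "?P j k \<in> carrier V" for j k
    using assms by (intro V_sum V.carrier_scale unit_at_V)
  have sp: "app (super_prod od {1..m + n} (EE j) (EE k) a b) (ten x v) = ten x (?P j k)"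
    if "j \<in> {1..l}" "k \<in> {1..l}" for j k
    using that assms(1) V_words[OF assms(2)]
    by (simp add: super_prod_def app_sum sgn1_sc EE_ten unit_at_words is_lin_sum[OF lin(1)] is_linD[OF lin(1)] del: One_nat_def)
  have "app (S.J l a b) (ten x v) = (\<Sum>k\<in>{1..l}. ten (hact x (gen (U k))) (unit_at m a b k v)
     + (lam / 2) *\<^sub>C (\<Sum>j\<in>{1..l} - {k}. ?s j k *\<^sub>C ten x (?P j k)))"
    unfolding S.J_sites app_sum
    by (rule sum.cong) (use assms in \<open>simp_all add: app_sum ksgn_sc sp EE_ten V_words UU_ten del: One_nat_def\<close>)
  then have E1: "\<beta> (app (S.J l a b) (ten x v)) = (\<Sum>k\<in>{1..l}. \<beta> (ten (hact x (gen (U k))) (unit_at m a b k v))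
     + (lam / 2) *\<^sub>C (\<Sum>j\<in>{1..l} - {k}. ?s j k *\<^sub>C \<beta> (ten x (?P j k))))"
    by (simp only: is_lin_sum[OF lin(2)] is_linD[OF lin(2)])
  have E2: "W.eqv (\<Sum>k\<in>{1..l}. \<beta> (ten (hact x (gen (U k))) (unit_at m a b k v))
     + (lam / 2) *\<^sub>C (\<Sum>j\<in>{1..l} - {k}. ?s j k *\<^sub>C \<beta> (ten x (?P j k)))) (\<Sum>k\<in>{1..l}. dl (hact x (gen (U k))) (unit_at m a b k v)
     + (lam / 2) *\<^sub>C (\<Sum>j\<in>{1..l} - {k}. ?s j k *\<^sub>C dl x (?P j k)))"
    using assms by (intro W.eqv_sum W.eqv_add W.eqv_scale \<beta>_ten PV hact_closed gen_U_HC unit_at_V)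
  \<comment> \<open>Balancing enters only in this comparison, through \<open>dl_swap\<close>; so far
    the steps have used linearity alone.\<close>
  have E3: "W.eqv (\<Sum>k\<in>{1..l}. dl (hact x (gen (U k))) (unit_at m a b k v)
     + (lam / 2) *\<^sub>C (\<Sum>j\<in>{1..l} - {k}. ?s j k *\<^sub>C dl x (?P j k))) (\<Sum>k\<in>{1..l}. dl (hact x (zt k)) (unit_at m a b k v))"
  proof (rule W.eqv_sum)
    fix k assume k: "k \<in> {1..l}"
    let ?v = "unit_at m a b k v"
    have v: "?v \<in> carrier V" using assms by (intro unit_at_V)
    have sw: "swap_gen k j \<in> HC" if "j \<in> {1..l} - {k}" for j using k that by (intro swap_gen_HC) auto
    have S1: "(\<Sum>j\<in>{1..l} - {k}. ?s j k *\<^sub>C swap_gen k j) \<in> HC"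
      by (intro free_algebra_sum FA.carrier_scale sw)
    have "W.eqv (dl (hact x (zt k)) ?v) (dl (hact x (gen (U k))) ?v
       + dl (hact x ((lam / 2) *\<^sub>C (\<Sum>j\<in>{1..l} - {k}. ?s j k *\<^sub>C swap_gen k j))) ?v)"
      unfolding zt_def by (rule dl_hact_add[OF assms(1) gen_U_HC[OF k] FA.carrier_scale[OF S1] v])
    also have "W.eqv \<dots> (dl (hact x (gen (U k))) ?v
       + (lam / 2) *\<^sub>C dl (hact x (\<Sum>j\<in>{1..l} - {k}. ?s j k *\<^sub>C swap_gen k j)) ?v)"
      by (intro W.eqv_add W.eqv_refl dl_hact_scale assms(1) S1 v)
    also have "W.eqv \<dots> (dl (hact x (gen (U k))) ?v
       + (lam / 2) *\<^sub>C (\<Sum>j\<in>{1..l} - {k}. dl (hact x (?s j k *\<^sub>C swap_gen k j)) ?v))"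
      by (intro W.eqv_add W.eqv_refl W.eqv_scale dl_hact_sum FA.carrier_scale assms(1) sw v)
    also have "W.eqv \<dots> (dl (hact x (gen (U k))) ?v
       + (lam / 2) *\<^sub>C (\<Sum>j\<in>{1..l} - {k}. ?s j k *\<^sub>C dl (hact x (swap_gen k j)) ?v))"
      by (intro W.eqv_add W.eqv_refl W.eqv_scale W.eqv_sum dl_hact_scale assms(1) sw v)
    also have "W.eqv \<dots> (dl (hact x (gen (U k))) ?v
       + (lam / 2) *\<^sub>C (\<Sum>j\<in>{1..l} - {k}. ?s j k *\<^sub>C dl x (?P j k)))"
      using assms k by (intro W.eqv_add W.eqv_refl W.eqv_scale W.eqv_sum dl_swap) auto
    finally show "W.eqv (dl (hact x (gen (U k))) ?v
       + (lam / 2) *\<^sub>C (\<Sum>j\<in>{1..l} - {k}. ?s j k *\<^sub>C dl x (?P j k))) (dl (hact x (zt k)) ?v)"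
      by (rule W.eqv_sym)
  qed
  show ?thesis unfolding E1 by (rule W.eqv_trans[OF E2 E3])
qed

lemma eqv_diff0: "W.eqv f g \<Longrightarrow> W.eqv (f - g) 0" by (simp add: W.eqv_def)

lemma super_perm_unit:
  assumes "(\<sigma>, T) \<in> super_perm m l" "k \<in> {1..l}" "v \<in> carrier V"
  shows "T (unit_at m a b k v) = unit_at m a b (\<sigma> k) (T v)"
  using assms
proof (induction rule: super_perm.induct)
  case (super_perm_step \<sigma> T i)
  have k: "\<sigma> k \<in> {1..l}"
    using super_perm_props(1)[OF super_perm_step(1)] super_perm_step(5) by (simp only: permutes_in_image)
  have "Poly_Mapping.keys (T v) \<subseteq> words l"
    using super_perm_props(3)[OF super_perm_step(1)] super_perm_step(6) V_words carrier_V by blast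
  then have "super_swap m i (unit_at m a b (\<sigma> k) (T v)) =
      unit_at m a b (Transposition.transpose i (i + 1) (\<sigma> k)) (super_swap m i (T v))"
    using super_perm_step k by (intro super_swap_unit_vec) auto
  then show ?case using super_perm_step by simp
qed simp

text \<open>The intertwining of adjacent transpositions spreads to all permutations along the
  inductive definition. As M is a right module, the transposition composed last acts on it
  first.\<close>

lemma super_perm_hact:
  assumes "(\<sigma>, T) \<in> super_perm m l" "x \<in> carrier M" "k \<in> {1..l}"
    and \<zeta>: "\<And>k. k \<in> {1..l} \<Longrightarrow> \<zeta> k \<in> HC"
    and sw: "\<And>i k. k \<in> {1..l} \<Longrightarrow> 1 \<le> i \<Longrightarrow> i < l \<Longrightarrow>
      H.eqv (swap_gen i (i + 1) * \<zeta> k) (\<zeta> (Transposition.transpose i (i + 1) k) * swap_gen i (i + 1))"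
  shows "hact (hact x (gen (Perm \<sigma>))) (\<zeta> k) = hact (hact x (\<zeta> (\<sigma> k))) (gen (Perm \<sigma>))"
  using assms(1,2)
proof (induction arbitrary: x rule: super_perm.induct)
  case super_perm_id
  have id1: "hact y (gen (Perm id)) = y" if "y \<in> carrier M" for y
    using hact_eqv[OF perm_id] that by (simp add: hact_one)
  show ?case
    using id1[OF super_perm_id] id1[OF hact_closed[OF super_perm_id \<zeta>[OF assms(3)]]] by (simp add: id_def)
next
  case (super_perm_step \<sigma> T i)
  let ?t = "Transposition.transpose i (i + 1)"
  have \<sigma>: "\<sigma> permutes {1..l}" by (rule super_perm_props(1)[OF super_perm_step(1)])
  have t: "?t permutes {1..l}" using super_perm_step by (intro transpose_permutes) auto
  have k: "\<sigma> k \<in> {1..l}" "?t (\<sigma> k) \<in> {1..l}"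
    using assms(3) by (simp_all only: permutes_in_image[OF \<sigma>] permutes_in_image[OF t])
  have comp: "hact y (gen (Perm (?t \<circ> \<sigma>))) = hact (hact y (swap_gen i (i + 1))) (gen (Perm \<sigma>))" if "y \<in> carrier M" for y
    using hact_eqv[OF perm_mult[OF t \<sigma>], of y] that
    by (simp only: swap_gen_def hact_mult gen_Perm_HC[OF t] gen_Perm_HC[OF \<sigma>])
  have S: "swap_gen i (i + 1) \<in> HC" unfolding swap_gen_def by (rule gen_Perm_HC[OF t])
  have xs: "hact x (swap_gen i (i + 1)) \<in> carrier M" using super_perm_step S by (intro hact_closed)
  have "hact (hact x (gen (Perm (?t \<circ> \<sigma>)))) (\<zeta> k) = hact (hact (hact x (swap_gen i (i + 1))) (\<zeta> (\<sigma> k))) (gen (Perm \<sigma>))"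
    unfolding comp[OF super_perm_step(5)] by (rule super_perm_step.IH[OF xs])
  also have "hact (hact x (swap_gen i (i + 1))) (\<zeta> (\<sigma> k)) = hact (hact x (\<zeta> (?t (\<sigma> k)))) (swap_gen i (i + 1))"
    using hact_eqv[OF sw[OF k(1) super_perm_step(2,3)], of x] super_perm_step(5)
    by (simp only: hact_mult S \<zeta>[OF k(1)] \<zeta>[OF k(2)])
  also have "hact (hact (hact x (\<zeta> (?t (\<sigma> k)))) (swap_gen i (i + 1))) (gen (Perm \<sigma>)) = hact (hact x (\<zeta> ((?t \<circ> \<sigma>) k))) (gen (Perm (?t \<circ> \<sigma>)))"
    using comp[OF hact_closed[OF super_perm_step(5) \<zeta>[OF k(2)]]] by simp
  finally show ?case .
qed

text \<open>Passing \<sigma> through the tensor sign moves site k to \<sigma>(k) among the units and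
  \<open>\<zeta> k\<close> to \<open>\<zeta> (\<sigma> k)\<close> in M, so the sum over all sites is
  merely reindexed. The constant family 1 yields gl(m|n), and the family z_k yields J.\<close>

lemma pres_site:
  assumes a: "a \<in> {1..m + n}" and Y: "\<And>y. y \<in> Y0 \<Longrightarrow> app S y \<in> Y0"
    and form: "\<And>x v. x \<in> carrier M \<Longrightarrow> v \<in> carrier V \<Longrightarrow>
      W.eqv (\<beta> (app S (ten x v))) (\<Sum>k\<in>{1..l}. dl (hact x (\<zeta> k)) (unit_at m a b k v))"
    and \<zeta>: "\<And>k. k \<in> {1..l} \<Longrightarrow> \<zeta> k \<in> HC"
    and sw: "\<And>i k. k \<in> {1..l} \<Longrightarrow> 1 \<le> i \<Longrightarrow> i < l \<Longrightarrow>
      H.eqv (swap_gen i (i + 1) * \<zeta> k) (\<zeta> (Transposition.transpose i (i + 1) k) * swap_gen i (i + 1))"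
  shows "pres S"
proof (rule presI[OF Y])
  define B where "B x v = \<beta> (app S (ten x v))" for x v
  define \<Phi> where "\<Phi> x v = (\<Sum>k\<in>{1..l}. dl (hact x (\<zeta> k)) (unit_at m a b k v))" for x v
  have B\<Phi>: "W.eqv (B x v) (\<Phi> x v)" if "x \<in> carrier M" "v \<in> carrier V" for x v
    unfolding B_def \<Phi>_def by (rule form[OF that])
  have \<beta>S: "\<beta> (app S (\<pi> (f - g))) = \<beta> (app S (\<pi> f)) - \<beta> (app S (\<pi> g))" "\<beta> (app S (\<pi> (c *\<^sub>C f))) = c *\<^sub>C \<beta> (app S (\<pi> f))" for f g c
    by (simp_all add: is_lin_diff is_linD lin is_lin_app)
  have \<beta>d: "\<beta> (app S (\<pi> (Poly_Mapping.single (x, v) 1))) = B x v" for x v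
    using \<pi>_dl[of x v] by (simp add: B_def dl_def)
  have BI: "W.eqv (B x v) f" if "x \<in> carrier M" "v \<in> carrier V" "W.eqv (\<Phi> x v) f" for x v f
    using B\<Phi> that W.eqv_trans by blast
  note U = unit_at_V[OF _ a]
  fix r assume "r \<in> tensor_rels M V bal"
  then show "W.eqv (\<beta> (app S (\<pi> r))) 0"
    unfolding tensor_rels_def Let_def V.add_eq V.smult_eq
  proof (elim UnE CollectE exE conjE)
    fix x y v assume *: "x \<in> carrier M" "y \<in> carrier M" "v \<in> carrier V"
      "r = Poly_Mapping.single (x \<oplus>\<^bsub>M\<^esub> y, v) 1 - Poly_Mapping.single (x, v) 1 - Poly_Mapping.single (y, v) 1"
    have "W.eqv (\<Phi> (x \<oplus>\<^bsub>M\<^esub> y) v) (\<Phi> x v + \<Phi> y v)"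
      unfolding \<Phi>_def sum.distrib[symmetric] using * \<zeta>
      by (intro W.eqv_sum) (simp add: hact_add_left dl_add_left hact_closed U)
    then have "W.eqv (B (x \<oplus>\<^bsub>M\<^esub> y) v) (B x v + B y v)"
      by (intro BI[OF M.a_closed[OF *(1,2)] *(3)] W.eqv_trans[OF _ W.eqv_sym[OF W.eqv_add[OF B\<Phi>[OF *(1,3)] B\<Phi>[OF *(2,3)]]]])
    from eqv_diff0[OF this] show ?thesis unfolding *(4) \<beta>S \<beta>d by (simp add: diff_diff_eq)
  next
    fix x u v assume *: "x \<in> carrier M" "u \<in> carrier V" "v \<in> carrier V"
      "r = Poly_Mapping.single (x, u + v) 1 - Poly_Mapping.single (x, u) 1 - Poly_Mapping.single (x, v) 1"
    have "W.eqv (\<Phi> x (u + v)) (\<Phi> x u + \<Phi> x v)"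
      unfolding \<Phi>_def sum.distrib[symmetric] using * \<zeta>
      by (intro W.eqv_sum) (simp add: is_linD[OF is_lin_unit_at] dl_add hact_closed U)
    then have "W.eqv (B x (u + v)) (B x u + B x v)"
      by (intro BI[OF *(1) V.carrier_add[OF *(2,3)]] W.eqv_trans[OF _ W.eqv_sym[OF W.eqv_add[OF B\<Phi>[OF *(1,2)] B\<Phi>[OF *(1,3)]]]])
    from eqv_diff0[OF this] show ?thesis unfolding *(4) \<beta>S \<beta>d by (simp add: diff_diff_eq)
  next
    fix c x v assume *: "x \<in> carrier M" "v \<in> carrier V"
      "r = Poly_Mapping.single (c \<odot>\<^bsub>M\<^esub> x, v) 1 - c *\<^sub>C Poly_Mapping.single (x, v) 1"
    have "W.eqv (\<Phi> (c \<odot>\<^bsub>M\<^esub> x) v) (c *\<^sub>C \<Phi> x v)"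
      unfolding \<Phi>_def scale_sum using * \<zeta>
      by (intro W.eqv_sum) (simp add: hact_scale_left dl_scale_left hact_closed U)
    then have "W.eqv (B (c \<odot>\<^bsub>M\<^esub> x) v) (c *\<^sub>C B x v)"
      by (intro BI[OF M.smult_closed[OF _ *(1)] *(2)] W.eqv_trans[OF _ W.eqv_sym[OF W.eqv_scale[OF B\<Phi>[OF *(1,2)]]]]) simp_all
    from eqv_diff0[OF this] show ?thesis unfolding *(3) \<beta>S \<beta>d by simp
  next
    fix c x v assume *: "x \<in> carrier M" "v \<in> carrier V"
      "r = Poly_Mapping.single (x, c *\<^sub>C v) 1 - c *\<^sub>C Poly_Mapping.single (x, v) 1"
    have "W.eqv (\<Phi> x (c *\<^sub>C v)) (c *\<^sub>C \<Phi> x v)"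
      unfolding \<Phi>_def scale_sum using * \<zeta>
      by (intro W.eqv_sum) (simp add: is_linD[OF is_lin_unit_at] dl_scale hact_closed U)
    then have "W.eqv (B x (c *\<^sub>C v)) (c *\<^sub>C B x v)"
      by (intro BI[OF *(1) V.carrier_scale[OF *(2)]] W.eqv_trans[OF _ W.eqv_sym[OF W.eqv_scale[OF B\<Phi>[OF *(1,2)]]]])
    from eqv_diff0[OF this] show ?thesis unfolding *(3) \<beta>S \<beta>d by simp
  next
    fix \<rho> T x v assume *: "(\<rho>, T) \<in> bal" "x \<in> carrier M" "v \<in> carrier V"
      "r = Poly_Mapping.single (\<rho> x, v) 1 - Poly_Mapping.single (x, T v) 1"
    then obtain \<sigma> where \<sigma>: "(\<sigma>, T) \<in> super_perm m l" "\<rho> = (\<lambda>x. hact x (gen (Perm \<sigma>)))" by (auto simp: bal_iff)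
    have p: "\<sigma> permutes {1..l}" by (rule super_perm_props(1)[OF \<sigma>(1)])
    have Tv: "T v \<in> carrier V" by (rule bal_closed(2)[OF *(1,3)])
    have "\<Phi> x (T v) = (\<Sum>k\<in>{1..l}. dl (hact x (\<zeta> (\<sigma> k))) (unit_at m a b (\<sigma> k) (T v)))"
      unfolding \<Phi>_def by (rule sum.reindex_bij_betw[OF permutes_imp_bij[OF p], symmetric])
    moreover have "W.eqv (\<Phi> (\<rho> x) v) (\<Sum>k\<in>{1..l}. dl (hact x (\<zeta> (\<sigma> k))) (unit_at m a b (\<sigma> k) (T v)))"
      unfolding \<Phi>_def
    proof (rule W.eqv_sum)
      fix k assume k: "k \<in> {1..l}"
      have E: "hact (hact x (gen (Perm \<sigma>))) (\<zeta> k) = hact (hact x (\<zeta> (\<sigma> k))) (gen (Perm \<sigma>))"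
        by (rule super_perm_hact[OF \<sigma>(1) *(2) k]) (erule \<zeta>, erule (2) sw)
      have "\<sigma> k \<in> {1..l}" using k by (simp only: permutes_in_image[OF p])
      then have "hact x (\<zeta> (\<sigma> k)) \<in> carrier M" using * \<zeta> by (intro hact_closed)
      then have "W.eqv (dl (hact (hact x (\<zeta> (\<sigma> k))) (gen (Perm \<sigma>))) (unit_at m a b k v)) (dl (hact x (\<zeta> (\<sigma> k))) (T (unit_at m a b k v)))"
        using * U \<sigma> by (intro dl_bal)
      then show "W.eqv (dl (hact (\<rho> x) (\<zeta> k)) (unit_at m a b k v)) (dl (hact x (\<zeta> (\<sigma> k))) (unit_at m a b (\<sigma> k) (T v)))"
        unfolding \<sigma>(2) E super_perm_unit[OF \<sigma>(1) k *(3)] .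
    qed
    ultimately have "W.eqv (\<Phi> (\<rho> x) v) (\<Phi> x (T v))" by simp
    then have "W.eqv (B (\<rho> x) v) (B x (T v))"
      by (intro BI[OF bal_closed(1)[OF *(1,2)] *(3)] W.eqv_trans[OF _ W.eqv_sym[OF B\<Phi>[OF *(2) Tv]]])
    from eqv_diff0[OF this] show ?thesis unfolding *(4) \<beta>S \<beta>d by simp
  qed
qed

section \<open>Parity of the operators\<close>

definition Yp :: "nat \<Rightarrow> (('m \<times> nat list) \<Rightarrow>\<^sub>0 complex) set" where
  "Yp p = {y. Poly_Mapping.keys y \<subseteq> carrier M \<times> {w \<in> tensor_words m n l. sum_list (map (par m) w) mod 2 = p mod 2}}"

definition grad :: "nat \<Rightarrow> ('m \<times> nat list) lop \<Rightarrow> bool" where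
  "grad d S \<longleftrightarrow> (\<forall>p. \<forall>y\<in>Yp p. app S y \<in> Yp (p + d))"

lemma Yp_add: "f \<in> Yp p \<Longrightarrow> g \<in> Yp p \<Longrightarrow> f + g \<in> Yp p" and Yp_scale: "f \<in> Yp p \<Longrightarrow> c *\<^sub>C f \<in> Yp p"
  and Yp_zero: "0 \<in> Yp p" and Yp_Y0: "f \<in> Yp p \<Longrightarrow> f \<in> Y0"
  using Poly_Mapping.keys_add[of f g] keys_scale[of c f] by (auto simp: Yp_def Y0_def)

lemma Yp_cong: "p mod 2 = q mod 2 \<Longrightarrow> Yp p = Yp q"
  by (simp add: Yp_def)

lemma grad_cong: "grad d S \<Longrightarrow> d mod 2 = d' mod 2 \<Longrightarrow> grad d' S"
  unfolding grad_def by (metis Yp_cong mod_add_right_eq)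

lemma grad_add: "grad d S \<Longrightarrow> grad d T \<Longrightarrow> grad d (S + T)"
  and grad_mult: "grad d S \<Longrightarrow> grad d' T \<Longrightarrow> grad (d + d') (S * T)"
  and grad_sc: "grad 0 (sc c)" and grad_zero: "grad d 0" and grad_one: "grad 0 1"
  unfolding grad_def by (auto simp: Yp_add Yp_scale Yp_zero) (metis add.assoc add.commute)

lemma grad_sc_mult: "grad d S \<Longrightarrow> grad d (sc c * S)"
  using grad_mult[OF grad_sc] by fastforce

lemma grad_minus: "grad d S \<Longrightarrow> grad d (- S)"
  using grad_sc_mult[of d S "-1"] by (simp add: sc_minus sc_1)

lemma grad_diff: "grad d S \<Longrightarrow> grad d T \<Longrightarrow> grad d (S - T)"
  using grad_add[OF _ grad_minus, of d S T] by simp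

lemma grad_sum: "(\<And>x. x \<in> A \<Longrightarrow> grad d (f x)) \<Longrightarrow> grad d (\<Sum>x\<in>A. f x)"
  by (induction A rule: infinite_finite_induct) (auto simp: grad_zero grad_add)

lemma grad_basisI:
  assumes "\<And>x w. x \<in> carrier M \<Longrightarrow> w \<in> tensor_words m n l \<Longrightarrow>
    app S (Poly_Mapping.single (x, w) 1) \<in> Yp (sum_list (map (par m) w) + d)"
  shows "grad d S"
  unfolding grad_def
proof (intro allI ballI)
  fix p y assume "y \<in> Yp p"
  then have "Poly_Mapping.keys y \<subseteq> carrier M \<times> {w \<in> tensor_words m n l. sum_list (map (par m) w) mod 2 = p mod 2}"
    by (simp add: Yp_def)
  then show "app S y \<in> Yp (p + d)"
  proof (induction y rule: poly_mapping_span_induct)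
    case (single k c)
    obtain x w where k: "k = (x, w)" "x \<in> carrier M" "w \<in> tensor_words m n l" "sum_list (map (par m) w) mod 2 = p mod 2"
      using single by auto
    have "Yp (sum_list (map (par m) w) + d) = Yp (p + d)" using k(4) by (intro Yp_cong) (metis mod_add_left_eq)
    with assms[OF k(2,3)] have "app S (Poly_Mapping.single (x, w) 1) \<in> Yp (p + d)" by simp
    from Yp_scale[OF this, of c] show ?case
      unfolding k(1) using is_linD(2)[OF is_lin_app, of S c "Poly_Mapping.single (x, w) 1"] by simp
  qed (simp_all add: is_lin_0 is_linD is_lin_app Yp_zero Yp_add)
qed

text \<open>The basis vectors of \<open>Y0\<close> are homogeneous, so a homogeneous operator
  preserves \<open>Y0\<close>.\<close>

lemma grad_Y0:
  assumes "grad d S" "y \<in> Y0"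
  shows "app S y \<in> Y0"
proof -
  have "Poly_Mapping.keys y \<subseteq> carrier M \<times> tensor_words m n l" using assms(2) by (simp add: Y0_def)
  then show ?thesis
  proof (induction y rule: poly_mapping_span_induct)
    case (single k c)
    then have "Poly_Mapping.single k c \<in> Yp (sum_list (map (par m) (snd k)))"
      by (auto simp: Yp_def keys_single split: if_splits)
    then show ?case using assms(1) Yp_Y0 unfolding grad_def by blast
  qed (simp_all add: is_lin_0 is_linD is_lin_app Y0_zero Y0_add)
qed

lemma grad_EE:
  assumes "a \<in> {1..m + n}"
  shows "grad (par m a + par m b) (EE k a b)"
proof (rule grad_basisI)
  fix x w assume *: "x \<in> carrier M" "w \<in> tensor_words m n l"
  show "app (EE k a b) (Poly_Mapping.single (x, w) 1) \<in> Yp (sum_list (map (par m) w) + (par m a + par m b))"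
  proof (cases "k \<in> {1..l} \<and> w ! (k - 1) = b")
    case True
    have len: "k - 1 < length w" using True *(2) by (auto simp: tensor_words_def)
    have "par m b \<le> sum_list (map (par m) w)"
      using elem_le_sum_list[of "k - 1" "map (par m) w"] len True by simp
    then have s: "sum_list (map (par m) (w[k - 1 := a])) + par m b = sum_list (map (par m) w) + par m a"
      using sum_list_update[of "k - 1" "map (par m) w" "par m a"] len True by (simp add: map_update)
    \<comment> \<open>Adding the parity of b twice changes nothing modulo 2 and avoids a
      subtraction.\<close>
    have "sum_list (map (par m) (w[k - 1 := a])) mod 2 = (sum_list (map (par m) (w[k - 1 := a])) + par m b + par m b) mod 2"
      by presburger
    then have "sum_list (map (par m) (w[k - 1 := a])) mod 2 = (sum_list (map (par m) w) + (par m a + par m b)) mod 2"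
      unfolding s by (simp only: add.assoc)
    moreover have "w[k - 1 := a] \<in> tensor_words m n l"
      using *(2) assms by (auto simp: tensor_words_def dest!: set_update_subset_insert[THEN subsetD])
    ultimately show ?thesis using * True
      by (auto simp: EE_single unit_at_single ten_single Yp_def keys_single)
  next
    case False
    then show ?thesis by (auto simp: EE_single unit_at_single is_lin_0[OF lin(1)] Yp_zero)
  qed
qed

lemma grad_UU: "grad 0 (UU k)"
  by (rule grad_basisI) (auto simp: UU_single Yp_def keys_single intro!: hact_closed gen_U_HC)

text \<open>
  The index set \<open>{1..m + n}\<close> is a parameter of the sublocale \<open>S\<close>; rewriting its lower bound to
  \<open>Suc 0\<close> would separate the terms from the sublocale's rules.
\<close>

declare One_nat_def [simp del]

lemma grad_sgn1: "grad 0 (sgn1 od c)" by (simp add: sgn1_sc grad_sc)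

lemma grad_super_prod:
  assumes "\<And>a b. a \<in> {1..m + n} \<Longrightarrow> grad (par m a + par m b) (A a b)"
    and "\<And>a b. a \<in> {1..m + n} \<Longrightarrow> grad (par m a + par m b) (B a b)"
    and "C \<subseteq> {1..m + n}" "a \<in> {1..m + n}"
  shows "grad (par m a + par m b) (super_prod od C A B a b)"
  unfolding super_prod_def
proof (rule grad_sum)
  fix c assume "c \<in> C"
  then have "c \<in> {1..m + n}" using assms(3) by blast
  from grad_mult[OF grad_sgn1 grad_mult[OF assms(1)[OF assms(4)] assms(2)[OF this]]]
  show "grad (par m a + par m b) (sgn1 od c * (A a c * B c b))"
    by (rule grad_cong) presburger
qed

lemma grad_e: "a \<in> {1..m + n} \<Longrightarrow> grad (par m a + par m b) (S.e r a b)"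
  unfolding S.e_def by (intro grad_sum grad_EE)

lemma h2: "sc (lam / 2) + sc (lam / 2) = (sc lam :: ('m \<times> nat list) lop)"
  by (simp add: sc_add[symmetric])

lemma \<sigma>_sc: "S.\<sigma> i = sc (\<Sum>k\<in>S.below i. sg m k)" and \<tau>_sc: "S.\<tau> = sc (\<Sum>k\<in>{1..m + n}. sg m k)"
  by (simp_all add: S.\<sigma>_def S.\<tau>_def sgn1_sc sc_sum)

lemma grad_T: "a \<in> {1..m + n} \<Longrightarrow> grad (par m a + par m b) (S.T r a b)"
proof -
  assume a: "a \<in> {1..m + n}"
  have 1: "grad (par m a + par m b) (UU k * EE k a b)" for k
    using grad_mult[OF grad_UU grad_EE[OF a]] by simp
  show ?thesis unfolding S.T_sites h2
    by (intro grad_sum grad_diff 1 grad_sc_mult grad_super_prod grad_EE a) auto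
qed

lemma grad_G: "a \<in> {1..m + n} \<Longrightarrow> grad (par m a + par m b) (S.G r i a b)"
  unfolding S.G_def h2 \<sigma>_sc
  by (intro grad_add grad_diff grad_sc_mult grad_T grad_super_prod grad_e) (auto simp: S.below_def)

lemma pres_sc_mult: "pres S \<Longrightarrow> pres (sc c * S)" by (intro pres_mult pres_sc)

lemma pres_super_prod:
  assumes "\<And>a b. a \<in> {1..m + n} \<Longrightarrow> pres (A a b)" "\<And>a b. a \<in> {1..m + n} \<Longrightarrow> pres (B a b)"
    and "C \<subseteq> {1..m + n}" "a \<in> {1..m + n}"
  shows "pres (super_prod od C A B a b)"
  unfolding super_prod_def sgn1_sc using assms by (intro pres_sum pres_mult pres_sc) auto

lemma pres_e:
  assumes a: "a \<in> {1..m + n}"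
  shows "pres (S.e l a b)"
proof (rule pres_site[OF a, where \<zeta> = "\<lambda>_. 1" and b = b])
  show "y \<in> Y0 \<Longrightarrow> app (S.e l a b) y \<in> Y0" for y by (rule grad_Y0[OF grad_e[OF a]])
  fix x v assume xv: "x \<in> carrier M" "v \<in> carrier V"
  have "W.eqv (\<beta> (ten x (unit_op m l a b v))) (dl x (unit_op m l a b v))"
    using xv a by (intro \<beta>_ten unit_op_V)
  moreover have "W.eqv (dl x (unit_op m l a b v)) (\<Sum>k\<in>{1..l}. dl (hact x 1) (unit_at m a b k v))"
    unfolding unit_op_def hact_one[OF xv(1)] using xv a by (intro dl_sum unit_at_V)
  ultimately show "W.eqv (\<beta> (app (S.e l a b) (ten x v))) (\<Sum>k\<in>{1..l}. dl (hact x 1) (unit_at m a b k v))"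
    unfolding e_ten[OF xv] by (rule W.eqv_trans)
qed (simp_all add: free_algebra_one)

lemma T_J: "S.T l a b = S.J l a b - sc (lam / 2) * super_prod od {1..m + n} (S.e l) (S.e l) a b + sc (lam / 2) * (S.\<tau> * S.e l a b)"
  by (simp add: S.J_def)

lemma grad_J: "a \<in> {1..m + n} \<Longrightarrow> grad (par m a + par m b) (S.J r a b)"
  unfolding S.J_def \<tau>_sc
  by (intro grad_add grad_diff grad_sc_mult grad_T grad_super_prod grad_e) auto

lemma pres_J:
  assumes a: "a \<in> {1..m + n}"
  shows "pres (S.J l a b)"
  by (rule pres_site[OF a, where \<zeta> = zt and b = b]) (rule grad_Y0[OF grad_J[OF a]], assumption,
    rule J_ten, assumption, assumption, rule a, erule zt_HC, erule (2) swap_zt)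

text \<open>The summands u_k E_ab^(k) of \<open>S.T\<close> need not descend one by one.
  \<open>S.T\<close> is therefore rewritten by \<open>T_J\<close> in terms of J and
  \<open>e\<close>, which are known to descend.\<close>

lemma pres_G: "a \<in> {1..m + n} \<Longrightarrow> pres (S.G l i a b)"
  unfolding S.G_def T_J h2 \<sigma>_sc \<tau>_sc
  by (intro pres_add pres_diff pres_sc_mult pres_J pres_super_prod pres_e) (auto simp: S.below_def)

section \<open>The images of the generators and the defining relations\<close>

primrec img :: "yangian_gen \<Rightarrow> ('m \<times> nat list) lop" where
  "img (Xgen e i r) = (if r = 0 then S.x0 l e i else S.x1 l e i)"
| "img (Hgen i r) = (if r = 0 then S.h0 l i else S.h1 l i)"

lemma index_mem: "i \<in> {1..m + n - 1} \<Longrightarrow> i \<in> {1..m + n}" "i \<in> {1..m + n - 1} \<Longrightarrow> Suc i \<in> {1..m + n}"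
  by auto

lemma pres_img: "g \<in> yangian_gens m n \<Longrightarrow> pres (img g)"
proof -
  have "pres (S.x0 l e i)" "pres (S.x1 l e i)" "pres (S.h0 l i)" "pres (S.h1 l i)" if "i \<in> {1..m + n - 1}" for e i
    unfolding S.x0_def S.x1_def S.h0_def S.h1_def S.ht_def sgn1_sc
    using index_mem[OF that]
    by (auto intro!: pres_add pres_diff pres_mult pres_sc pres_e pres_G split: pm.split simp del: atLeastAtMost_iff)
  then show "g \<in> yangian_gens m n \<Longrightarrow> pres (img g)" by (auto simp: yangian_gens_def)
qed

lemma grad_img: "g \<in> yangian_gens m n \<Longrightarrow> grad (gen_par m g) (img g)"
proof -
  have x: "grad (if i = m then 1 else 0) (S.x0 l e i)" "grad (if i = m then 1 else 0) (S.x1 l e i)"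
    and h: "grad 0 (S.h0 l i)" "grad 0 (S.h1 l i)"
    if "i \<in> {1..m + n - 1}" for e i
  proof -
    note i = index_mem[OF that]
    have X: "grad (if i = m then 1 else 0) S" if "grad (par m i + par m (Suc i)) S \<or> grad (par m (Suc i) + par m i) S" for S
      using that by (auto elim!: grad_cong simp: par_def)
    show "grad (if i = m then 1 else 0) (S.x0 l e i)" "grad (if i = m then 1 else 0) (S.x1 l e i)"
      using i by (intro X; cases e; simp add: S.x0_def S.x1_def sgn1_sc grad_sc_mult grad_e grad_G del: atLeastAtMost_iff)+
    have E: "grad 0 (S.e l a a)" "grad 0 (S.G l j a a)" if "a \<in> {1..m + n}" for a j
      using grad_cong[OF grad_e[OF that]] grad_cong[OF grad_G[OF that]] by auto
    have E2: "grad 0 (S.e l a a * S.e l a a)" if "a \<in> {1..m + n}" for a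
      using grad_mult[OF E(1) E(1)] that by fastforce
    show h0: "grad 0 (S.h0 l i)"
      unfolding S.h0_def sgn1_sc using i by (intro grad_diff grad_sc_mult E)
    have "grad 0 (S.h0 l i * S.h0 l i)" using grad_mult[OF h0 h0] by simp
    then show "grad 0 (S.h1 l i)"
      unfolding S.h1_def S.ht_def sgn1_sc using i by (intro grad_add grad_diff grad_sc_mult E E2)
  qed
  show "g \<in> yangian_gens m n \<Longrightarrow> grad (gen_par m g) (img g)"
    unfolding yangian_gens_def using x h by (auto simp del: atLeastAtMost_iff)
qed

abbreviation "YC \<equiv> carrier (free_algebra (yangian_gens m n))"
abbreviation "ae \<equiv> aeval img"

lemma pres_ae: "f \<in> YC \<Longrightarrow> pres (ae f)"
  by (induction f rule: free_algebra_induct)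
    (simp_all add: aeval_simps pres_one pres_add pres_mult pres_sc pres_img)

lemma grad_ae:
  assumes "f \<in> YC" "homog m p f"
  shows "grad p (ae f)"
  unfolding aeval_def
proof (rule grad_sum)
  fix w assume w: "w \<in> Poly_Mapping.keys f"
  then have "set (letters w) \<subseteq> yangian_gens m n" using assms(1) by (auto simp: free_algebra_def)
  then have "grad (sum_list (map (gen_par m) gs)) (prod_list (map img gs))" if "gs = letters w" for gs
    unfolding that[symmetric]
    by (induction gs) (auto simp: grad_one intro!: grad_mult grad_img)
  then have "grad (word_par m w) (prod_list (map img (letters w)))" by (simp add: word_par_def)
  then show "grad p (sc (Poly_Mapping.lookup f w) * prod_list (map img (letters w)))"
    using assms(2) w by (intro grad_sc_mult) (auto simp: homog_def elim: grad_cong)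
qed

lemma ae_super_comm:
  assumes "homog m p f" "homog m q g"
  shows "ae (super_comm m f g) = S.brp (odd p) (odd q) (ae f) (ae g)"
  unfolding super_comm_homog[OF assms] S.brp_def
  by (simp add: aeval_simps minus_one_power_iff sc_minus sc_1)

lemma ae_gens: "ae (X_elt e i 0) = S.x0 l e i" "ae (X_elt e i 1) = S.x1 l e i"
  "ae (H_elt i 0) = S.h0 l i" "ae (H_elt i 1) = S.h1 l i"
  by (simp_all add: X_elt_def H_elt_def aeval_gen)

lemma ae_H_tilde: "ae (H_tilde lam i) = S.ht l i"
  by (simp add: H_tilde_def aeval_simps ae_gens S.h1_def del: One_nat_def)

lemma homog_H_tilde: "homog m 0 (H_tilde lam i)"
  unfolding H_tilde_def using homog_mult[OF homog_H[of m i 0] homog_H[of m i 0]]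
  by (intro homog_diff homog_scale homog_H) simp

lemma q_odd: "odd (if i = m then 1 else 0 :: nat) = (od i \<noteq> od (Suc i))"
  by auto

lemma ae_X_X: "ae (super_comm m (X_elt e i r) (X_elt e' j r')) = S.brp (od i \<noteq> od (Suc i)) (od j \<noteq> od (Suc j)) (ae (X_elt e i r)) (ae (X_elt e' j r'))"
  using ae_super_comm[OF homog_X homog_X] by (simp only: q_odd)

lemma ae_even: "homog m 0 f \<Longrightarrow> homog m p g \<Longrightarrow> ae (super_comm m f g) = ae f * ae g - ae g * ae f"
  by (simp add: ae_super_comm S.brp_def)

lemma car_sc: "S.car i j = sc (of_int (cartan m i j))"
  unfolding S.car_def cartan_def by (auto simp: sgn1_sc sg_def sc_add sc_minus sc_0 One_nat_def)

lemma psgn_sc: "S.psgn e = sc (pm_sign e)"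
  by (cases e) (simp_all add: S.psgn_def sc_minus sc_1)

lemma aeval_rels:
  assumes mn: "2 \<le> m" "2 \<le> n" and r: "r \<in> yangian_rels m n lam"
  shows "ae r = 0"
proof -
  note I = index_mem
  have d: "sc (if i = j then 1 else 0) = (if i = j then 1 else 0 :: ('m \<times> nat list) lop)" for i j :: nat
    by (simp add: sc_1 sc_0)
  have 1: "ae (super_comm m (H_elt i r) (H_elt j s)) = 0"
    if "i \<in> {1..m + n - 1}" "j \<in> {1..m + n - 1}" "r \<in> {0, 1}" "s \<in> {0, 1}" for i j r s
    unfolding ae_even[OF homog_H homog_H]
    using that(3,4) S.h0_h0[OF I[OF that(1)] I[OF that(2)], of l] S.h0_h1[OF I[OF that(1)] I[OF that(2)], of l]
      S.h0_h1[OF I[OF that(2)] I[OF that(1)], of l] S.h1_h1[OF I[OF that(1)] I[OF that(2)], of l]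
    by (auto simp: ae_gens simp del: One_nat_def)
  have 2: "ae (super_comm m (X_elt Plus i 0) (X_elt Minus j 0) - (if i = j then 1 else 0) *\<^sub>C H_elt i 0) = 0"
      "ae (super_comm m (X_elt Plus i 1) (X_elt Minus j 0) - (if i = j then 1 else 0) *\<^sub>C H_elt i 1) = 0"
      "ae (super_comm m (X_elt Plus i 0) (X_elt Minus j 1) - (if i = j then 1 else 0) *\<^sub>C H_elt i 1) = 0"
    if "i \<in> {1..m + n - 1}" "j \<in> {1..m + n - 1}" for i j
    unfolding aeval_diff aeval_scale ae_X_X ae_gens d
      S.x0_x0[OF I[OF that(1)] I[OF that(2)]] S.x1_x0[OF I[OF that(1)] I[OF that(2)]] S.x0_x1[OF I[OF that(1)] I[OF that(2)]]
    by simp_all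
  have 5: "ae (super_comm m (H_elt i 0) (X_elt e j r) - (pm_sign e * of_int (cartan m i j)) *\<^sub>C X_elt e j r) = 0"
    if "i \<in> {1..m + n - 1}" "j \<in> {1..m + n - 1}" "r \<in> {0, 1}" for e i j r
    unfolding aeval_diff aeval_scale ae_even[OF homog_H homog_X] sc_mult car_sc[symmetric] psgn_sc[symmetric]
    using that(3) S.h0_x0[OF I[OF that(1)] I[OF that(2)], of l e] S.h0_x1[OF I[OF that(1)] I[OF that(2)], of l e]
    by (auto simp: ae_gens simp del: One_nat_def)
  have 6: "ae (super_comm m (H_tilde lam i) (X_elt e j 0) - (pm_sign e * of_int (cartan m i j)) *\<^sub>C X_elt e j 1) = 0"
    if "i \<in> {1..m + n - 1}" "j \<in> {1..m + n - 1}" for e i j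
    unfolding aeval_diff aeval_scale ae_even[OF homog_H_tilde homog_X] sc_mult car_sc[symmetric] psgn_sc[symmetric]
      ae_H_tilde ae_gens S.ht_x0[OF I[OF that(1)] I[OF that(2)]] by simp
  have 7: "ae (super_comm m (X_elt e i 1) (X_elt e j 0) - super_comm m (X_elt e i 0) (X_elt e j 1)
          - (pm_sign e * lam * of_int (cartan m i j) / 2) *\<^sub>C (X_elt e i 0 * X_elt e j 0 + X_elt e j 0 * X_elt e i 0)) = 0"
    if "i \<in> {1..m + n - 1}" "j \<in> {1..m + n - 1}" for e i j
  proof -
    have c: "pm_sign e * lam * of_int (cartan m i j) / 2 = pm_sign e * (lam / 2) * of_int (cartan m i j)" by simp
    \<comment> \<open>Node m is the only odd one, so two odd nodes coincide.\<close>
    have "i = j \<or> \<not> ((od i \<noteq> od (Suc i)) \<and> (od j \<noteq> od (Suc j)))" by auto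
    from S.x1_x0_same[OF I[OF that(1)] I[OF that(2)] this, of l e] show ?thesis
      unfolding c aeval_diff aeval_scale aeval_add aeval_mult ae_X_X ae_gens sc_mult car_sc[symmetric] psgn_sc[symmetric]
      by simp
  qed
  have 8: "ae ((super_comm m (X_elt e i 0) ^^ (1 + nat \<bar>cartan m i j\<bar>)) (X_elt e j 0)) = 0"
    if "i \<in> {1..m + n - 1}" "j \<in> {1..m + n - 1}" "i \<noteq> j" for e i j
  proof (cases "i = Suc j \<or> j = Suc i")
    case True
    \<comment> \<open>The Cartan entries between neighbours are signs, also next to the odd node, so
      the bracket is iterated twice.\<close>
    then have c: "1 + nat \<bar>cartan m i j\<bar> = Suc (Suc 0)" using that(3) by (auto simp: cartan_def power_abs)
    have "ae (super_comm m (X_elt e i 0) (super_comm m (X_elt e i 0) (X_elt e j 0))) =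
      S.brp (od i \<noteq> od (Suc i)) ((od i \<noteq> od (Suc i)) \<noteq> (od j \<noteq> od (Suc j))) (S.x0 l e i) (ae (super_comm m (X_elt e i 0) (X_elt e j 0)))"
      unfolding ae_super_comm[OF homog_X homog_super_comm[OF homog_X homog_X]] odd_add q_odd ae_gens ..
    also have "\<dots> = 0"
      unfolding ae_X_X ae_gens using S.x0_serre1[OF I[OF that(1)] I[OF that(2)] True] .
    finally show ?thesis unfolding c by simp
  next
    case False
    then have c: "1 + nat \<bar>cartan m i j\<bar> = Suc 0" using that(3) by (auto simp: cartan_def)
    show ?thesis unfolding c using S.x0_serre0[OF I[OF that(1)] I[OF that(2)] that(3)] False by (simp add: ae_X_X ae_gens)
  qed
  \<comment> \<open>The quartic relation involves the four indices from m - 1 to m + 2, which is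
    where both bounds on m and n enter.\<close>
  have m: "m \<in> {1..m + n}" "Suc m \<in> {1..m + n}" "m - 1 \<in> {1..m + n}" "Suc (m - 1) = m" "Suc (Suc m) \<in> {1..m + n}" using mn by auto
  have 9: "ae (super_comm m (X_elt e m 0) (X_elt e m 0)) = 0" for e
    unfolding ae_X_X ae_gens by (rule S.x0_odd[OF m(1,2)])
  have 10: "ae (super_comm m (super_comm m (X_elt e (m - 1) 0) (X_elt e m 0)) (super_comm m (X_elt e m 0) (X_elt e (m + 1) 0))) = 0" for e
    using S.x0_quartic[of "m - 1" l e] m
    unfolding ae_super_comm[OF homog_super_comm[OF homog_X homog_X] homog_super_comm[OF homog_X homog_X]] odd_add q_odd ae_X_X ae_gens
    by (simp only: Suc_eq_plus1[symmetric] m(4))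
  show ?thesis
    using r unfolding yangian_rels_def Let_def
    apply (elim UnE CollectE exE conjE; (hypsubst)?)
    subgoal using 1 by blast
    subgoal using 2(1) by blast
    subgoal using 2(2) by blast
    subgoal using 2(3) by blast
    subgoal using 5 by blast
    subgoal using 6 by blast
    subgoal using 7 by blast
    subgoal using 8 by blast
    subgoal using 9 by blast
    subgoal using 10 by blast
    done
qed

end

section \<open>Root vectors and the generators \<open>J\<close>\<close>

text \<open>Kept general because it serves two sets: the free algebra on the given generators, and
  the set of elements on which two actions agree.\<close>

definition subalg :: "'g free set \<Rightarrow> bool" where
  "subalg A \<longleftrightarrow> A \<noteq> {} \<and> (\<forall>f\<in>A. \<forall>g\<in>A. f + g \<in> A \<and> f * g \<in> A) \<and> (\<forall>c. \<forall>f\<in>A. c *\<^sub>C f \<in> A)"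

lemma subalgD:
  assumes "subalg A"
  shows "f \<in> A \<Longrightarrow> g \<in> A \<Longrightarrow> f + g \<in> A" "f \<in> A \<Longrightarrow> g \<in> A \<Longrightarrow> f * g \<in> A" "f \<in> A \<Longrightarrow> c *\<^sub>C f \<in> A"
    "f \<in> A \<Longrightarrow> g \<in> A \<Longrightarrow> f - g \<in> A" "f \<in> A \<Longrightarrow> - f \<in> A" "0 \<in> A"
proof -
  show add: "f \<in> A \<Longrightarrow> g \<in> A \<Longrightarrow> f + g \<in> A" for f g using assms by (simp add: subalg_def)
  show "f \<in> A \<Longrightarrow> g \<in> A \<Longrightarrow> f * g \<in> A" using assms by (simp add: subalg_def)
  show sc: "f \<in> A \<Longrightarrow> c *\<^sub>C f \<in> A" for f c using assms by (simp add: subalg_def)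
  show neg: "f \<in> A \<Longrightarrow> - f \<in> A" for f using sc[of f "-1"] by (simp add: scale_minus_one)
  show "f \<in> A \<Longrightarrow> g \<in> A \<Longrightarrow> f - g \<in> A" using add[of f "- g"] neg by simp
  obtain x where "x \<in> A" using assms by (auto simp: subalg_def)
  then show "0 \<in> A" using sc[of x 0] by simp
qed

lemma subalg_sum: "subalg A \<Longrightarrow> (\<And>x. x \<in> S \<Longrightarrow> f x \<in> A) \<Longrightarrow> (\<Sum>x\<in>S. f x) \<in> A"
  by (induction S rule: infinite_finite_induct) (auto intro: subalgD)

lemma subalg_super_comm: "subalg A \<Longrightarrow> homog m p f \<Longrightarrow> homog m q g \<Longrightarrow> f \<in> A \<Longrightarrow> g \<in> A \<Longrightarrow> super_comm m f g \<in> A"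
  by (simp add: super_comm_homog subalgD)

definition ppar :: "nat \<Rightarrow> nat \<Rightarrow> nat \<Rightarrow> nat" where "ppar m i k = (if (m < i) \<noteq> (m < k) then 1 else 0)"

lemma homog_root_up: "homog m (ppar m i (i + d + 1)) (root_up m i d)"
proof (induction d)
  case 0 show ?case using homog_X[of m i Plus 0] by (rule_tac homog_cong) (auto simp: ppar_def)
next
  case (Suc d)
  show ?case unfolding root_up.simps
    by (rule homog_cong[OF homog_super_comm[OF Suc homog_X]]) (auto simp: ppar_def)
qed

lemma homog_root_down: "homog m (ppar m i (i + d + 1)) (root_down m i d)"
proof (induction d)
  case 0 show ?case using homog_scale[OF homog_X[of m i Minus 0]] by (rule_tac homog_cong) (auto simp: ppar_def)
next
  case (Suc d)
  show ?case unfolding root_down.simps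
    by (rule homog_cong[OF homog_super_comm[OF homog_scale[OF homog_X] Suc]]) (auto simp: ppar_def)
qed

lemma E_img_subalg:
  assumes A: "subalg A" and X: "\<And>e i. i \<in> {1..N - 1} \<Longrightarrow> X_elt e i 0 \<in> A"
    and "i \<in> {1..N}" "k \<in> {1..N}" "i \<noteq> k"
  shows "E_img m i k \<in> A"
proof -
  have up: "1 \<le> j \<Longrightarrow> j + d + 1 \<le> N \<Longrightarrow> root_up m j d \<in> A" for j d
  proof (induction d)
    case 0 then show ?case using X[of j Plus] by simp
  next
    case (Suc d)
    then show ?case unfolding root_up.simps
      by (intro subalg_super_comm[OF A homog_root_up homog_X] X) auto
  qed
  have down: "1 \<le> j \<Longrightarrow> j + d + 1 \<le> N \<Longrightarrow> root_down m j d \<in> A" for j d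
  proof (induction d)
    case 0 then show ?case using X[of j Minus] by (auto intro: subalgD[OF A])
  next
    case (Suc d)
    then show ?case unfolding root_down.simps
      by (intro subalg_super_comm[OF A homog_scale[OF homog_X] homog_root_down] subalgD(3)[OF A] X) auto
  qed
  show ?thesis using assms(3-5) up[of i "k - i - 1"] down[of k "i - k - 1"] by (auto simp: E_img_def)
qed

lemma theta_subalg:
  assumes A: "subalg A" and X: "\<And>e i. i \<in> {1..m + n - 1} \<Longrightarrow> X_elt e i 0 \<in> A"
    and H: "\<And>i. i \<in> {1..m + n - 1} \<Longrightarrow> H_elt i 0 \<in> A" and i: "i \<in> {1..m + n - 1}"
  shows "theta m n i \<in> A" "varpi_plus m n i \<in> A" "varpi_minus m n i \<in> A"
proof -
  have i': "i \<in> {1..m + n}" "i + 1 \<in> {1..m + n}" using i by auto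
  note E = E_img_subalg[OF A X]
  show "theta m n i \<in> A" unfolding theta_def
    by (intro subalgD(1-4)[OF A] subalg_sum[OF A] E H i) (use i' in auto)
  show "varpi_plus m n i \<in> A" unfolding varpi_plus_def
    by (intro subalgD(1-4)[OF A] subalg_sum[OF A] E H X i) (use i' in auto)
  show "varpi_minus m n i \<in> A" unfolding varpi_minus_def
    by (intro subalgD(1-4)[OF A] subalg_sum[OF A] E H X i) (use i' in auto)
qed

context sw_setup
begin

lemma odd_ppar: "odd (ppar m i k) = (od i \<noteq> od k)" by (simp add: ppar_def)

text \<open>Each step brackets two units with one matching index. The second correction in
  \<open>brp_gl\<close> would require the outer indices to be equal.\<close>

lemma ae_root_up: "1 \<le> i \<Longrightarrow> i + d + 1 \<le> m + n \<Longrightarrow> ae (root_up m i d) = S.e l i (i + d + 1)"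
proof (induction d)
  case 0 then show ?case by (simp add: ae_gens S.x0_def One_nat_def)
next
  case (Suc d)
  define k where "k = i + d + 1"
  have k: "i \<in> {1..m + n}" "k \<in> {1..m + n}" "i \<noteq> Suc k" using Suc.prems by (auto simp: k_def)
  have IH: "ae (root_up m i d) = S.e l i k" using Suc by (simp add: k_def)
  have "ae (root_up m i (Suc d)) = S.brp (od i \<noteq> od k) (od k \<noteq> od (Suc k)) (S.e l i k) (S.e l k (Suc k))"
    unfolding root_up.simps ae_super_comm[OF homog_root_up homog_X] odd_ppar q_odd k_def[symmetric] IH ae_gens S.x0_def pm.case ..
  also have "\<dots> = S.e l i (Suc k)" unfolding S.brp_gl[OF k(1,2)] using k(3) by simp
  finally show ?case by (simp add: k_def)
qed

lemma sgn1_sq: "sc (sg m i) * (sgn1 od i * x) = (x :: ('m \<times> nat list) lop)"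
  unfolding sgn1_sc[symmetric] by (rule S.s_sq)

text \<open>The sign attached to each lowering generator in \<open>root_down\<close> cancels the one
  in \<open>x0\<close>, leaving plain matrix units.\<close>

lemma ae_root_down: "1 \<le> i \<Longrightarrow> i + d + 1 \<le> m + n \<Longrightarrow> ae (root_down m i d) = S.e l (i + d + 1) i"
proof (induction d)
  case 0 then show ?case by (simp add: aeval_scale ae_gens S.x0_def sgn1_sq One_nat_def)
next
  case (Suc d)
  define k where "k = i + d + 1"
  have k: "i \<in> {1..m + n}" "k \<in> {1..m + n}" "Suc k \<in> {1..m + n}" "i \<noteq> Suc k" using Suc.prems by (auto simp: k_def)
  have IH: "ae (root_down m i d) = S.e l k i" using Suc by (simp add: k_def)
  have "ae (root_down m i (Suc d)) = S.brp (od k \<noteq> od (Suc k)) (od i \<noteq> od k) (S.e l (Suc k) k) (S.e l k i)"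
    unfolding root_down.simps ae_super_comm[OF homog_scale[OF homog_X] homog_root_down] odd_ppar q_odd k_def[symmetric] IH
      aeval_scale ae_gens S.x0_def pm.case sgn1_sq ..
  also have "\<dots> = S.brp (od (Suc k) \<noteq> od k) (od k \<noteq> od i) (S.e l (Suc k) k) (S.e l k i)"
    by (simp only: neq_commute[of "od i"] neq_commute[of "od k" "od (Suc k)"])
  also have "\<dots> = S.e l (Suc k) i" unfolding S.brp_gl[OF k(3,2)] using k(4) by simp
  finally show ?case by (simp add: k_def)
qed

lemma ae_E_img: "i \<in> {1..m + n} \<Longrightarrow> k \<in> {1..m + n} \<Longrightarrow> i \<noteq> k \<Longrightarrow> ae (E_img m i k) = S.e l i k"
  using ae_root_up[of i "k - i - 1"] ae_root_down[of k "i - k - 1"] by (auto simp: E_img_def)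

lemma lam_half: "sc lam * (sc (c / 2) * x) = sc (lam / 2) * (sc c * (x :: ('m \<times> nat list) lop))"
  by (simp add: mult.assoc[symmetric] sc_mult[symmetric])

lemma upper_sc: "i \<in> {1..m + n - 1} \<Longrightarrow> (\<Sum>k\<in>S.above i. sgn1 od k) = (sc (upper_sum m n i) :: ('m \<times> nat list) lop)"
  unfolding upper_sum_def sc_sum sgn1_sc by (rule sum.cong) (auto simp: S.above_def)

lemma ksgn_sc': "sgn1 od k * S.ksgn k i = sc (sg m k * isgn k i)"
  by (simp add: sc_mult sgn1_sc ksgn_sc isgn_def)

lemma ae_sum_E:
  assumes "J \<subseteq> {1..m + n}" "a \<in> {1..m + n}" "b \<in> {1..m + n}" "a \<notin> J" "b \<notin> J"
  shows "ae (\<Sum>k\<in>J. (sg m k * isgn k i) *\<^sub>C (E_img m a k * E_img m k b)) = (\<Sum>k\<in>J. sgn1 od k * S.ksgn k i * (S.e l a k * S.e l k b))"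
  unfolding aeval_sum aeval_scale aeval_mult ksgn_sc'
proof (rule sum.cong[OF refl])
  fix k assume "k \<in> J"
  then have "k \<in> {1..m + n}" "a \<noteq> k" "k \<noteq> b" using assms by auto
  then show "sc (sg m k * isgn k i) * (ae (E_img m a k) * ae (E_img m k b)) = sc (sg m k * isgn k i) * (S.e l a k * S.e l k b)"
    using assms by (simp add: ae_E_img)
qed

lemma ae_J_plus:
  assumes i: "i \<in> {1..m + n - 1}"
  shows "ae (J_x m n lam Plus i) = S.J l i (Suc i)"
proof -
  note I = index_mem[OF i]
  have E: "ae (\<Sum>k\<in>{1..m + n} - {i, i + 1}. (sg m k * isgn k i) *\<^sub>C (E_img m i k * E_img m k (i + 1)))
     = (\<Sum>k\<in>{1..m + n} - {i, Suc i}. sgn1 od k * S.ksgn k i * (S.e l i k * S.e l k (Suc i)))"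
    unfolding Suc_eq_plus1[symmetric] by (rule ae_sum_E) (use I in auto)
  have "ae (J_x m n lam Plus i) = S.x1 l Plus i + sc (lam / 2) * (- (\<Sum>k\<in>S.above i. sgn1 od k) * S.x0 l Plus i
     + (\<Sum>k\<in>{1..m + n} - {i, Suc i}. sgn1 od k * S.ksgn k i * (S.e l i k * S.e l k (Suc i))) - S.h0 l i * S.x0 l Plus i)"
    unfolding J_x_def pm.case varpi_plus_def aeval_add aeval_diff aeval_scale E aeval_mult ae_gens upper_sc[OF i]
    by (simp add: distrib_left right_diff_distrib lam_half sc_1 sc_minus)
  then show ?thesis unfolding S.J_plus[OF I] .
qed

lemma ae_J_minus:
  assumes i: "i \<in> {1..m + n - 1}"
  shows "ae (J_x m n lam Minus i) = sgn1 od i * S.J l (Suc i) i"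
proof -
  note I = index_mem[OF i]
  have E: "ae (\<Sum>k\<in>{1..m + n} - {i, i + 1}. (sg m k * isgn k i) *\<^sub>C (E_img m (i + 1) k * E_img m k i))
     = (\<Sum>k\<in>{1..m + n} - {i, Suc i}. sgn1 od k * S.ksgn k i * (S.e l (Suc i) k * S.e l k i))"
    unfolding Suc_eq_plus1[symmetric] by (rule ae_sum_E) (use I in auto)
  have "ae (J_x m n lam Minus i) = S.x1 l Minus i + sc (lam / 2) * (- (\<Sum>k\<in>S.above i. sgn1 od k) * S.x0 l Minus i
     + sgn1 od i * (\<Sum>k\<in>{1..m + n} - {i, Suc i}. sgn1 od k * S.ksgn k i * (S.e l (Suc i) k * S.e l k i)) - S.x0 l Minus i * S.h0 l i)"
    unfolding J_x_def pm.case varpi_minus_def aeval_add aeval_diff aeval_scale E aeval_mult ae_gens upper_sc[OF i] sgn1_sc[of i]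
    by (simp add: distrib_left right_diff_distrib lam_half sc_1 sc_minus)
  then show ?thesis unfolding S.J_minus[OF I] .
qed

lemma ae_J_h:
  assumes i: "i \<in> {1..m + n - 1}"
  shows "ae (J_h m n lam i) = sgn1 od i * S.J l i i - sgn1 od (Suc i) * S.J l (Suc i) (Suc i)"
proof -
  note I = index_mem[OF i]
  have E: "ae (\<Sum>k\<in>{1..m + n} - {j}. (sg m k * isgn k j) *\<^sub>C (E_img m j k * E_img m k j))
     = (\<Sum>k\<in>{1..m + n} - {j}. sgn1 od k * S.ksgn k j * (S.e l j k * S.e l k j))" if "j \<in> {1..m + n}" for j
    by (rule ae_sum_E) (use that in auto)
  \<comment> \<open>Since i is at least 1, the range i - 1 + 2 starts at i + 1 and has one index
    more than the range for i.\<close>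
  have u: "(sc (upper_sum m n (i - 1)) :: ('m \<times> nat list) lop) = sgn1 od (Suc i) + (\<Sum>k\<in>S.above i. sgn1 od k)"
  proof -
    have "{i - 1 + 2..m + n} = insert (Suc i) {i + 2..m + n}" using i by auto
    then have "upper_sum m n (i - 1) = sg m (Suc i) + upper_sum m n i" by (simp add: upper_sum_def)
    then show ?thesis unfolding upper_sc[OF i] by (simp add: sc_add sgn1_sc)
  qed
  have "ae (J_h m n lam i) = S.ht l i + sc (lam / 2) * (- sc (upper_sum m n (i - 1)) * S.h0 l i
     + sgn1 od i * (\<Sum>k\<in>{1..m + n} - {i}. sgn1 od k * S.ksgn k i * (S.e l i k * S.e l k i))
     - sgn1 od (Suc i) * (\<Sum>k\<in>{1..m + n} - {Suc i}. sgn1 od k * S.ksgn k (Suc i) * (S.e l (Suc i) k * S.e l k (Suc i))))"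
    unfolding J_h_def theta_def Suc_eq_plus1[symmetric] aeval_add aeval_diff aeval_scale E[OF I(1)] E[OF I(2)] ae_H_tilde ae_gens sgn1_sc[of i] sgn1_sc[of "Suc i"]
    by (simp add: distrib_left right_diff_distrib lam_half sc_minus)
  then show ?thesis unfolding u S.J_cartan[OF I] .
qed

end

lemma subalg_free_algebra: "subalg (carrier (free_algebra G))"
proof -
  have "carrier (free_algebra G) \<noteq> {}" using free_algebra_one by blast
  then show ?thesis by (simp add: subalg_def free_algebra_closed)
qed

lemma left_moduleD:
  assumes "left_module A W act"
  shows "a \<in> carrier A \<Longrightarrow> x \<in> carrier W \<Longrightarrow> act a x \<in> carrier W"
    and "a \<in> carrier A \<Longrightarrow> x \<in> carrier W \<Longrightarrow> z \<in> carrier W \<Longrightarrow> act a (x \<oplus>\<^bsub>W\<^esub> z) = act a x \<oplus>\<^bsub>W\<^esub> act a z"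
    and "a \<in> carrier A \<Longrightarrow> b \<in> carrier A \<Longrightarrow> x \<in> carrier W \<Longrightarrow> act (a \<oplus>\<^bsub>A\<^esub> b) x = act a x \<oplus>\<^bsub>W\<^esub> act b x"
    and "a \<in> carrier A \<Longrightarrow> x \<in> carrier W \<Longrightarrow> act a (c \<odot>\<^bsub>W\<^esub> x) = c \<odot>\<^bsub>W\<^esub> act a x"
    and "a \<in> carrier A \<Longrightarrow> x \<in> carrier W \<Longrightarrow> act (c \<odot>\<^bsub>A\<^esub> a) x = c \<odot>\<^bsub>W\<^esub> act a x"
    and "a \<in> carrier A \<Longrightarrow> b \<in> carrier A \<Longrightarrow> x \<in> carrier W \<Longrightarrow> act (a \<otimes>\<^bsub>A\<^esub> b) x = act a (act b x)"
    and "x \<in> carrier W \<Longrightarrow> act \<one>\<^bsub>A\<^esub> x = x"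
  using assms unfolding left_module_def by simp_all

lemma super_comm_closed:
  assumes "f \<in> carrier (free_algebra G)" "g \<in> carrier (free_algebra G)"
  shows "super_comm m f g \<in> carrier (free_algebra G)"
  unfolding super_comm_def
proof (intro free_algebra_sum FA.carrier_scale FA.carrier_diff free_algebra_single)
  fix x y assume "x \<in> Poly_Mapping.keys f" "y \<in> Poly_Mapping.keys g"
  then have "set (letters x) \<subseteq> G" "set (letters y) \<subseteq> G" using assms by (auto simp: free_algebra_def)
  then show "set (letters (x + y)) \<subseteq> G" "set (letters (y + x)) \<subseteq> G" by simp_all
qed

lemma X_elt_closed: "i \<in> {1..m + n - 1} \<Longrightarrow> r \<in> {0, 1} \<Longrightarrow> X_elt e i r \<in> carrier (free_algebra (yangian_gens m n))"
  and H_elt_closed: "i \<in> {1..m + n - 1} \<Longrightarrow> r \<in> {0, 1} \<Longrightarrow> H_elt i r \<in> carrier (free_algebra (yangian_gens m n))"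
  unfolding X_elt_def H_elt_def by (intro free_algebra_gen; simp add: yangian_gens_def)+

lemma yangian_presentation:
  assumes "2 \<le> m" "2 \<le> n"
  shows "presentation (yangian_gens m n) (yangian_rels m n lam)"
proof (rule presentation.intro, rule subsetI)
  let ?C = "carrier (free_algebra (yangian_gens m n))"
  have X: "X_elt e i 0 \<in> ?C" "X_elt e i 1 \<in> ?C" "H_elt i 0 \<in> ?C" "H_elt i 1 \<in> ?C" if "i \<in> {1..m + n - 1}" for e i
    using that by (intro X_elt_closed H_elt_closed; simp)+
  have XH: "X_elt e i r \<in> ?C" "H_elt i r \<in> ?C" if "i \<in> {1..m + n - 1}" "r \<in> {0, 1}" for e i r
    using that by (intro X_elt_closed H_elt_closed; simp)+
  have T: "H_tilde lam i \<in> ?C" if "i \<in> {1..m + n - 1}" for i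
    unfolding H_tilde_def using X[OF that] by (intro free_algebra_closed)
  have P: "(super_comm m f ^^ k) g \<in> ?C" if "f \<in> ?C" "g \<in> ?C" for f g k
    using that by (induction k) (auto intro: super_comm_closed)
  have m: "m \<in> {1..m + n - 1}" "m - 1 \<in> {1..m + n - 1}" "m + 1 \<in> {1..m + n - 1}" using assms by auto
  fix r assume "r \<in> yangian_rels m n lam"
  then show "r \<in> ?C"
    unfolding yangian_rels_def Let_def
    apply (elim UnE CollectE exE conjE; (hypsubst)?)
    subgoal by (intro super_comm_closed XH)
    subgoal by (intro FA.carrier_diff FA.carrier_scale super_comm_closed X)
    subgoal by (intro FA.carrier_diff FA.carrier_scale super_comm_closed X)
    subgoal by (intro FA.carrier_diff FA.carrier_scale super_comm_closed X)
    subgoal by (intro FA.carrier_diff FA.carrier_scale super_comm_closed XH) simp_all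
    subgoal by (intro FA.carrier_diff FA.carrier_scale super_comm_closed X T)
    subgoal by (intro FA.carrier_diff FA.carrier_scale FA.carrier_add free_algebra_mult super_comm_closed X)
    subgoal by (intro P X)
    subgoal by (intro super_comm_closed X m)
    subgoal by (intro super_comm_closed X m)
    done
qed

section \<open>The action on the balanced product and its uniqueness\<close>

locale yangian_action = sw_setup l lam m n M ract
  for l lam m n and M :: "(complex, 'm) module" and ract +
  assumes m2: "2 \<le> m" and n2: "2 \<le> n"
begin

sublocale Y: presentation "yangian_gens m n" "yangian_rels m n lam"
  by (rule yangian_presentation[OF m2 n2])

abbreviation "A \<equiv> yangian m n lam"
abbreviation "WW \<equiv> sw_space m n l lam M ract"

lemma A_eq: "A = presented_algebra (yangian_gens m n) (yangian_rels m n lam)"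
  by (simp add: yangian_def)

lemma W_eq: "WW = quot FS KS"
  by (simp add: sw_space_def tensor_product_def)

lemma y_eq: "yangian_class m n lam f = Y.cls f"
  by (simp add: yangian_class_def Y.class_eq)

lemma t_eq: "sw_tensor m n l lam M ract x v = W.cls (dl x v)"
  by (simp add: sw_tensor_def pure_tensor_def tensor_class_def W.cls_def dl_def)

lemma z_eq: "ract x (hecke_z l lam k) = hact x (zt k)"
  by (simp add: hact_def hecke_z_def zt_def)

lemma A_ops: "Y.cls f \<oplus>\<^bsub>A\<^esub> Y.cls g = Y.cls (f + g)" "c \<odot>\<^bsub>A\<^esub> Y.cls f = Y.cls (c *\<^sub>C f)" "\<one>\<^bsub>A\<^esub> = Y.cls 1"
  "f \<in> YC \<Longrightarrow> g \<in> YC \<Longrightarrow> Y.cls f \<otimes>\<^bsub>A\<^esub> Y.cls g = Y.cls (f * g)"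
  by (simp_all add: A_eq Y.presented_mult Y.presented_add Y.presented_smult Y.presented_one)

lemma W_ops: "W.cls f' \<oplus>\<^bsub>WW\<^esub> W.cls g' = W.cls (f' + g')" "c \<odot>\<^bsub>WW\<^esub> W.cls f' = W.cls (c *\<^sub>C f')"
  by (simp_all add: W_eq W.quot_add W.quot_smult)

lemma A_carrier: "carrier A = Y.cls ` YC" by (simp add: A_eq Y.presented_carrier)
lemma W_carrier: "carrier WW = W.cls ` carrier FS" by (simp add: W_eq W.quot_carrier)

text \<open>Chosen representatives are evaluated; \<open>act_cls\<close> shows that the choice does
  not matter.\<close>

definition act where
  "act a w = W.cls (\<beta> (app (ae (SOME f. f \<in> YC \<and> Y.cls f = a)) (\<pi> (SOME g. g \<in> carrier FS \<and> W.cls g = w))))"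

text \<open>Two lifts of an algebra element differ by an element of the relation ideal, which
  evaluates to 0. Two lifts of a vector differ by an element of \<open>KS\<close>, which
  \<open>\<pi>\<close> takes into \<open>KY\<close>, and \<open>KY\<close> is preserved.\<close>

lemma act_cls:
  assumes f: "f \<in> YC" and g: "g \<in> carrier FS"
  shows "act (Y.cls f) (W.cls g) = W.cls (\<beta> (app (ae f) (\<pi> g)))"
proof -
  define f' where "f' = (SOME f'. f' \<in> YC \<and> Y.cls f' = Y.cls f)"
  define g' where "g' = (SOME g'. g' \<in> carrier FS \<and> W.cls g' = W.cls g)"
  have f': "f' \<in> YC \<and> Y.cls f' = Y.cls f" unfolding f'_def by (rule someI[of _ f]) (simp add: f)
  have g': "g' \<in> carrier FS \<and> W.cls g' = W.cls g" unfolding g'_def by (rule someI[of _ g]) (simp add: g)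
  have "ae (f' - f) = 0"
    by (rule Y.aeval_Id) (use f' aeval_rels[OF m2 n2] in \<open>auto simp: Y.cls_eq_iff\<close>)
  then have ff: "ae f' = ae f" by (simp add: aeval_diff)
  have d: "g' - g \<in> KS" "g' - g \<in> carrier FS" using g' W.K_D(1) by (auto simp: W.cls_eq_iff)
  have "W.eqv (\<beta> (\<pi> (g' - g))) 0" using \<beta>_\<pi>[OF d(2)] d(1) W.eqv_0_iff W.eqv_trans by blast
  then have "\<pi> (g' - g) \<in> KY" using \<pi>_Y0[OF d(2)] by (simp add: KY_def W.eqv_0_iff)
  then have "app (ae f) (\<pi> (g' - g)) \<in> KY" using pres_ae[OF f] by (simp add: pres_def)
  then have "\<beta> (app (ae f) (\<pi> g')) - \<beta> (app (ae f) (\<pi> g)) \<in> KS"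
    by (simp add: KY_def is_lin_diff lin is_lin_app)
  then have "W.cls (\<beta> (app (ae f) (\<pi> g'))) = W.cls (\<beta> (app (ae f) (\<pi> g)))" by (simp add: W.cls_eq_iff)
  then show ?thesis unfolding act_def f'_def[symmetric] g'_def[symmetric] ff .
qed

lemma act_FS: "f \<in> YC \<Longrightarrow> g \<in> carrier FS \<Longrightarrow> \<beta> (app (ae f) (\<pi> g)) \<in> carrier FS"
  using pres_ae \<pi>_Y0 by (intro \<beta>_FS) (auto simp: pres_def)

lemma W_module: "module complex_ring WW" unfolding W_eq by (rule W.quot_module)

lemma act_left_module: "left_module A WW act"
  unfolding left_module_def
proof (intro conjI ballI allI)
  show "module complex_ring WW" by (rule W_module)
next
  fix a x assume "a \<in> carrier A" "x \<in> carrier WW"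
  then show "act a x \<in> carrier WW" by (auto simp: A_carrier W_carrier act_cls act_FS)
next
  fix a x y assume "a \<in> carrier A" "x \<in> carrier WW" "y \<in> carrier WW"
  then show "act a (x \<oplus>\<^bsub>WW\<^esub> y) = act a x \<oplus>\<^bsub>WW\<^esub> act a y"
    by (auto simp: A_carrier W_carrier W_ops act_cls W.carrier_add is_linD lin is_lin_app)
next
  fix a b x assume "a \<in> carrier A" "b \<in> carrier A" "x \<in> carrier WW"
  then show "act (a \<oplus>\<^bsub>A\<^esub> b) x = act a x \<oplus>\<^bsub>WW\<^esub> act b x"
    by (auto simp: A_carrier W_carrier W_ops A_ops act_cls FA.carrier_add is_linD lin aeval_add)
next
  fix c a x assume "a \<in> carrier A" "x \<in> carrier WW"
  then show "act a (c \<odot>\<^bsub>WW\<^esub> x) = c \<odot>\<^bsub>WW\<^esub> act a x" "act (c \<odot>\<^bsub>A\<^esub> a) x = c \<odot>\<^bsub>WW\<^esub> act a x"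
    by (auto simp: A_carrier W_carrier W_ops A_ops act_cls FA.carrier_scale W.carrier_scale is_linD lin is_lin_app aeval_scale)
next
  fix a b x assume "a \<in> carrier A" "b \<in> carrier A" "x \<in> carrier WW"
  then show "act (a \<otimes>\<^bsub>A\<^esub> b) x = act a (act b x)"
    by (auto simp: A_carrier W_carrier A_ops act_cls free_algebra_mult act_FS \<pi>_\<beta> aeval_mult)
next
  fix x assume "x \<in> carrier WW"
  then show "act \<one>\<^bsub>A\<^esub> x = x"
    using \<beta>_\<pi> by (auto simp: W_carrier A_ops act_cls free_algebra_one aeval_1 W.eqv_iff)
qed

text \<open>Both \<open>\<pi>\<close> and \<open>\<beta>\<close> keep the parity of the word, so the
  parity of the operator decides.\<close>

lemma act_super:
  assumes "a \<in> yangian_part m n lam p" "x \<in> sw_part m n l lam M ract q"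
  shows "act a x \<in> sw_part m n l lam M ract (p + q)"
proof -
  obtain f where f: "a = Y.cls f" "f \<in> YC" "homog m p f"
    using assms(1) by (auto simp: yangian_part_def y_eq homog_def)
  have tc: "tensor_class M V bal g = W.cls g" for g by (simp add: tensor_class_def W.cls_def)
  obtain g where g: "x = W.cls g" "Poly_Mapping.keys g \<subseteq> carrier M \<times> tensor_power_part m n l q"
    using assms(2) by (auto simp: sw_part_def tc)
  have gF: "g \<in> carrier FS" using g(2) by (auto simp: free_space_def tensor_power_part_def)
  have "\<pi> g \<in> Yp q"
    unfolding Yp_def mem_Collect_eq \<pi>_def
  proof (rule keys_lin_ext_subset)
    fix k assume "k \<in> Poly_Mapping.keys g"
    then obtain y v where k: "k = (y, v)" "y \<in> carrier M" "v \<in> tensor_power_part m n l q" using g(2) by blast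
    show "Poly_Mapping.keys (case k of (x, v) \<Rightarrow> ten x v) \<subseteq> carrier M \<times> {w \<in> tensor_words m n l. sum_list (map (par m) w) mod 2 = q mod 2}"
      unfolding k prod.case ten_def
      by (rule keys_lin_ext_subset) (use k in \<open>auto simp: tensor_power_part_def carrier_V\<close>)
  qed
  then have "app (ae f) (\<pi> g) \<in> Yp (p + q)"
    using grad_ae[OF f(2,3)] unfolding grad_def by (metis add.commute)
  then have "Poly_Mapping.keys (\<beta> (app (ae f) (\<pi> g))) \<subseteq> carrier M \<times> tensor_power_part m n l (p + q)"
    unfolding \<beta>_def Yp_def
    by (intro keys_lin_ext_subset) (auto simp: dl_def keys_single tensor_power_part_def intro!: single_V)
  then show ?thesis
    unfolding f(1) g(1) act_cls[OF f(2) gF] sw_part_def tc by blast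
qed

lemma act_ten: "f \<in> YC \<Longrightarrow> x \<in> carrier M \<Longrightarrow> v \<in> carrier V \<Longrightarrow> W.eqv (\<beta> (app (ae f) (ten x v))) g \<Longrightarrow>
    act (Y.cls f) (W.cls (dl x v)) = W.cls g"
  by (simp add: act_cls dl_FS \<pi>_dl W.eqv_iff)

lemma dl_lin:
  assumes "x \<in> carrier M" "u \<in> carrier V" "v \<in> carrier V"
  shows "W.eqv (c *\<^sub>C dl x u - d *\<^sub>C dl x v) (dl x (c *\<^sub>C u - d *\<^sub>C v))"
proof -
  have e: "c *\<^sub>C u - d *\<^sub>C v = c *\<^sub>C u + (- d) *\<^sub>C v" "c *\<^sub>C dl x u - d *\<^sub>C dl x v = c *\<^sub>C dl x u + (- d) *\<^sub>C dl x v"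
    by (simp_all add: scale_minus_left)
  have "W.eqv (dl x (c *\<^sub>C u + (- d) *\<^sub>C v)) (dl x (c *\<^sub>C u) + dl x ((- d) *\<^sub>C v))"
    using assms by (intro dl_add V.carrier_scale)
  moreover have "W.eqv (dl x (c *\<^sub>C u) + dl x ((- d) *\<^sub>C v)) (c *\<^sub>C dl x u + (- d) *\<^sub>C dl x v)"
    using assms by (intro W.eqv_add dl_scale)
  ultimately show ?thesis unfolding e by (rule W.eqv_sym[OF W.eqv_trans])
qed

abbreviation "t \<equiv> sw_tensor m n l lam M ract"
abbreviation "y \<equiv> yangian_class m n lam"

lemma theta_closed:
  assumes i: "i \<in> {1..m + n - 1}"
  shows "theta m n i \<in> YC" "varpi_plus m n i \<in> YC" "varpi_minus m n i \<in> YC"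
  using i by (intro theta_subalg[OF subalg_free_algebra] X_elt_closed H_elt_closed; simp)+

lemma J_closed:
  assumes i: "i \<in> {1..m + n - 1}"
  shows "J_h m n lam i \<in> YC" "J_x m n lam e i \<in> YC"
proof -
  have "H_elt i 0 \<in> YC" "H_elt i 1 \<in> YC" "X_elt e i 1 \<in> YC" for e
    using i by (intro X_elt_closed H_elt_closed; simp)+
  then show "J_h m n lam i \<in> YC" "J_x m n lam e i \<in> YC"
    unfolding J_h_def J_x_def H_tilde_def using theta_closed[OF i]
    by (auto intro!: free_algebra_closed split: pm.split)
qed

context
  fixes i x v
  assumes i: "i \<in> {1..m + n - 1}" and x: "x \<in> carrier M" and v: "v \<in> carrier V"
begin

lemma act_H0: "act (y (H_elt i 0)) (t x v) = t x (sg m i *\<^sub>C unit_op m l i i v - sg m (i + 1) *\<^sub>C unit_op m l (i + 1) (i + 1) v)"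
  unfolding y_eq t_eq Suc_eq_plus1[symmetric]
proof (rule act_ten[OF _ x v])
  show "H_elt i 0 \<in> YC" using i by (rule H_elt_closed) simp
  have "app (ae (H_elt i 0)) (ten x v) = ten x (sg m i *\<^sub>C unit_op m l i i v - sg m (Suc i) *\<^sub>C unit_op m l (Suc i) (Suc i) v)"
    using x v by (simp add: ae_gens S.h0_def sgn1_sc e_ten is_lin_diff is_linD lin)
  then show "W.eqv (\<beta> (app (ae (H_elt i 0)) (ten x v))) (dl x (sg m i *\<^sub>C unit_op m l i i v - sg m (Suc i) *\<^sub>C unit_op m l (Suc i) (Suc i) v))"
    using x v i by (auto intro!: \<beta>_ten V.carrier_diff V.carrier_scale unit_op_V)
qed

lemma act_X0: "act (y (X_elt Plus i 0)) (t x v) = t x (unit_op m l i (i + 1) v)"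
  unfolding y_eq t_eq Suc_eq_plus1[symmetric]
proof (rule act_ten[OF _ x v])
  show "X_elt Plus i 0 \<in> YC" using i by (rule X_elt_closed) simp
  show "W.eqv (\<beta> (app (ae (X_elt Plus i 0)) (ten x v))) (dl x (unit_op m l i (Suc i) v))"
    using x v i by (auto simp: ae_gens S.x0_def e_ten intro!: \<beta>_ten unit_op_V)
qed

lemma act_X0': "act (y (X_elt Minus i 0)) (t x v) = sg m i \<odot>\<^bsub>WW\<^esub> t x (unit_op m l (i + 1) i v)"
  unfolding y_eq t_eq W_ops Suc_eq_plus1[symmetric]
proof (rule act_ten[OF _ x v])
  show "X_elt Minus i 0 \<in> YC" using i by (rule X_elt_closed) simp
  have "\<beta> (app (ae (X_elt Minus i 0)) (ten x v)) = sg m i *\<^sub>C \<beta> (ten x (unit_op m l (Suc i) i v))"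
    using x v by (simp add: ae_gens S.x0_def sgn1_sc e_ten is_linD lin)
  then show "W.eqv (\<beta> (app (ae (X_elt Minus i 0)) (ten x v))) (sg m i *\<^sub>C dl x (unit_op m l (Suc i) i v))"
    using x v i by (auto intro!: W.eqv_scale \<beta>_ten unit_op_V)
qed

lemma t_sum:
  assumes "\<And>k. k \<in> {1..l} \<Longrightarrow> f k \<in> carrier V"
  shows "(\<Oplus>\<^bsub>WW\<^esub>k\<in>{1..l}. t (ract x (hecke_z l lam k)) (f k)) = W.cls (\<Sum>k\<in>{1..l}. dl (hact x (zt k)) (f k))"
  unfolding t_eq z_eq W_eq
  using assms x by (intro W.quot_sum[THEN conjunct1] dl_FS hact_closed zt_HC) auto

lemma act_J_plus: "act (y (J_x m n lam Plus i)) (t x v) = (\<Oplus>\<^bsub>WW\<^esub>k\<in>{1..l}. t (ract x (hecke_z l lam k)) (unit_at m i (i + 1) k v))"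
proof (subst t_sum)
  show "unit_at m i (i + 1) k v \<in> carrier V" for k using i v by (intro unit_at_V) auto
  show "act (y (J_x m n lam Plus i)) (t x v) = W.cls (\<Sum>k\<in>{1..l}. dl (hact x (zt k)) (unit_at m i (i + 1) k v))"
    unfolding y_eq t_eq Suc_eq_plus1[symmetric]
    by (rule act_ten[OF J_closed(2)[OF i] x v]) (use J_ten[OF x v, of i "Suc i"] index_mem[OF i] in \<open>simp add: ae_J_plus[OF i]\<close>)
qed

lemma act_J_minus: "act (y (J_x m n lam Minus i)) (t x v) =
    sg m i \<odot>\<^bsub>WW\<^esub> (\<Oplus>\<^bsub>WW\<^esub>k\<in>{1..l}. t (ract x (hecke_z l lam k)) (unit_at m (i + 1) i k v))"
proof (subst t_sum)
  show "unit_at m (i + 1) i k v \<in> carrier V" for k using i v by (intro unit_at_V) auto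
  have "W.eqv (\<beta> (app (ae (J_x m n lam Minus i)) (ten x v))) (sg m i *\<^sub>C (\<Sum>k\<in>{1..l}. dl (hact x (zt k)) (unit_at m (i + 1) i k v)))"
    unfolding Suc_eq_plus1[symmetric] using W.eqv_scale[OF J_ten[OF x v, of "Suc i" i], of "sg m i"] index_mem[OF i]
    by (simp add: ae_J_minus[OF i] sgn1_sc is_linD lin)
  from act_ten[OF J_closed(2)[OF i] x v this]
  show "act (y (J_x m n lam Minus i)) (t x v) = sg m i \<odot>\<^bsub>WW\<^esub> W.cls (\<Sum>k\<in>{1..l}. dl (hact x (zt k)) (unit_at m (i + 1) i k v))"
    unfolding y_eq t_eq W_eq W.quot_smult .
qed

lemma act_J_h: "act (y (J_h m n lam i)) (t x v) = (\<Oplus>\<^bsub>WW\<^esub>k\<in>{1..l}. t (ract x (hecke_z l lam k))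
     (sg m i *\<^sub>C unit_at m i i k v - sg m (i + 1) *\<^sub>C unit_at m (i + 1) (i + 1) k v))"
proof (subst t_sum)
  have U: "unit_at m i i k v \<in> carrier V" "unit_at m (i + 1) (i + 1) k v \<in> carrier V" for k
    using i v by (intro unit_at_V; auto)+
  then show "sg m i *\<^sub>C unit_at m i i k v - sg m (i + 1) *\<^sub>C unit_at m (i + 1) (i + 1) k v \<in> carrier V" for k
    by (intro V.carrier_diff V.carrier_scale)
  let ?s = "\<lambda>j. \<Sum>k\<in>{1..l}. dl (hact x (zt k)) (unit_at m j j k v)"
  have 1: "W.eqv (\<beta> (app (ae (J_h m n lam i)) (ten x v))) (sg m i *\<^sub>C ?s i - sg m (i + 1) *\<^sub>C ?s (i + 1))"
    unfolding Suc_eq_plus1[symmetric] using W.eqv_diff[OF W.eqv_scale[OF J_ten[OF x v, of i i], of "sg m i"] W.eqv_scale[OF J_ten[OF x v, of "Suc i" "Suc i"], of "sg m (Suc i)"]] index_mem[OF i]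
    by (simp add: ae_J_h[OF i] sgn1_sc is_linD is_lin_diff lin)
  have 2: "sg m i *\<^sub>C ?s i - sg m (i + 1) *\<^sub>C ?s (i + 1) = (\<Sum>k\<in>{1..l}. sg m i *\<^sub>C dl (hact x (zt k)) (unit_at m i i k v)
      - sg m (i + 1) *\<^sub>C dl (hact x (zt k)) (unit_at m (i + 1) (i + 1) k v))"
    by (simp only: scale_sum sum_subtractf)
  have 3: "W.eqv (sg m i *\<^sub>C ?s i - sg m (i + 1) *\<^sub>C ?s (i + 1)) (\<Sum>k\<in>{1..l}. dl (hact x (zt k))
      (sg m i *\<^sub>C unit_at m i i k v - sg m (i + 1) *\<^sub>C unit_at m (i + 1) (i + 1) k v))"
    unfolding 2 by (intro W.eqv_sum dl_lin U hact_closed x zt_HC)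
  show "act (y (J_h m n lam i)) (t x v) = W.cls (\<Sum>k\<in>{1..l}. dl (hact x (zt k))
      (sg m i *\<^sub>C unit_at m i i k v - sg m (i + 1) *\<^sub>C unit_at m (i + 1) (i + 1) k v))"
    unfolding y_eq t_eq by (rule act_ten[OF J_closed(1)[OF i] x v W.eqv_trans[OF 1 3]])
qed

end

text \<open>The elements on which two actions agree form a subalgebra. It contains the generators of
  level 0 and hence theta and varpi, which are polynomials in them; subtracting these from the J
  leaves the generators of level 1.\<close>

lemma action_unique:
  assumes L: "left_module A WW a1" "left_module A WW a2"
    and eq: "\<And>i x v. i \<in> {1..m + n - 1} \<Longrightarrow> x \<in> carrier M \<Longrightarrow> v \<in> carrier V \<Longrightarrow>
      a1 (y (H_elt i 0)) (t x v) = a2 (y (H_elt i 0)) (t x v) \<and>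
      (\<forall>e. a1 (y (X_elt e i 0)) (t x v) = a2 (y (X_elt e i 0)) (t x v)) \<and>
      a1 (y (J_h m n lam i)) (t x v) = a2 (y (J_h m n lam i)) (t x v) \<and>
      (\<forall>e. a1 (y (J_x m n lam e i)) (t x v) = a2 (y (J_x m n lam e i)) (t x v))"
    and "a \<in> carrier A" "w \<in> carrier WW"
  shows "a1 a w = a2 a w"
proof -
  define S where "S = {f \<in> YC. \<forall>w\<in>carrier WW. a1 (Y.cls f) w = a2 (Y.cls f) w}"
  have lm: "b \<in> YC \<Longrightarrow> u \<in> carrier WW \<Longrightarrow> ac (Y.cls b) u \<in> carrier WW"
    "b \<in> YC \<Longrightarrow> c \<in> YC \<Longrightarrow> u \<in> carrier WW \<Longrightarrow> ac (Y.cls (b + c)) u = ac (Y.cls b) u \<oplus>\<^bsub>WW\<^esub> ac (Y.cls c) u"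
    "b \<in> YC \<Longrightarrow> c \<in> YC \<Longrightarrow> u \<in> carrier WW \<Longrightarrow> ac (Y.cls (b * c)) u = ac (Y.cls b) (ac (Y.cls c) u)"
    "b \<in> YC \<Longrightarrow> u \<in> carrier WW \<Longrightarrow> ac (Y.cls (z *\<^sub>C b)) u = z \<odot>\<^bsub>WW\<^esub> ac (Y.cls b) u"
    "u \<in> carrier WW \<Longrightarrow> ac (Y.cls 1) u = u"
    "b \<in> YC \<Longrightarrow> u \<in> carrier WW \<Longrightarrow> u' \<in> carrier WW \<Longrightarrow> ac (Y.cls b) (u \<oplus>\<^bsub>WW\<^esub> u') = ac (Y.cls b) u \<oplus>\<^bsub>WW\<^esub> ac (Y.cls b) u'"
    "b \<in> YC \<Longrightarrow> u \<in> carrier WW \<Longrightarrow> ac (Y.cls b) (z \<odot>\<^bsub>WW\<^esub> u) = z \<odot>\<^bsub>WW\<^esub> ac (Y.cls b) u"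
    if "ac = a1 \<or> ac = a2" for ac b c u u' z
  proof -
    have "left_module A WW ac" using that L by blast
    note D = left_moduleD[OF this]
    have cl: "b \<in> YC \<Longrightarrow> Y.cls b \<in> carrier A" for b by (simp add: A_carrier)
    show "b \<in> YC \<Longrightarrow> u \<in> carrier WW \<Longrightarrow> ac (Y.cls b) u \<in> carrier WW"
      by (rule D(1)[OF cl])
    show "b \<in> YC \<Longrightarrow> c \<in> YC \<Longrightarrow> u \<in> carrier WW \<Longrightarrow> ac (Y.cls (b + c)) u = ac (Y.cls b) u \<oplus>\<^bsub>WW\<^esub> ac (Y.cls c) u"
      using D(3)[OF cl cl] by (simp add: A_ops)
    show "b \<in> YC \<Longrightarrow> c \<in> YC \<Longrightarrow> u \<in> carrier WW \<Longrightarrow> ac (Y.cls (b * c)) u = ac (Y.cls b) (ac (Y.cls c) u)"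
      using D(6)[OF cl cl] by (simp add: A_ops)
    show "b \<in> YC \<Longrightarrow> u \<in> carrier WW \<Longrightarrow> ac (Y.cls (z *\<^sub>C b)) u = z \<odot>\<^bsub>WW\<^esub> ac (Y.cls b) u"
      using D(5)[OF cl] by (simp add: A_ops)
    show "u \<in> carrier WW \<Longrightarrow> ac (Y.cls 1) u = u" using D(7) by (simp add: A_ops)
    show "b \<in> YC \<Longrightarrow> u \<in> carrier WW \<Longrightarrow> u' \<in> carrier WW \<Longrightarrow> ac (Y.cls b) (u \<oplus>\<^bsub>WW\<^esub> u') = ac (Y.cls b) u \<oplus>\<^bsub>WW\<^esub> ac (Y.cls b) u'"
      by (rule D(2)[OF cl])
    show "b \<in> YC \<Longrightarrow> u \<in> carrier WW \<Longrightarrow> ac (Y.cls b) (z \<odot>\<^bsub>WW\<^esub> u) = z \<odot>\<^bsub>WW\<^esub> ac (Y.cls b) u"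
      by (rule D(4)[OF cl])
  qed
  note l1 = lm[OF disjI1[OF refl]] and l2 = lm[OF disjI2[OF refl]]
  have one: "1 \<in> S" by (simp add: S_def free_algebra_one l1 l2)
  then have "S \<noteq> {}" by blast
  then have sub: "subalg S"
    unfolding subalg_def by (auto simp: S_def free_algebra_closed l1 l2)
  \<comment> \<open>Every class is a linear combination of pure tensors, so agreement there
    suffices.\<close>
  have pure: "f \<in> S" if f: "f \<in> YC" and pt: "\<And>x v. x \<in> carrier M \<Longrightarrow> v \<in> carrier V \<Longrightarrow> a1 (y f) (t x v) = a2 (y f) (t x v)" for f
  proof -
    have "a1 (Y.cls f) (W.cls g) = a2 (Y.cls f) (W.cls g)" if g: "g \<in> carrier FS" for g
    proof -
      have "Poly_Mapping.keys g \<subseteq> carrier M \<times> carrier V" using g by (simp add: free_space_def)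
      then show ?thesis
      proof (induction g rule: poly_mapping_span_induct)
        case zero
        \<comment> \<open>The zero class is written as 0 times itself, so that homogeneity of both
          actions settles this case.\<close>
        have z: "W.cls 0 \<in> carrier WW" "W.cls 0 = 0 \<odot>\<^bsub>WW\<^esub> W.cls 0" by (simp_all add: W_carrier W.carrier_zero W_ops)
        have zz: "0 \<odot>\<^bsub>WW\<^esub> u = W.cls 0" if "u \<in> carrier WW" for u using that by (auto simp: W_carrier W_ops)
        have "a1 (Y.cls f) (W.cls 0) = W.cls 0" by (subst z(2)) (simp only: l1(7)[OF f z(1)] zz[OF l1(1)[OF f z(1)]])
        moreover have "a2 (Y.cls f) (W.cls 0) = W.cls 0" by (subst z(2)) (simp only: l2(7)[OF f z(1)] zz[OF l2(1)[OF f z(1)]])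
        ultimately show ?case by simp
      next
        case (add g g')
        then have "g \<in> carrier FS" "g' \<in> carrier FS" by (simp_all add: free_space_def)
        then have "W.cls g \<in> carrier WW" "W.cls g' \<in> carrier WW" "W.cls (g + g') = W.cls g \<oplus>\<^bsub>WW\<^esub> W.cls g'"
          by (simp_all add: W_carrier W_ops)
        with add show ?case by (simp add: l1(6)[OF f] l2(6)[OF f])
      next
        case (single k c)
        then obtain x v where k: "k = (x, v)" "x \<in> carrier M" "v \<in> carrier V" by auto
        have "W.cls (Poly_Mapping.single k c) = c \<odot>\<^bsub>WW\<^esub> W.cls (dl x v)"
          by (simp add: W_ops k dl_def)
        moreover have "W.cls (dl x v) \<in> carrier WW" using k dl_FS by (simp add: W_carrier)
        ultimately show ?case using pt[OF k(2,3)] by (simp add: l1(7)[OF f] l2(7)[OF f] y_eq t_eq)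
      qed
    qed
    then show ?thesis using f by (auto simp: S_def W_carrier)
  qed
  have H0: "H_elt i 0 \<in> S" and X0: "X_elt e i 0 \<in> S" and Jh: "J_h m n lam i \<in> S" and Jx: "J_x m n lam e i \<in> S"
    if "i \<in> {1..m + n - 1}" for e i
    using eq[OF that] J_closed[OF that] that by (auto intro!: pure H_elt_closed X_elt_closed simp del: atLeastAtMost_iff)
  note th = theta_subalg[OF sub X0 H0]
  have X1: "X_elt e i 1 \<in> S" if i: "i \<in> {1..m + n - 1}" for e i
  proof -
    have "X_elt e i 1 = J_x m n lam e i - lam *\<^sub>C (case e of Plus \<Rightarrow> varpi_plus m n i | Minus \<Rightarrow> varpi_minus m n i)"
      by (simp add: J_x_def)
    moreover have "(case e of Plus \<Rightarrow> varpi_plus m n i | Minus \<Rightarrow> varpi_minus m n i) \<in> S"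
      using th(2,3) i by (cases e) simp_all
    ultimately show ?thesis using Jx[OF i] subalgD(3,4)[OF sub] by metis
  qed
  have H1: "H_elt i 1 \<in> S" if i: "i \<in> {1..m + n - 1}" for i
  proof -
    have "H_elt i 1 = J_h m n lam i - lam *\<^sub>C theta m n i + (lam / 2) *\<^sub>C (H_elt i 0 * H_elt i 0)"
      by (simp add: J_h_def H_tilde_def)
    moreover have "theta m n i \<in> S" using th(1) i by simp
    ultimately show ?thesis using Jh[OF i] H0[OF i] subalgD(1-4)[OF sub] by metis
  qed
  have gens: "gen g \<in> S" if "g \<in> yangian_gens m n" for g
    using that X0 X1 H0 H1 unfolding yangian_gens_def X_elt_def H_elt_def by auto
  obtain f where f: "f \<in> YC" "a = Y.cls f" using assms(4) by (auto simp: A_carrier)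
  from f(1) one have "f \<in> S"
    by (induction f rule: free_algebra_induct) (auto intro: subalgD[OF sub] gens)
  then show ?thesis using f(2) assms(5) by (simp add: S_def)
qed

text \<open>Worded like the property in the theorem, so that folding it there leaves existence and
  uniqueness as two separate facts.\<close>

definition sw_action where
  "sw_action ac \<longleftrightarrow> left_supermodule A (yangian_part m n lam) WW (sw_part m n l lam M ract) ac \<and>
    (\<forall>i\<in>{1..m + n - 1}. \<forall>x\<in>carrier M. \<forall>v\<in>carrier V.
      ac (y (H_elt i 0)) (t x v) = t x (sg m i *\<^sub>C unit_op m l i i v - sg m (i + 1) *\<^sub>C unit_op m l (i + 1) (i + 1) v) \<and>
      ac (y (X_elt Plus i 0)) (t x v) = t x (unit_op m l i (i + 1) v) \<and>
      ac (y (X_elt Minus i 0)) (t x v) = sg m i \<odot>\<^bsub>WW\<^esub> t x (unit_op m l (i + 1) i v) \<and>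
      ac (y (J_h m n lam i)) (t x v) = (\<Oplus>\<^bsub>WW\<^esub>k\<in>{1..l}. t (ract x (hecke_z l lam k))
        (sg m i *\<^sub>C unit_at m i i k v - sg m (i + 1) *\<^sub>C unit_at m (i + 1) (i + 1) k v)) \<and>
      ac (y (J_x m n lam Plus i)) (t x v) = (\<Oplus>\<^bsub>WW\<^esub>k\<in>{1..l}. t (ract x (hecke_z l lam k)) (unit_at m i (i + 1) k v)) \<and>
      ac (y (J_x m n lam Minus i)) (t x v) =
        sg m i \<odot>\<^bsub>WW\<^esub> (\<Oplus>\<^bsub>WW\<^esub>k\<in>{1..l}. t (ract x (hecke_z l lam k)) (unit_at m (i + 1) i k v)))"

lemma sw_action_act: "sw_action act"
  unfolding sw_action_def left_supermodule_def
  by (intro conjI ballI allI act_left_module act_super act_H0 act_X0 act_X0' act_J_h act_J_plus act_J_minus)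

lemma sw_action_unique:
  assumes a1: "sw_action a1" and a2: "sw_action a2" and "a \<in> carrier A" "w \<in> carrier WW"
  shows "a1 a w = a2 a w"
proof (rule action_unique[OF _ _ _ assms(3,4)])
  show "left_module A WW a1" "left_module A WW a2"
    using a1 a2 by (simp_all add: sw_action_def left_supermodule_def)
  fix i x v assume that: "i \<in> {1..m + n - 1}" "x \<in> carrier M" "v \<in> carrier V"
  have e: "P e" if "P Plus" "P Minus" for P e using that by (cases e) auto
  note r = a1[unfolded sw_action_def, THEN conjunct2, rule_format, OF that]
    a2[unfolded sw_action_def, THEN conjunct2, rule_format, OF that]
  show "a1 (y (H_elt i 0)) (t x v) = a2 (y (H_elt i 0)) (t x v) \<and>
    (\<forall>e. a1 (y (X_elt e i 0)) (t x v) = a2 (y (X_elt e i 0)) (t x v)) \<and>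
    a1 (y (J_h m n lam i)) (t x v) = a2 (y (J_h m n lam i)) (t x v) \<and>
    (\<forall>e. a1 (y (J_x m n lam e i)) (t x v) = a2 (y (J_x m n lam e i)) (t x v))"
    by (intro conjI allI; (rule e)?) (simp_all only: r)
qed

end

theorem theorem4p5:
  fixes m n l :: nat
    and lam :: complex
    and M :: "(complex, 'm) module"
    and ract :: "'m \<Rightarrow> hecke_gen free set \<Rightarrow> 'm"
  assumes "m \<ge> 2" and "n \<ge> 2" and "m \<noteq> n" and "l \<ge> 1"
    and "right_module (hecke l lam) M ract"
  shows "let W = sw_space m n l lam M ract;
             t = sw_tensor m n l lam M ract;
             y = yangian_class m n lam;
             z = hecke_z l lam;
             E = unit_op m l;
             Ek = unit_at m;
             is_action = (\<lambda>act.
               left_supermodule (yangian m n lam) (yangian_part m n lam)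
                 W (sw_part m n l lam M ract) act \<and>
               (\<forall>i\<in>{1..m + n - 1}. \<forall>x\<in>carrier M. \<forall>v\<in>carrier (tensor_power m n l).
                  act (y (H_elt i 0)) (t x v) =
                    t x (sg m i *\<^sub>C E i i v - sg m (i + 1) *\<^sub>C E (i + 1) (i + 1) v) \<and>
                  act (y (X_elt Plus i 0)) (t x v) = t x (E i (i + 1) v) \<and>
                  act (y (X_elt Minus i 0)) (t x v) = sg m i \<odot>\<^bsub>W\<^esub> t x (E (i + 1) i v) \<and>
                  act (y (J_h m n lam i)) (t x v) =
                    (\<Oplus>\<^bsub>W\<^esub>k\<in>{1..l}. t (ract x (z k))
                       (sg m i *\<^sub>C Ek i i k v - sg m (i + 1) *\<^sub>C Ek (i + 1) (i + 1) k v)) \<and>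
                  act (y (J_x m n lam Plus i)) (t x v) =
                    (\<Oplus>\<^bsub>W\<^esub>k\<in>{1..l}. t (ract x (z k)) (Ek i (i + 1) k v)) \<and>
                  act (y (J_x m n lam Minus i)) (t x v) =
                    sg m i \<odot>\<^bsub>W\<^esub> (\<Oplus>\<^bsub>W\<^esub>k\<in>{1..l}. t (ract x (z k)) (Ek (i + 1) i k v))))
         in (\<exists>act. is_action act) \<and>
            (\<forall>act act'. is_action act \<longrightarrow> is_action act' \<longrightarrow>
               (\<forall>a\<in>carrier (yangian m n lam). \<forall>w\<in>carrier W. act a w = act' a w))"
proof -
  interpret yangian_action l lam m n M ract
    by unfold_locales (use assms in auto)
  show ?thesis
    unfolding Let_def sw_action_def[symmetric] using sw_action_act sw_action_unique by blast
qed

end
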